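(* Let $h$ be a boundary function, and suppose that either (1) (Poly-$R_1$) and $\mathbf{HK}^h_B$ hold, or (2) (Poly-$\infty$) and $\mathbf{HK}^h_U$ hold. Let $G_D(x,y):=\int_0^\infty q(t,x,y)\,dt$ be the Green function of $X$. Suppose that $C_0=0$ or $\gamma<\beta_1+1$, that $h$ is regular, and that (H2* ) holds. Then the following hold for $x,y\in D$, $x\ne y$. (a) Suppose also that one of the following holds: (1) $d_1>\alpha_2(\beta_2\wedge1)$, or (2) $d_1=d_2=\alpha_1\beta_1=\alpha_2\beta_2$, or (3) $d_2<\alpha_1\beta_1$. Then $$G_D(x,y)\simeq h(\Phi(\rho(x,y)),x,y)\,g_0(x,y).$$ (b) If $d_2<\alpha_1(\beta_1-\gamma)$, then $$G_D(x,y)\simeq\begin{cases}h(1,x,y), & \text{when } \mathbf{HK}^h_B \text{ holds},\\ \infty, & \text{when } \mathbf{HK}^h_U\text{ holds}.\end{cases}$$ (c) If $\alpha_1=\alpha_2$, $\beta_1=\beta_2$, $\gamma=\gamma_*$ and $d_1=d_2=\alpha_1(\beta_1-\gamma)$, then $$G_D(x,y)\simeq\begin{cases}h(1,x,y)\log\Big(e+\dfrac{\mathrm{diam}(D)}{\rho(x,y)\vee\delta_\vee(x,y)}\Big), & \text{when } \mathbf{HK}^h_B \text{ holds},\\ \infty, & \text{when } \mathbf{HK}^h_U\text{ holds}.\end{cases}$$ ($G_D\simeq\infty$ means $G_D(x,y)=\infty$.)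
   Context: Notation: $a\wedge b=\min$, $a\vee b=\max$; $f\simeq g$ means $c_1g\le f\le c_2g$ on the specified range for some constants $c_1,c_2>0$. Quotients $c/0$ with $c>0$ are $+\infty$. Subordinator: $S=(S_t)_{t\ge0}$ is a driftless subordinator (non-decreasing pure-jump Lévy process, $S_0=0$) with Laplace exponent $\phi(\lambda)=-\log\mathbb{E}e^{-\lambda S_1}=\int_0^\infty(1-e^{-\lambda s})\nu(ds)$ and $w(r):=\nu(r,\infty)$. Condition (Poly-$R_1$), $R_1\in(0,\infty]$: there are constants $c_1,c_2>0$, $\beta_2\ge\beta_1>0$ with $c_1(R/r)^{\beta_1}\le w(r)/w(R)\le c_2(R/r)^{\beta_2}$ for all $0<r\le R<R_1$. (Poly-$\infty$) is the case $R_1=\infty$. Space and process: $(E,\rho)$ is a locally compact separable metric space in which all bounded closed sets are compact, $m$ is a positive Radon measure on $E$ with full support, $B(x,r)$ is the open ball, $V(x,r)=m(B(x,r))$. There are $R_E\in(0,\infty]$ and $d_2\ge d_1>0$ such that for every $a\ge1$ there is $C_V\ge1$ with $C_V^{-1}(R/r)^{d_1}\le V(x,R)/V(x,r)\le C_V(R/r)^{d_2}$ for all $x\in E$, $0<r\le R<aR_E$. $D\subset E$ is a proper open subset, $\delta_D(x)=\rho(x,E\setminus D)$, $\delta_\wedge(x,y)=\delta_D(x)\wedge\delta_D(y)$, $\delta_\vee(x,y)=\delta_D(x)\vee\delta_D(y)$. $Y^D$ is a Hunt process in $D$ independent of $S$ whose semigroup has a density (heat kernel) $p_D(t,x,y)$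 with respect to $m$; $X_t=Y^D_{S_t}$ has heat kernel $q(t,x,y)=\int_0^\infty p_D(s,x,y)\mathbb{P}(S_t\in ds)$. Scale functions: $\Phi,\Psi:[0,\infty)\to[0,\infty)$ are strictly increasing, $\Psi\ge\Phi$, and for some constants $\alpha_1,\dots,\alpha_4,c_1,\dots,c_4>0$ and all $R\ge r>0$: $c_1(R/r)^{\alpha_1}\le\Phi(R)/\Phi(r)\le c_2(R/r)^{\alpha_2}$ and $c_3(R/r)^{\alpha_3}\le\Psi(R)/\Psi(r)\le c_4(R/r)^{\alpha_4}$. Set $\psi(r)=1/\phi(1/\Phi(r))$. If $D$ is unbounded, $\Phi(\mathrm{diam}(D))$ is read as $\infty$. Boundary function: $h:(0,\infty)\times D\times D\to[0,1]$ such that (H1) $s\mapsto h(s,x,y)$ is non-increasing for all $x,y\in D$; (H2) there are $c_1>0$, $\gamma\ge0$ with $s^\gamma h(s,x,y)\le c_1t^\gamma h(t,x,y)$ for $0<s\le t<4\Phi(\mathrm{diam}(D))+1$, $x,y\in D$. $h$ is regular if there is $c_2>0$ with $h(t,x,y)\ge c_2$ whenever $0<t<4\Phi(\mathrm{diam}(D))+1$ and $\delta_\wedge(x,y)\ge\Phi^{-1}(t)$. (H2* ): there are $c_1,\gamma_*>0$ such that $s^{\gamma_*}h(s,x,y)\ge c_1t^{\gamma_*}h(t,x,y)$ for all $x,y\in D$ and $\Phi(\delta_\vee(x,y))\le s\le t<2\Phi(\mathrm{diam}(D))$. Heat kernel conditions: for $C_0\in\{0,1\}$ and $c>0$ put $$I_{c}(t,x,y)=\frac1{V(x,\Phi^{-1}(t))}\wedge\Big(\frac{C_0t}{V(x,\rho(x,y))\Psi(\rho(x,y))}+\frac1{V(x,\Phi^{-1}(t))}\exp\Big(-\frac{c\,\rho(x,y)^2}{\Phi^{-1}(t)^2}\Big)\Big)$$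 (the first summand is absent if $C_0=0$). $\mathbf{HK}^h_B$: $D$ is bounded; (i) there are $C_0\in\{0,1\}$ and $c_1,c_2,c_3,c_4>0$ with $c_1h(t,x,y)I_{c_2}(t,x,y)\le p_D(t,x,y)\le c_3h(t,x,y)I_{c_4}(t,x,y)$ for all $(t,x,y)\in(0,1]\times D\times D$; (ii) there is $\lambda_D>0$ with $p_D(t,x,y)\simeq e^{-\lambda_Dt}h(1,x,y)$ for $(t,x,y)\in[1,\infty)\times D\times D$. $\mathbf{HK}^h_U$: $R_E=\infty$ and the two-sided estimate in (i) holds for all $(t,x,y)\in(0,\infty)\times D\times D$. In the claim, $C_0,d_1,d_2,\beta_1,\beta_2,\alpha_1,\alpha_2,\gamma,\gamma_*$ are the constants in these conditions. Standing convention: when (Poly-$R_1$) and $\mathbf{HK}^h_B$ hold, $\Phi$ is normalized (by multiplication by a constant) so that $\Phi(\mathrm{diam}(D))<R_1/8$. The function $g_0$: $$g_0(x,y)=\begin{cases}\dfrac{\psi(\rho(x,y))}{V(x,\rho(x,y))}, & d_1>\alpha_2(\beta_2\wedge1),\\[6pt] \log\Big(e+\dfrac{\delta_\vee(x,y)}{\rho(x,y)}\Big), & d_1=d_2=\alpha_1\beta_1=\alpha_2\beta_2,\\[6pt] \dfrac{\psi(\rho(x,y)\vee\delta_\vee(x,y))}{V(x,\rho(x,y)\vee\delta_\vee(x,y))}, & d_2<\alpha_1\beta_1.\end{cases}$$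
   Formalization: Case (a)(3) additionally assumes d_1 > α_2((β_2∧1) − γ_* ), since otherwise (a)(3) contradicts (b) when HK_U holds; and HK_U is taken to include that D is unbounded, since a bounded D could otherwise satisfy both HK_B and HK_U and make (b) contradictory. *)

theory Defs
  imports "HOL-Probability.Probability"
begin

section \<open>The state space\<close>

text \<open>
  The space E is the universe of a type of class \<open>{heine_borel, second_countable_topology}\<close>:
  a separable metric space whose bounded closed sets are compact (hence locally compact).
  On such a space a Borel measure that is finite on compact sets is automatically inner and
  outer regular, so finiteness on compact sets is all that being a Radon measure requires.
\<close>

definition radon_measure :: "'a::topological_space measure \<Rightarrow> bool" where
  "radon_measure m \<longleftrightarrow> sets m = sets borel \<and> (\<forall>K. compact K \<longrightarrow> emeasure m K < \<infinity>)"

definition full_support :: "'a::topological_space measure \<Rightarrow> bool" where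
  "full_support m \<longleftrightarrow> (\<forall>U. open U \<longrightarrow> U \<noteq> {} \<longrightarrow> 0 < emeasure m U)"

definition vol :: "'a::metric_space measure \<Rightarrow> 'a \<Rightarrow> real \<Rightarrow> real" where
  "vol m x r = measure m (ball x r)"

definition volume_scaling :: "'a::metric_space measure \<Rightarrow> ereal \<Rightarrow> real \<Rightarrow> real \<Rightarrow> bool" where
  "volume_scaling m R\<^sub>E d1 d2 \<longleftrightarrow>
     0 < R\<^sub>E \<and> 0 < d1 \<and> d1 \<le> d2 \<and>
     (\<forall>a\<ge>1. \<exists>C\<ge>1. \<forall>x r R. 0 < r \<and> r \<le> R \<and> ereal R < ereal a * R\<^sub>E \<longrightarrow>
        (R / r) powr d1 / C \<le> vol m x R / vol m x r \<and>
        vol m x R / vol m x r \<le> C * (R / r) powr d2)"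

definition delta :: "'a::metric_space set \<Rightarrow> 'a \<Rightarrow> real" where
  "delta D x = infdist x (- D)"

definition delta_min :: "'a::metric_space set \<Rightarrow> 'a \<Rightarrow> 'a \<Rightarrow> real" where
  "delta_min D x y = min (delta D x) (delta D y)"

definition delta_max :: "'a::metric_space set \<Rightarrow> 'a \<Rightarrow> 'a \<Rightarrow> real" where
  "delta_max D x y = max (delta D x) (delta D y)"


section \<open>Scale functions\<close>

definition weak_scaling :: "real \<Rightarrow> real \<Rightarrow> (real \<Rightarrow> real) \<Rightarrow> bool" where
  "weak_scaling a b f \<longleftrightarrow>
     0 < a \<and> 0 < b \<and>
     (\<exists>c1>0. \<exists>c2>0. \<forall>r R. 0 < r \<and> r \<le> R \<longrightarrow>
        c1 * (R / r) powr a \<le> f R / f r \<and> f R / f r \<le> c2 * (R / r) powr b)"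

definition scale_function :: "real \<Rightarrow> real \<Rightarrow> (real \<Rightarrow> real) \<Rightarrow> bool" where
  "scale_function a b f \<longleftrightarrow>
     strict_mono_on {0..} f \<and> (\<forall>r\<ge>0. 0 \<le> f r) \<and> weak_scaling a b f"

text \<open>
  Right-continuous inverse. It coincides with the ordinary inverse wherever the latter is
  defined, and gives \<open>\<Phi>\<^sup>-\<^sup>1\<close> a meaning without assuming that \<open>\<Phi>\<close> is continuous.
\<close>

definition scale_inv :: "(real \<Rightarrow> real) \<Rightarrow> real \<Rightarrow> real" where
  "scale_inv f t = Inf {r. 0 \<le> r \<and> t < f r}"

definition scale_diam :: "(real \<Rightarrow> real) \<Rightarrow> 'a::metric_space set \<Rightarrow> ereal" where
  "scale_diam f D = (if bounded D then ereal (f (diameter D)) else \<infinity>)"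


section \<open>Subordinators\<close>

definition levy_measure :: "real measure \<Rightarrow> bool" where
  "levy_measure \<nu> \<longleftrightarrow>
     sets \<nu> = sets borel \<and> emeasure \<nu> {..0} = 0 \<and> (\<integral>\<^sup>+ s. ennreal (min 1 s) \<partial>\<nu>) < \<infinity>"

definition laplace_exponent :: "real measure \<Rightarrow> real \<Rightarrow> real" where
  "laplace_exponent \<nu> u = (LINT s|\<nu>. 1 - exp (- u * s))"

definition levy_tail :: "real measure \<Rightarrow> real \<Rightarrow> real" where
  "levy_tail \<nu> r = measure \<nu> {r<..}"

text \<open>
  A non-decreasing Levy process, on the time set \<open>[0, \<infinity>)\<close>, without killing. That it
  is driftless with Levy measure \<open>\<nu>\<close> is expressed by the form of its Laplace exponent. Left
  limits exist because the paths are non-decreasing.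
\<close>

definition subordinator :: "'w measure \<Rightarrow> (real \<Rightarrow> 'w \<Rightarrow> real) \<Rightarrow> real measure \<Rightarrow> bool" where
  "subordinator M S \<nu> \<longleftrightarrow>
     prob_space M \<and> levy_measure \<nu> \<and>
     (\<forall>t\<ge>0. S t \<in> borel_measurable M) \<and>
     (AE \<omega> in M. S 0 \<omega> = 0) \<and>
     (AE \<omega> in M. mono_on {0..} (\<lambda>t. S t \<omega>) \<and>
        (\<forall>t\<ge>0. continuous (at_right t) (\<lambda>s. S s \<omega>))) \<and>
     (\<forall>s\<ge>0. \<forall>t\<ge>0. distr M borel (\<lambda>\<omega>. S (s + t) \<omega> - S s \<omega>) = distr M borel (S t)) \<and>
     (\<forall>n (t :: nat \<Rightarrow> real). 0 \<le> t 0 \<longrightarrow> (\<forall>i<n. t i \<le> t (Suc i)) \<longrightarrow>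
        prob_space.indep_vars M (\<lambda>_. borel) (\<lambda>i \<omega>. S (t (Suc i)) \<omega> - S (t i) \<omega>) {..<n}) \<and>
     (\<forall>u\<ge>0. - ln (LINT \<omega>|M. exp (- u * S 1 \<omega>)) = laplace_exponent \<nu> u)"

definition Poly_tail :: "ereal \<Rightarrow> real \<Rightarrow> real \<Rightarrow> real measure \<Rightarrow> bool" where
  "Poly_tail R1 b1 b2 \<nu> \<longleftrightarrow>
     0 < R1 \<and> 0 < b1 \<and> b1 \<le> b2 \<and>
     (\<exists>c1>0. \<exists>c2>0. \<forall>r R. 0 < r \<and> r \<le> R \<and> ereal R < R1 \<longrightarrow>
        c1 * (R / r) powr b1 \<le> levy_tail \<nu> r / levy_tail \<nu> R \<and>
        levy_tail \<nu> r / levy_tail \<nu> R \<le> c2 * (R / r) powr b2)"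

definition psi :: "real measure \<Rightarrow> (real \<Rightarrow> real) \<Rightarrow> real \<Rightarrow> real" where
  "psi \<nu> \<Phi> r = 1 / laplace_exponent \<nu> (1 / \<Phi> r)"


section \<open>Hunt processes\<close>

text \<open>
  The cemetery is \<open>None\<close>, and D together with the cemetery carries the topology of the
  one-point compactification of D.
\<close>

abbreviation cemetery_top :: "'a::topological_space set \<Rightarrow> 'a option topology" where
  "cemetery_top D \<equiv> Alexandroff_compactification (top_of_set D)"

abbreviation cemetery_space :: "'a set \<Rightarrow> 'a option set" where
  "cemetery_space D \<equiv> insert None (Some ` D)"

definition cemetery_borel :: "'a::topological_space set \<Rightarrow> 'a option measure" where
  "cemetery_borel D = sigma (cemetery_space D) {U. openin (cemetery_top D) U}"

text \<open>
  Time runs through \<open>[0, \<infinity>]\<close>, with the cemetery as the state at time \<open>\<infinity>\<close>; thus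
  stopping times may be infinite. The strong Markov property and quasi-left continuity are
  required under each \<open>P x\<close>; for a general initial law they follow by integrating over x.
\<close>

definition strong_markov ::
  "'a::topological_space set \<Rightarrow> ('a option \<Rightarrow> 'w measure) \<Rightarrow> (ennreal \<Rightarrow> 'w \<Rightarrow> 'a option) \<Rightarrow>
   (ennreal \<Rightarrow> 'w measure) \<Rightarrow> bool" where
  "strong_markov D P Y Fil \<longleftrightarrow>
     (\<forall>x\<in>cemetery_space D. \<forall>\<sigma>. stopping_time Fil \<sigma> \<longrightarrow>
        (\<forall>s. \<forall>A\<in>sets (cemetery_borel D).
           AE \<omega> in P x.
             real_cond_exp (P x) (filtration.pre_sigma (space (P None)) Fil \<sigma>)
               (\<lambda>\<omega>'. indicator A (Y (\<sigma> \<omega>' + s) \<omega>')) \<omega>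
             = measure (P (Y (\<sigma> \<omega>) \<omega>)) {\<omega>' \<in> space (P None). Y s \<omega>' \<in> A}))"

definition quasi_left_continuous ::
  "'a::topological_space set \<Rightarrow> ('a option \<Rightarrow> 'w measure) \<Rightarrow> (ennreal \<Rightarrow> 'w \<Rightarrow> 'a option) \<Rightarrow>
   (ennreal \<Rightarrow> 'w measure) \<Rightarrow> bool" where
  "quasi_left_continuous D P Y Fil \<longleftrightarrow>
     (\<forall>x\<in>cemetery_space D. \<forall>\<sigma> :: nat \<Rightarrow> 'w \<Rightarrow> ennreal.
        (\<forall>n. stopping_time Fil (\<sigma> n)) \<longrightarrow> (\<forall>\<omega>\<in>space (P None). incseq (\<lambda>n. \<sigma> n \<omega>)) \<longrightarrow>
        (AE \<omega> in P x. (SUP n. \<sigma> n \<omega>) < \<infinity> \<longrightarrow>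
           limitin (cemetery_top D) (\<lambda>n. Y (\<sigma> n \<omega>) \<omega>) (Y (SUP n. \<sigma> n \<omega>) \<omega>) sequentially))"

definition hunt_process ::
  "'a::topological_space set \<Rightarrow> ('a option \<Rightarrow> 'w measure) \<Rightarrow> (ennreal \<Rightarrow> 'w \<Rightarrow> 'a option) \<Rightarrow> bool"
where
  "hunt_process D P Y \<longleftrightarrow>
     (\<forall>x\<in>cemetery_space D.
        prob_space (P x) \<and> space (P x) = space (P None) \<and> sets (P x) = sets (P None)) \<and>
     (\<forall>t. Y t \<in> P None \<rightarrow>\<^sub>M cemetery_borel D) \<and>
     (\<forall>t. \<forall>A\<in>sets (cemetery_borel D).
        (\<lambda>x. measure (P x) {\<omega> \<in> space (P None). Y t \<omega> \<in> A})
          \<in> borel_measurable (cemetery_borel D)) \<and>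
     (\<forall>x\<in>cemetery_space D. AE \<omega> in P x. Y 0 \<omega> = x) \<and>
     (\<forall>\<omega>\<in>space (P None). Y \<infinity> \<omega> = None) \<and>
     (\<forall>\<omega>\<in>space (P None). \<forall>s t. s \<le> t \<longrightarrow> Y s \<omega> = None \<longrightarrow> Y t \<omega> = None) \<and>
     (\<exists>\<theta> :: ennreal \<Rightarrow> 'w \<Rightarrow> 'w. \<forall>\<omega>\<in>space (P None). \<forall>s. \<forall>t<\<infinity>.
        \<theta> t \<omega> \<in> space (P None) \<and> Y s (\<theta> t \<omega>) = Y (s + t) \<omega>) \<and>
     (\<forall>\<omega>\<in>space (P None). \<forall>t<\<infinity>.
        limitin (cemetery_top D) (\<lambda>s. Y s \<omega>) (Y t \<omega>) (at_right t)) \<and>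
     (\<forall>\<omega>\<in>space (P None). \<forall>t. 0 < t \<longrightarrow> t < \<infinity> \<longrightarrow>
        (\<exists>l. limitin (cemetery_top D) (\<lambda>s. Y s \<omega>) l (at_left t))) \<and>
     (\<exists>Fil. filtration (space (P None)) Fil \<and>
        (\<forall>t. sets (Fil t) \<subseteq> sets (P None)) \<and>
        (\<forall>t<\<infinity>. sets (Fil t) = (\<Inter>s\<in>{t<..}. sets (Fil s))) \<and>
        (\<forall>t. Y t \<in> Fil t \<rightarrow>\<^sub>M cemetery_borel D) \<and>
        strong_markov D P Y Fil \<and> quasi_left_continuous D P Y Fil)"

text \<open>Independence of the sigma-algebras generated by the two processes.\<close>

definition independent_processes ::
  "'a::topological_space set \<Rightarrow> 'w measure \<Rightarrow> (ennreal \<Rightarrow> 'w \<Rightarrow> 'a option) \<Rightarrow>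
   (real \<Rightarrow> 'w \<Rightarrow> real) \<Rightarrow> bool" where
  "independent_processes D M Y S \<longleftrightarrow>
     prob_space.indep_set M
       (sets (vimage_algebra (space M) (\<lambda>\<omega> t. Y t \<omega>) (\<Pi>\<^sub>M t\<in>UNIV. cemetery_borel D)))
       (sets (vimage_algebra (space M) (\<lambda>\<omega>. \<lambda>t\<in>{0..}. S t \<omega>) (\<Pi>\<^sub>M t\<in>{0..}. borel)))"

definition heat_kernel ::
  "'a::metric_space measure \<Rightarrow> 'a set \<Rightarrow> ('a option \<Rightarrow> 'w measure) \<Rightarrow>
   (ennreal \<Rightarrow> 'w \<Rightarrow> 'a option) \<Rightarrow> (real \<Rightarrow> 'a \<Rightarrow> 'a \<Rightarrow> real) \<Rightarrow> bool" where
  "heat_kernel m D P Y p \<longleftrightarrow>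
     (\<lambda>(t, x, y). p t x y) \<in> borel_measurable (restrict_space borel ({0<..} \<times> D \<times> D)) \<and>
     (\<forall>t>0. \<forall>x\<in>D. \<forall>y\<in>D. 0 \<le> p t x y) \<and>
     (\<forall>t>0. \<forall>x\<in>D. \<forall>A\<in>sets borel. A \<subseteq> D \<longrightarrow>
        emeasure (P (Some x)) {\<omega> \<in> space (P None). Y (ennreal t) \<omega> \<in> Some ` A}
        = (\<integral>\<^sup>+ y\<in>A. ennreal (p t x y) \<partial>m))"

text \<open>
  The heat kernel of the subordinate process \<open>X t \<omega> = Y (S t \<omega>) \<omega>\<close>. The law of \<open>S t\<close>
  is the same under every \<open>P (Some x)\<close>.
\<close>

definition subordinate_kernel ::
  "('a option \<Rightarrow> 'w measure) \<Rightarrow> (real \<Rightarrow> 'w \<Rightarrow> real) \<Rightarrow> (real \<Rightarrow> 'a \<Rightarrow> 'a \<Rightarrow> real) \<Rightarrow>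
   real \<Rightarrow> 'a \<Rightarrow> 'a \<Rightarrow> ennreal" where
  "subordinate_kernel P S p t x y =
     (\<integral>\<^sup>+ s\<in>{0<..}. ennreal (p s x y) \<partial>distr (P (Some x)) borel (S t))"

definition green_function ::
  "('a option \<Rightarrow> 'w measure) \<Rightarrow> (real \<Rightarrow> 'w \<Rightarrow> real) \<Rightarrow> (real \<Rightarrow> 'a \<Rightarrow> 'a \<Rightarrow> real) \<Rightarrow>
   'a \<Rightarrow> 'a \<Rightarrow> ennreal" where
  "green_function P S p x y = (\<integral>\<^sup>+ t\<in>{0<..}. subordinate_kernel P S p t x y \<partial>lborel)"


section \<open>Boundary functions\<close>

definition boundary_function ::
  "(real \<Rightarrow> real) \<Rightarrow> 'a::metric_space set \<Rightarrow> real \<Rightarrow> (real \<Rightarrow> 'a \<Rightarrow> 'a \<Rightarrow> real) \<Rightarrow> bool" where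
  "boundary_function \<Phi> D \<gamma> h \<longleftrightarrow>
     0 \<le> \<gamma> \<and>
     (\<forall>t>0. \<forall>x\<in>D. \<forall>y\<in>D. 0 \<le> h t x y \<and> h t x y \<le> 1) \<and>
     (\<forall>x\<in>D. \<forall>y\<in>D. \<forall>s t. 0 < s \<and> s \<le> t \<longrightarrow> h t x y \<le> h s x y) \<and>
     (\<exists>c1>0. \<forall>x\<in>D. \<forall>y\<in>D. \<forall>s t.
        0 < s \<and> s \<le> t \<and> ereal t < 4 * scale_diam \<Phi> D + 1 \<longrightarrow>
        s powr \<gamma> * h s x y \<le> c1 * (t powr \<gamma> * h t x y))"

definition regular_boundary_function ::
  "(real \<Rightarrow> real) \<Rightarrow> 'a::metric_space set \<Rightarrow> (real \<Rightarrow> 'a \<Rightarrow> 'a \<Rightarrow> real) \<Rightarrow> bool" where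
  "regular_boundary_function \<Phi> D h \<longleftrightarrow>
     (\<exists>c2>0. \<forall>x\<in>D. \<forall>y\<in>D. \<forall>t.
        0 < t \<and> ereal t < 4 * scale_diam \<Phi> D + 1 \<and> scale_inv \<Phi> t \<le> delta_min D x y \<longrightarrow>
        c2 \<le> h t x y)"

definition H2_star ::
  "(real \<Rightarrow> real) \<Rightarrow> 'a::metric_space set \<Rightarrow> real \<Rightarrow> (real \<Rightarrow> 'a \<Rightarrow> 'a \<Rightarrow> real) \<Rightarrow> bool" where
  "H2_star \<Phi> D \<gamma>' h \<longleftrightarrow>
     0 < \<gamma>' \<and>
     (\<exists>c1>0. \<forall>x\<in>D. \<forall>y\<in>D. \<forall>s t.
        \<Phi> (delta_max D x y) \<le> s \<and> s \<le> t \<and> ereal t < 2 * scale_diam \<Phi> D \<longrightarrow>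
        c1 * (t powr \<gamma>' * h t x y) \<le> s powr \<gamma>' * h s x y)"


section \<open>Heat kernel conditions\<close>

text \<open>
  For x = y the first summand of the bracket is 1/0. Its value is irrelevant: both for
  1/0 = 0 and for 1/0 = \<open>\<infinity>\<close> the minimum below equals \<open>1 / vol m x (scale_inv \<Phi> t)\<close>.
\<close>

definition hk_profile ::
  "'a::metric_space measure \<Rightarrow> (real \<Rightarrow> real) \<Rightarrow> (real \<Rightarrow> real) \<Rightarrow> real \<Rightarrow> real \<Rightarrow>
   real \<Rightarrow> 'a \<Rightarrow> 'a \<Rightarrow> real" where
  "hk_profile m \<Phi> \<Psi> C0 c t x y =
     min (1 / vol m x (scale_inv \<Phi> t))
         (C0 * t / (vol m x (dist x y) * \<Psi> (dist x y)) +
          1 / vol m x (scale_inv \<Phi> t) * exp (- c * (dist x y)\<^sup>2 / (scale_inv \<Phi> t)\<^sup>2))"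

definition hk_two_sided ::
  "'a::metric_space measure \<Rightarrow> 'a set \<Rightarrow> (real \<Rightarrow> real) \<Rightarrow> (real \<Rightarrow> real) \<Rightarrow> real \<Rightarrow>
   (real \<Rightarrow> 'a \<Rightarrow> 'a \<Rightarrow> real) \<Rightarrow> (real \<Rightarrow> 'a \<Rightarrow> 'a \<Rightarrow> real) \<Rightarrow> real set \<Rightarrow> bool" where
  "hk_two_sided m D \<Phi> \<Psi> C0 h p T \<longleftrightarrow>
     C0 \<in> {0, 1} \<and>
     (\<exists>c1>0. \<exists>c2>0. \<exists>c3>0. \<exists>c4>0. \<forall>t\<in>T. \<forall>x\<in>D. \<forall>y\<in>D.
        c1 * h t x y * hk_profile m \<Phi> \<Psi> C0 c2 t x y \<le> p t x y \<and>
        p t x y \<le> c3 * h t x y * hk_profile m \<Phi> \<Psi> C0 c4 t x y)"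

definition HK_B ::
  "'a::metric_space measure \<Rightarrow> 'a set \<Rightarrow> (real \<Rightarrow> real) \<Rightarrow> (real \<Rightarrow> real) \<Rightarrow> real \<Rightarrow>
   (real \<Rightarrow> 'a \<Rightarrow> 'a \<Rightarrow> real) \<Rightarrow> (real \<Rightarrow> 'a \<Rightarrow> 'a \<Rightarrow> real) \<Rightarrow> bool" where
  "HK_B m D \<Phi> \<Psi> C0 h p \<longleftrightarrow>
     bounded D \<and> hk_two_sided m D \<Phi> \<Psi> C0 h p {0<..1} \<and>
     (\<exists>l>0. \<exists>c1>0. \<exists>c2>0. \<forall>t\<ge>1. \<forall>x\<in>D. \<forall>y\<in>D.
        c1 * (exp (- l * t) * h 1 x y) \<le> p t x y \<and>
        p t x y \<le> c2 * (exp (- l * t) * h 1 x y))"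

text \<open>
  \<open>HK_U\<close> is the condition for unbounded D (as \<open>HK_B\<close> is that for bounded D). Without
  this requirement a bounded D could satisfy both conditions at once.
\<close>

definition HK_U ::
  "'a::metric_space measure \<Rightarrow> ereal \<Rightarrow> 'a set \<Rightarrow> (real \<Rightarrow> real) \<Rightarrow> (real \<Rightarrow> real) \<Rightarrow> real \<Rightarrow>
   (real \<Rightarrow> 'a \<Rightarrow> 'a \<Rightarrow> real) \<Rightarrow> (real \<Rightarrow> 'a \<Rightarrow> 'a \<Rightarrow> real) \<Rightarrow> bool" where
  "HK_U m R\<^sub>E D \<Phi> \<Psi> C0 h p \<longleftrightarrow>
     \<not> bounded D \<and> R\<^sub>E = \<infinity> \<and> hk_two_sided m D \<Phi> \<Psi> C0 h p {0<..}"


section \<open>Green function estimates\<close>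

text \<open>The three cases are mutually exclusive; the value 0 outside of them is a dummy.\<close>

definition g0 ::
  "'a::metric_space measure \<Rightarrow> 'a set \<Rightarrow> real measure \<Rightarrow> (real \<Rightarrow> real) \<Rightarrow>
   real \<Rightarrow> real \<Rightarrow> real \<Rightarrow> real \<Rightarrow> real \<Rightarrow> real \<Rightarrow> 'a \<Rightarrow> 'a \<Rightarrow> real" where
  "g0 m D \<nu> \<Phi> d1 d2 \<alpha>1 \<alpha>2 \<beta>1 \<beta>2 x y =
     (if d1 > \<alpha>2 * min \<beta>2 1 then psi \<nu> \<Phi> (dist x y) / vol m x (dist x y)
      else if d1 = d2 \<and> d2 = \<alpha>1 * \<beta>1 \<and> \<alpha>1 * \<beta>1 = \<alpha>2 * \<beta>2
        then ln (exp 1 + delta_max D x y / dist x y)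
      else if d2 < \<alpha>1 * \<beta>1
        then psi \<nu> \<Phi> (max (dist x y) (delta_max D x y))
             / vol m x (max (dist x y) (delta_max D x y))
      else 0)"

definition comparable_off_diagonal ::
  "'a set \<Rightarrow> ('a \<Rightarrow> 'a \<Rightarrow> ennreal) \<Rightarrow> ('a \<Rightarrow> 'a \<Rightarrow> real) \<Rightarrow> bool" where
  "comparable_off_diagonal D G f \<longleftrightarrow>
     (\<exists>c1>0. \<exists>c2>0. \<forall>x\<in>D. \<forall>y\<in>D. x \<noteq> y \<longrightarrow>
        ennreal (c1 * f x y) \<le> G x y \<and> G x y \<le> ennreal (c2 * f x y))"

end

theory Submission
  imports Defs
begin

text \<open>
  Write \<open>\<rho>\<close> for the distance of x and y, V for the volume, and \<open>\<phi>\<close> for the Laplace exponent of the subordinator.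
  The Green function is the integral of the heat kernel of Y against the potential measure U of the
  subordinator, and U enters only through its values on intervals. The Laplace transform of the law of \<open>S t\<close> is
  \<open>exp (- t * \<phi> u)\<close>, and Markov-type inequalities bound the potential of \<open>{0<..r}\<close> by a multiple of
  \<open>1 / \<phi> (1 / r)\<close>. The power growth of \<open>\<phi>\<close>, inherited from the Levy tail (\<open>laplace_exponent_scaling\<close>), provides a
  ratio K such that \<open>{r / K<..r}\<close> already carries a fixed fraction of it (\<open>potential_upper\<close>, \<open>potential_lower\<close>).

  For times s above \<open>\<Phi> \<rho>\<close> the heat kernel is of the order \<open>h s x y / V\<close>, with the volume of the ball
  with radius \<open>scale_inv \<Phi> s\<close>. For smaller times it is at most \<open>(s / \<Phi> \<rho>) powr \<theta>\<close> times its order at \<open>\<Phi> \<rho>\<close>,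
  with \<open>\<theta> > - \<beta>1\<close>; this is the point of the hypothesis that \<open>C0 = 0\<close> or \<open>\<gamma> < \<beta>1 + 1\<close>, and it makes these times as
  harmless as the times of order \<open>\<Phi> \<rho>\<close>. In a bounded set the heat kernel decays exponentially beyond the scale of the
  diameter, and these times are as harmless as the times of the order of that scale. Therefore the Green function is comparable to the sum, over the
  points s of the grid \<open>K ^ n * \<Phi> \<rho>\<close> up to the scale of the diameter, of
  \<open>h s x y * b s x\<close> with \<open>b s x = 1 / (V * \<phi> (1 / s))\<close> (\<open>green_function_comparable_series\<close>).

  It remains to sum this series. From scale s to scale t, b changes at least by \<open>(t / s) powr p1\<close> and at most by
  \<open>(t / s) powr p2\<close>, where \<open>p1 = \<beta>1 - d2 / \<alpha>1\<close> and \<open>p2 = min \<beta>2 1 - d1 / \<alpha>2\<close>. The boundary function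
  never increases and loses at most \<open>(s / t) powr \<gamma>\<close>. Up to the scale of the larger distance to the boundary it is of
  order 1 (unless that scale is of order \<open>\<Phi> \<rho>\<close>), and beyond it loses at least \<open>(s / t) powr \<gamma>'\<close>. The
  cases of the theorem are conditions on \<open>p1\<close> and \<open>p2\<close>:
  \<^item> \<open>p2 < 0\<close>: the terms decrease geometrically, and the first one dominates (\<open>green_local_scale\<close>);
  \<^item> \<open>p1 = p2 = 0\<close>: they are constant up to the scale of the boundary and decrease beyond, so that one counts
    scales, which gives a logarithm (\<open>green_logarithmic\<close>);
  \<^item> \<open>0 < p1\<close> and \<open>p2 < \<gamma>'\<close>: they increase up to the scale of the boundary and decrease beyond, and the
    term at that scale dominates (\<open>green_intermediate_scale\<close>);
  \<^item> \<open>\<gamma> < p1\<close>: they increase throughout; the last one dominates, or the series diverges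
    (\<open>green_top_scale\<close>, \<open>green_infinite\<close>);
  \<^item> \<open>p1 = p2 = \<gamma> = \<gamma>'\<close>: they are constant from the scale of the boundary on, which gives a
    logarithm or divergence (\<open>green_top_logarithmic\<close>, \<open>green_infinite\<close>).
\<close>

section \<open>Laplace exponents and Levy tails\<close>

lemma levy_tail_finite:
  assumes "levy_measure \<nu>" "0 < r"
  shows "emeasure \<nu> {r<..} < \<infinity>"
proof -
  have s[measurable_cong]: "sets \<nu> = sets borel" using assms by (simp add: levy_measure_def)
  have "ennreal (min 1 r) * emeasure \<nu> {r<..} = (\<integral>\<^sup>+ s. ennreal (min 1 r) * indicator {r<..} s \<partial>\<nu>)"
    by (subst nn_integral_cmult_indicator) auto
  also have "\<dots> \<le> (\<integral>\<^sup>+ s. ennreal (min 1 s) \<partial>\<nu>)"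
    by (intro nn_integral_mono) (auto split: split_indicator intro!: ennreal_leI)
  also have "\<dots> < \<infinity>" using assms by (simp add: levy_measure_def)
  finally have "ennreal (min 1 r) * emeasure \<nu> {r<..} < \<infinity>" .
  moreover have "0 < ennreal (min 1 r)" using assms by simp
  ultimately show ?thesis
    using assms(2) by (auto simp: ennreal_mult_less_top)
qed

lemma levy_AE_pos:
  assumes "levy_measure \<nu>"
  shows "AE s in \<nu>. 0 < s"
proof -
  have s: "sets \<nu> = sets borel" using assms by (simp add: levy_measure_def)
  have "{..0} \<in> null_sets \<nu>" using assms s by (auto simp: levy_measure_def null_sets_def)
  from AE_not_in[OF this] show ?thesis by (auto elim: eventually_mono)
qed

lemma levy_sigma_finite:
  assumes "levy_measure \<nu>"
  shows "sigma_finite_measure \<nu>"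
proof
  have s: "sets \<nu> = sets borel" using assms by (simp add: levy_measure_def)
  have sp: "space \<nu> = UNIV" using sets_eq_imp_space_eq[OF s] by simp
  let ?A = "insert {..0} (range (\<lambda>n. {inverse (real (Suc n))<..}))"
  have "x \<in> \<Union>?A" for x :: real
  proof (cases "x \<le> 0")
    case False
    then obtain n where "inverse (real (Suc n)) < x"
      using reals_Archimedean[of x] by auto
    then show ?thesis by auto
  qed auto
  then have "\<Union>?A = space \<nu>" using sp by auto
  moreover have "emeasure \<nu> a \<noteq> \<infinity>" if a: "a \<in> ?A" for a
  proof (cases "a = {..0}")
    case True
    then show ?thesis using assms by (simp add: levy_measure_def)
  next
    case False
    then obtain n where "a = {inverse (real (Suc n))<..}" using a by blast
    then show ?thesis using levy_tail_finite[OF assms, of "inverse (real (Suc n))"] by simp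
  qed
  moreover have "?A \<subseteq> sets \<nu>" unfolding s by (simp add: image_subset_iff)
  moreover have "countable ?A" by blast
  ultimately show "\<exists>A. countable A \<and> A \<subseteq> sets \<nu> \<and> \<Union>A = space \<nu> \<and> (\<forall>a\<in>A. emeasure \<nu> a \<noteq> \<infinity>)"
    by blast
qed

lemma one_minus_exp_bounds:
  fixes z :: real assumes "0 \<le> z"
  shows "min 1 z / 2 \<le> 1 - exp (- z)" "1 - exp (- z) \<le> min 1 z"
proof -
  show "1 - exp (- z) \<le> min 1 z"
    using exp_ge_add_one_self[of "-z"] by (auto simp: min_def)
  have e: "exp z \<ge> 1 + z" by (rule exp_ge_add_one_self)
  have "1 + z > 0" using assms by simp
  then have "1 - exp (-z) \<ge> 1 - 1 / (1 + z)"
    using e by (simp add: exp_minus divide_inverse le_imp_inverse_le)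
  moreover have "1 - 1 / (1 + z) = z / (1 + z)" using \<open>1 + z > 0\<close> by (simp add: field_simps)
  moreover have "z / (1 + z) \<ge> min 1 z / 2"
  proof (cases "z \<le> 1")
    case True
    then have "z / (1 + z) \<ge> z / 2" using assms by (intro divide_left_mono) auto
    then show ?thesis using True by simp
  next
    case False
    then show ?thesis by (simp add: field_simps)
  qed
  ultimately show "min 1 z / 2 \<le> 1 - exp (- z)" by linarith
qed

lemma laplace_integrable:
  assumes "levy_measure \<nu>" "0 \<le> u"
  shows "integrable \<nu> (\<lambda>s. 1 - exp (- u * s))"
proof -
  have s[measurable_cong]: "sets \<nu> = sets borel" using assms by (simp add: levy_measure_def)
  have fin: "(\<integral>\<^sup>+ s. ennreal (min 1 s) \<partial>\<nu>) < \<infinity>" using assms by (simp add: levy_measure_def)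
  have "(\<integral>\<^sup>+ s. ennreal (norm (1 - exp (- u * s))) \<partial>\<nu>) \<le> (\<integral>\<^sup>+ s. ennreal (1 + u) * ennreal (min 1 s) \<partial>\<nu>)"
  proof (intro nn_integral_mono_AE)
    show "AE s in \<nu>. ennreal (norm (1 - exp (- u * s))) \<le> ennreal (1 + u) * ennreal (min 1 s)"
      using levy_AE_pos[OF assms(1)]
    proof eventually_elim
      fix s :: real assume "0 < s"
      then have us: "0 \<le> u * s" using assms by simp
      have "1 - exp (- (u * s)) \<le> min 1 (u * s)" using one_minus_exp_bounds(2)[OF us] .
      also have "\<dots> \<le> (1 + u) * min 1 s" 
        using assms \<open>0 < s\<close> by (auto simp: min_def algebra_simps)
      finally show "ennreal (norm (1 - exp (- u * s))) \<le> ennreal (1 + u) * ennreal (min 1 s)"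
        using assms \<open>0 < s\<close> us by (subst ennreal_mult[symmetric]) (auto intro!: ennreal_leI)
    qed
  qed
  also have "\<dots> = ennreal (1 + u) * (\<integral>\<^sup>+ s. ennreal (min 1 s) \<partial>\<nu>)"
    by (intro nn_integral_cmult) auto
  also have "\<dots> < \<infinity>" using fin by (simp add: ennreal_mult_less_top)
  finally show ?thesis by (intro integrableI_bounded) auto
qed

lemma laplace_exponent_mono:
  assumes "levy_measure \<nu>" "0 \<le> u" "u \<le> v"
  shows "laplace_exponent \<nu> u \<le> laplace_exponent \<nu> v"
  unfolding laplace_exponent_def
proof (rule integral_mono_AE)
  show "AE s in \<nu>. 1 - exp (- u * s) \<le> 1 - exp (- v * s)"
    using levy_AE_pos[OF assms(1)] assms by (auto elim!: eventually_mono)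
qed (use assms laplace_integrable[of \<nu>] in auto)

text \<open>
  Concavity of \<open>u \<mapsto> 1 - exp (- u * s)\<close>, integrated.
\<close>
lemma laplace_exponent_mult_le:
  assumes "levy_measure \<nu>" "0 \<le> u" "1 \<le> k"
  shows "laplace_exponent \<nu> (k * u) \<le> k * laplace_exponent \<nu> u"
proof -
  have "laplace_exponent \<nu> (k * u) \<le> (LINT s|\<nu>. k * (1 - exp (- u * s)))"
    unfolding laplace_exponent_def
  proof (rule integral_mono_AE)
    show "AE s in \<nu>. 1 - exp (- (k * u) * s) \<le> k * (1 - exp (- u * s))"
      using levy_AE_pos[OF assms(1)]
    proof eventually_elim
      fix s :: real assume "0 < s"
      define z where "z = u * s"
      have z: "0 \<le> z" using \<open>0 < s\<close> assms by (simp add: z_def)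
      have "exp (- z) * (1 + z) \<le> 1"
        using exp_ge_add_one_self[of z] by (simp add: exp_minus field_simps)
      then have "(k - 1) * (exp (- z) * (1 + z)) \<le> k - 1"
        using assms mult_left_mono[of "exp (- z) * (1 + z)" 1 "k - 1"] by simp
      moreover have "exp (- z) * exp (- ((k - 1) * z)) \<ge> exp (- z) * (1 + - ((k - 1) * z))"
        by (intro mult_left_mono exp_ge_add_one_self) auto
      moreover have "exp (- z) * exp (- ((k - 1) * z)) = exp (- (k * z))"
        by (simp add: mult_exp_exp[symmetric] algebra_simps flip: exp_add)
      ultimately have "1 - exp (- (k * z)) \<le> k * (1 - exp (- z))"
        by (simp add: algebra_simps)
      then show "1 - exp (- (k * u) * s) \<le> k * (1 - exp (- u * s))"
        by (simp add: z_def algebra_simps)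
    qed
  qed (use assms laplace_integrable[of \<nu>] in auto)
  then show ?thesis by (simp add: laplace_exponent_def)
qed

lemma laplace_exponent_pos:
  assumes "levy_measure \<nu>" "0 < r" "0 < levy_tail \<nu> r" "0 < u"
  shows "0 < laplace_exponent \<nu> u"
proof -
  have s[measurable_cong]: "sets \<nu> = sets borel" using assms by (simp add: levy_measure_def)
  have sp: "space \<nu> = UNIV" using sets_eq_imp_space_eq[OF s] by simp
  have "0 < (1 - exp (- u * r)) * levy_tail \<nu> r" using assms by simp
  also have "\<dots> = (LINT s|\<nu>. (1 - exp (- u * r)) * indicator {r<..} s)"
    by (simp add: levy_tail_def sp)
  also have "\<dots> \<le> laplace_exponent \<nu> u"
    unfolding laplace_exponent_def
  proof (rule integral_mono_AE)
    show "integrable \<nu> (\<lambda>s. (1 - exp (- u * r)) * indicator {r<..} s)"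
      using levy_tail_finite[OF assms(1,2)] by (intro integrable_mult_right integrable_real_indicator) auto
    show "AE s in \<nu>. (1 - exp (- u * r)) * indicator {r<..} s \<le> 1 - exp (- u * s)"
      using levy_AE_pos[OF assms(1)] assms by (auto elim!: eventually_mono split: split_indicator)
  qed (use assms laplace_integrable[of \<nu>] in auto)
  finally show ?thesis .
qed

lemma laplace_exponent_0: "laplace_exponent \<nu> 0 = 0"
  by (simp add: laplace_exponent_def)

lemma laplace_exponent_nonneg:
  assumes "levy_measure \<nu>" "0 \<le> u"
  shows "0 \<le> laplace_exponent \<nu> u"
  using laplace_exponent_mono[OF assms(1) order.refl assms(2)] by (simp add: laplace_exponent_0)

text \<open>
  Layer-cake formula. It turns the Laplace exponent, which is comparable to the truncated moment, into
  an average of the Levy tail over scales below \<open>t\<close>; a power bound for the tail on \<open>(0, R)\<close> can then be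
  integrated scale by scale without any information about the tail beyond \<open>R\<close>.
\<close>
lemma truncated_moment_eq_tail_integral:
  assumes "levy_measure \<nu>" "0 < t"
  shows "(\<integral>\<^sup>+ s. ennreal (min 1 (s / t)) \<partial>\<nu>)
       = (\<integral>\<^sup>+ u\<in>{0<..<1}. emeasure \<nu> {u * t<..} \<partial>lborel)"
proof -
  interpret sigma_finite_measure \<nu> by (rule levy_sigma_finite) fact
  interpret pair_sigma_finite lborel \<nu> ..
  have s[measurable_cong]: "sets \<nu> = sets borel" using assms by (simp add: levy_measure_def)
  have "(\<integral>\<^sup>+ s. ennreal (min 1 (s / t)) \<partial>\<nu>)
      = (\<integral>\<^sup>+ s. (\<integral>\<^sup>+ u. (if 0 < u \<and> u < 1 \<and> u * t < s then 1 else 0) \<partial>lborel) \<partial>\<nu>)"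
  proof (rule nn_integral_cong_AE)
    show "AE s in \<nu>. ennreal (min 1 (s / t)) =
        (\<integral>\<^sup>+ u. (if 0 < u \<and> u < 1 \<and> u * t < s then 1 else 0) \<partial>lborel)"
      using levy_AE_pos[OF assms(1)]
    proof eventually_elim
      fix s :: real assume "0 < s"
      have "(\<integral>\<^sup>+ u. (if 0 < u \<and> u < 1 \<and> u * t < s then 1 else 0) \<partial>lborel)
          = (\<integral>\<^sup>+ u. indicator {0<..<min 1 (s / t)} u \<partial>lborel)"
        using \<open>0 < t\<close> by (intro nn_integral_cong) (auto simp: field_simps split: split_indicator)
      also have "\<dots> = ennreal (min 1 (s / t))" using \<open>0 < s\<close> \<open>0 < t\<close> by simp
      finally show "ennreal (min 1 (s / t)) =
        (\<integral>\<^sup>+ u. (if 0 < u \<and> u < 1 \<and> u * t < s then 1 else 0) \<partial>lborel)" by simp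
    qed
  qed
  also have "\<dots> = (\<integral>\<^sup>+ u. (\<integral>\<^sup>+ s. (if 0 < u \<and> u < 1 \<and> u * t < s then 1 else 0) \<partial>\<nu>) \<partial>lborel)"
    by (rule Fubini') simp
  also have "\<dots> = (\<integral>\<^sup>+ u\<in>{0<..<1}. emeasure \<nu> {u * t<..} \<partial>lborel)"
  proof (rule nn_integral_cong)
    fix u :: real
    have "(\<integral>\<^sup>+ s. (if 0 < u \<and> u < 1 \<and> u * t < s then 1 else 0) \<partial>\<nu>)
        = (\<integral>\<^sup>+ s. indicator {0<..<1} u * indicator {u * t<..} s \<partial>\<nu>)"
      by (intro nn_integral_cong) (auto split: split_indicator)
    also have "\<dots> = indicator {0<..<1} u * emeasure \<nu> {u * t<..}"
      by (subst nn_integral_cmult_indicator) auto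
    finally show "(\<integral>\<^sup>+ s. (if 0 < u \<and> u < 1 \<and> u * t < s then 1 else 0) \<partial>\<nu>)
        = emeasure \<nu> {u * t<..} * indicator {0<..<1} u" by (simp add: mult.commute)
  qed
  finally show ?thesis .
qed

text \<open>
  \<open>1 - exp (- z)\<close> and \<open>min 1 z\<close> agree up to a factor 2.
\<close>
lemma truncated_moment_comparable:
  assumes "levy_measure \<nu>" "0 < t"
  shows "ennreal (laplace_exponent \<nu> (1 / t)) \<le> (\<integral>\<^sup>+ s. ennreal (min 1 (s / t)) \<partial>\<nu>)"
    and "(\<integral>\<^sup>+ s. ennreal (min 1 (s / t)) \<partial>\<nu>) \<le> ennreal (2 * laplace_exponent \<nu> (1 / t))"
proof -
  have s[measurable_cong]: "sets \<nu> = sets borel" using assms by (simp add: levy_measure_def)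
  have t: "0 \<le> 1 / t" using assms by simp
  have eq: "ennreal (laplace_exponent \<nu> (1 / t)) = (\<integral>\<^sup>+ s. ennreal (1 - exp (- (1 / t) * s)) \<partial>\<nu>)"
    unfolding laplace_exponent_def
  proof (rule nn_integral_eq_integral[symmetric])
    show "AE s in \<nu>. 0 \<le> 1 - exp (- (1 / t) * s)"
      using levy_AE_pos[OF assms(1)] assms by (auto elim!: eventually_mono)
  qed (use laplace_integrable[OF assms(1) t] in auto)
  show "ennreal (laplace_exponent \<nu> (1 / t)) \<le> (\<integral>\<^sup>+ s. ennreal (min 1 (s / t)) \<partial>\<nu>)"
    unfolding eq
  proof (rule nn_integral_mono_AE)
    show "AE s in \<nu>. ennreal (1 - exp (- (1 / t) * s)) \<le> ennreal (min 1 (s / t))"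
      using levy_AE_pos[OF assms(1)]
    proof eventually_elim
      fix s :: real assume "0 < s"
      then show "ennreal (1 - exp (- (1 / t) * s)) \<le> ennreal (min 1 (s / t))"
        using one_minus_exp_bounds(2)[of "s / t"] assms by (intro ennreal_leI) auto
    qed
  qed
  have "(\<integral>\<^sup>+ s. ennreal (min 1 (s / t)) \<partial>\<nu>) \<le> (\<integral>\<^sup>+ s. ennreal 2 * ennreal (1 - exp (- (1 / t) * s)) \<partial>\<nu>)"
  proof (rule nn_integral_mono_AE)
    show "AE s in \<nu>. ennreal (min 1 (s / t)) \<le> ennreal 2 * ennreal (1 - exp (- (1 / t) * s))"
      using levy_AE_pos[OF assms(1)]
    proof eventually_elim
      fix s :: real assume "0 < s"
      then show "ennreal (min 1 (s / t)) \<le> ennreal 2 * ennreal (1 - exp (- (1 / t) * s))"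
        using one_minus_exp_bounds(1)[of "s / t"] assms
        by (subst ennreal_mult[symmetric]) (auto intro!: ennreal_leI)
    qed
  qed
  also have "\<dots> = ennreal (2 * laplace_exponent \<nu> (1 / t))"
    unfolding ennreal_mult[OF _ laplace_exponent_nonneg[OF assms(1) t], of 2, simplified] eq
    by (subst nn_integral_cmult) auto
  finally show "(\<integral>\<^sup>+ s. ennreal (min 1 (s / t)) \<partial>\<nu>) \<le> ennreal (2 * laplace_exponent \<nu> (1 / t))" .
qed

text \<open>
  A vanishing tail would make the quotient in the condition \<open>0 / 0 = 0\<close>, which its lower bound excludes.
\<close>
lemma Poly_tail_pos:
  assumes "Poly_tail R1 \<beta>1 \<beta>2 \<nu>" "0 < r" "ereal r < R1"
  shows "0 < levy_tail \<nu> r"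
proof (rule ccontr)
  assume "\<not> ?thesis"
  then have "levy_tail \<nu> r = 0" by (simp add: levy_tail_def zero_less_measure_iff)
  moreover obtain c1 where "c1 > 0" "c1 * (r / r) powr \<beta>1 \<le> levy_tail \<nu> r / levy_tail \<nu> r"
    using assms unfolding Poly_tail_def by blast
  ultimately show False using assms by simp
qed

text \<open>
  The Laplace exponent at \<open>1 / t\<close> inherits the power bounds of the Levy tail at \<open>t\<close>. The upper exponent
  improves to \<open>min \<beta>2 1\<close>, because the Laplace exponent is concave and vanishes at 0, hence grows at most linearly.
\<close>
lemma laplace_exponent_scaling:
  assumes \<nu>: "levy_measure \<nu>" and poly: "Poly_tail R1 \<beta>1 \<beta>2 \<nu>"
  shows "\<exists>c>0. \<exists>C>0. \<forall>s t. 0 < s \<and> s \<le> t \<and> ereal t < R1 \<longrightarrow>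
     c * (t / s) powr \<beta>1 * laplace_exponent \<nu> (1 / t) \<le> laplace_exponent \<nu> (1 / s) \<and>
     laplace_exponent \<nu> (1 / s) \<le> C * (t / s) powr min \<beta>2 1 * laplace_exponent \<nu> (1 / t)"
proof -
  obtain c1 c2 where c: "0 < c1" "0 < c2" and w: "\<And>r R. 0 < r \<Longrightarrow> r \<le> R \<Longrightarrow> ereal R < R1 \<Longrightarrow>
      c1 * (R / r) powr \<beta>1 \<le> levy_tail \<nu> r / levy_tail \<nu> R \<and>
      levy_tail \<nu> r / levy_tail \<nu> R \<le> c2 * (R / r) powr \<beta>2"
    using poly unfolding Poly_tail_def by blast
  have s[measurable_cong]: "sets \<nu> = sets borel" using \<nu> by (simp add: levy_measure_def)
  define N where "N = (\<lambda>t. \<integral>\<^sup>+ s. ennreal (min 1 (s / t)) \<partial>\<nu>)"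
  have meas: "(\<lambda>u. emeasure \<nu> {u * t<..}) \<in> borel_measurable borel" if "0 < t" for t
  proof -
    interpret sigma_finite_measure \<nu> by (rule levy_sigma_finite) fact
    have "{u \<in> space (borel \<Otimes>\<^sub>M \<nu>). fst u * t < snd u} \<in> sets (borel \<Otimes>\<^sub>M \<nu>)" by measurable
    then show ?thesis by measurable (auto simp: sets_eq_imp_space_eq[OF s])
  qed
  have N: "c1 * (t / s) powr \<beta>1 * N t \<le> N s \<and> N s \<le> c2 * (t / s) powr \<beta>2 * N t"
    if st: "0 < s" "s \<le> t" "ereal t < R1" for s t
  proof -
    have em: "emeasure \<nu> {u<..} = ennreal (levy_tail \<nu> u)" if "0 < u" for u
      using levy_tail_finite[OF \<nu> that] by (simp add: levy_tail_def emeasure_eq_ennreal_measure less_top)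
    have w': "c1 * (t / s) powr \<beta>1 * levy_tail \<nu> (u * t) \<le> levy_tail \<nu> (u * s) \<and>
        levy_tail \<nu> (u * s) \<le> c2 * (t / s) powr \<beta>2 * levy_tail \<nu> (u * t)" if u: "0 < u" "u < 1" for u
    proof -
      have ut: "u * t \<le> t" "u * s \<le> u * t" "0 < u * s" "0 < u * t"
        using st u by (auto simp: mult_left_le_one_le)
      then have utR: "ereal (u * t) < R1" using st(3) by (meson ereal_less_eq(3) le_less_trans)
      have "0 < levy_tail \<nu> (u * t)" by (rule Poly_tail_pos[OF poly]) (use ut utR in auto)
      moreover have "u * t / (u * s) = t / s" using u by simp
      ultimately show ?thesis using w[OF ut(3) ut(2) utR] by (simp add: field_simps)
    qed
    have "ennreal (c1 * (t / s) powr \<beta>1) * N t =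
        (\<integral>\<^sup>+ u. ennreal (c1 * (t / s) powr \<beta>1) * (emeasure \<nu> {u * t<..} * indicator {0<..<1} u) \<partial>lborel)"
      unfolding N_def using st meas[of t]
      by (subst truncated_moment_eq_tail_integral[OF \<nu>]) (auto intro!: nn_integral_cmult[symmetric])
    also have "\<dots> \<le> N s"
      unfolding N_def truncated_moment_eq_tail_integral[OF \<nu> st(1)]
    proof (rule nn_integral_mono)
      fix u :: real
      show "ennreal (c1 * (t / s) powr \<beta>1) * (emeasure \<nu> {u * t<..} * indicator {0<..<1} u)
          \<le> emeasure \<nu> {u * s<..} * indicator {0<..<1} u"
        using st w'[of u] c by (auto split: split_indicator simp: em ennreal_mult[symmetric] levy_tail_def intro!: ennreal_leI)
    qed
    finally have 1: "ennreal (c1 * (t / s) powr \<beta>1) * N t \<le> N s" .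
    have "N s \<le>
        (\<integral>\<^sup>+ u. ennreal (c2 * (t / s) powr \<beta>2) * (emeasure \<nu> {u * t<..} * indicator {0<..<1} u) \<partial>lborel)"
      unfolding N_def truncated_moment_eq_tail_integral[OF \<nu> st(1)]
    proof (rule nn_integral_mono)
      fix u :: real
      show "emeasure \<nu> {u * s<..} * indicator {0<..<1} u
          \<le> ennreal (c2 * (t / s) powr \<beta>2) * (emeasure \<nu> {u * t<..} * indicator {0<..<1} u)"
        using st w'[of u] c by (auto split: split_indicator simp: em ennreal_mult[symmetric] levy_tail_def intro!: ennreal_leI)
    qed
    also have "\<dots> = ennreal (c2 * (t / s) powr \<beta>2) * N t"
      unfolding N_def using st meas[of t]
      by (subst truncated_moment_eq_tail_integral[OF \<nu>]) (auto intro!: nn_integral_cmult)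
    finally show ?thesis using 1 by simp
  qed
  have "\<forall>s t. 0 < s \<and> s \<le> t \<and> ereal t < R1 \<longrightarrow>
     c1 / 2 * (t / s) powr \<beta>1 * laplace_exponent \<nu> (1 / t) \<le> laplace_exponent \<nu> (1 / s) \<and>
     laplace_exponent \<nu> (1 / s) \<le> max 1 (2 * c2) * (t / s) powr min \<beta>2 1 * laplace_exponent \<nu> (1 / t)"
  proof (intro allI impI conjI)
    fix s t assume st: "0 < s \<and> s \<le> t \<and> ereal t < R1"
    let ?p = "\<lambda>t. laplace_exponent \<nu> (1 / t)"
    have pt: "0 \<le> ?p t" "0 \<le> ?p s" using st by (auto intro!: laplace_exponent_nonneg[OF \<nu>])
    have "ennreal (c1 * (t / s) powr \<beta>1 * ?p t) \<le> ennreal (c1 * (t / s) powr \<beta>1) * N t"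
      unfolding N_def using st c pt truncated_moment_comparable(1)[OF \<nu>, of t]
      by (subst ennreal_mult) (auto intro!: mult_left_mono)
    also have "\<dots> \<le> N s" using N[of s t] st by auto
    also have "\<dots> \<le> ennreal (2 * ?p s)"
      unfolding N_def using st by (intro truncated_moment_comparable(2)[OF \<nu>]) auto
    finally show "c1 / 2 * (t / s) powr \<beta>1 * ?p t \<le> ?p s" using pt by simp
    have "ennreal (?p s) \<le> N s" 
      unfolding N_def using st by (intro truncated_moment_comparable(1)[OF \<nu>]) auto
    also have "\<dots> \<le> ennreal (c2 * (t / s) powr \<beta>2) * N t" using N[of s t] st by auto
    also have "\<dots> \<le> ennreal (c2 * (t / s) powr \<beta>2) * ennreal (2 * ?p t)"
      unfolding N_def using st by (intro mult_left_mono truncated_moment_comparable(2)[OF \<nu>]) auto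
    also have "\<dots> = ennreal (2 * c2 * (t / s) powr \<beta>2 * ?p t)"
      using c st pt by (simp add: ennreal_mult[symmetric] mult_ac)
    finally have 1: "?p s \<le> 2 * c2 * (t / s) powr \<beta>2 * ?p t" using c pt by simp
    have "?p s \<le> (t / s) * ?p t"
      using laplace_exponent_mult_le[OF \<nu>, of "1 / t" "t / s"] st by simp
    then have 2: "?p s \<le> (t / s) powr 1 * ?p t" using st by simp
    show "?p s \<le> max 1 (2 * c2) * (t / s) powr min \<beta>2 1 * ?p t"
    proof (cases "\<beta>2 \<le> 1")
      case True
      have "2 * c2 * (t / s) powr \<beta>2 * ?p t \<le> max 1 (2 * c2) * (t / s) powr \<beta>2 * ?p t"
        using pt by (intro mult_right_mono) auto
      with 1 True show ?thesis by (simp add: min_def)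
    next
      case False
      have "1 * (t / s) powr 1 * ?p t \<le> max 1 (2 * c2) * (t / s) powr 1 * ?p t"
        using pt by (intro mult_right_mono) auto
      with 2 False show ?thesis by (simp add: min_def)
    qed
  qed
  moreover have "0 < c1 / 2" "0 < max 1 (2 * c2)" using c by auto
  ultimately show ?thesis by blast
qed

text \<open>
  The form in which a positive power beats a constant in the arguments below.
\<close>
lemma powr_exceeds:
  fixes a c u :: real
  assumes "0 < a" "0 < c"
  shows "\<exists>k\<ge>1. u \<le> c * k powr a"
proof (intro exI conjI)
  let ?k = "max 1 ((\<bar>u\<bar> / c) powr (1 / a))"
  show "1 \<le> ?k" by simp
  have "\<bar>u\<bar> / c = ((\<bar>u\<bar> / c) powr (1 / a)) powr a" using assms by (simp add: powr_powr)
  also have "\<dots> \<le> ?k powr a" using assms by (intro powr_mono2) auto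
  finally have "\<bar>u\<bar> \<le> c * ?k powr a" using assms by (simp add: pos_divide_le_eq mult.commute)
  then show "u \<le> c * ?k powr a" by linarith
qed

text \<open>
  The Laplace exponent is concave, so its growth is at most linear; a lower growth rate above 1 is
  impossible. This is the integrability of the Levy tail at 0 in disguise.
\<close>
lemma Poly_tail_exponent_le_1:
  assumes \<nu>: "levy_measure \<nu>" and poly: "Poly_tail R1 \<beta>1 \<beta>2 \<nu>"
  shows "\<beta>1 \<le> 1"
proof (rule ccontr)
  assume "\<not> ?thesis"
  then have b: "0 < \<beta>1 - 1" by simp
  obtain c where c: "0 < c" and sc: "\<And>s t. 0 < s \<Longrightarrow> s \<le> t \<Longrightarrow> ereal t < R1 \<Longrightarrow>
     c * (t / s) powr \<beta>1 * laplace_exponent \<nu> (1 / t) \<le> laplace_exponent \<nu> (1 / s)"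
    using laplace_exponent_scaling[OF \<nu> poly] by blast
  obtain t where t: "0 < t" "ereal t < R1"
    using poly unfolding Poly_tail_def by (metis ereal_dense2 ereal_less(2) less_ereal.simps(1) zero_ereal_def)
  have p: "0 < laplace_exponent \<nu> (1 / t)"
    using laplace_exponent_pos[OF \<nu>] Poly_tail_pos[OF poly] t by auto
  obtain k where k: "1 \<le> k" "2 \<le> c * k powr (\<beta>1 - 1)" using powr_exceeds[OF b c] by blast
  have "c * (t / (t / k)) powr \<beta>1 * laplace_exponent \<nu> (1 / t) \<le> laplace_exponent \<nu> (1 / (t / k))"
    using t k by (intro sc) (auto simp: field_simps)
  also have "\<dots> \<le> k * laplace_exponent \<nu> (1 / t)"
    using laplace_exponent_mult_le[OF \<nu>, of "1 / t" k] t k by simp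
  finally have "c * k powr \<beta>1 \<le> k" using p t by simp
  then have "c * k powr (\<beta>1 - 1) \<le> 1" using k by (simp add: powr_diff field_simps)
  with k(2) show False by simp
qed

section \<open>Potentials of subordinators\<close>

text \<open>
  Cauchy's functional equation with monotonicity as the regularity condition: comparing \<open>n * t\<close> with its
  integer part pins down \<open>g t\<close> up to \<open>g 1 / n\<close>.
\<close>
lemma additive_mono_imp_linear:
  fixes g :: "real \<Rightarrow> real"
  assumes add: "\<And>s t. 0 \<le> s \<Longrightarrow> 0 \<le> t \<Longrightarrow> g (s + t) = g s + g t"
    and mono: "\<And>s t. 0 \<le> s \<Longrightarrow> s \<le> t \<Longrightarrow> g s \<le> g t"
    and "0 \<le> t"
  shows "g t = t * g 1"
proof -
  have g0: "g 0 = 0" using add[of 0 0] by simp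
  have mult: "g (real n * s) = real n * g s" if "0 \<le> s" for n s
  proof (induction n)
    case (Suc n)
    have "g (real n * s + s) = g (real n * s) + g s" using that by (intro add) auto
    then show ?case using Suc by (simp add: algebra_simps)
  qed (simp add: g0)
  have g1: "0 \<le> g 1" using mono[of 0 1] g0 by simp
  have bound: "real n * \<bar>g t - t * g 1\<bar> \<le> g 1" for n
  proof -
    define k where "k = nat \<lfloor>real n * t\<rfloor>"
    have k: "real k \<le> real n * t" "real n * t \<le> real (Suc k)"
      using \<open>0 \<le> t\<close> by (auto simp: k_def) linarith
    have "real k * g 1 \<le> real n * g t" "real n * g t \<le> real (Suc k) * g 1"
      using mono[OF _ k(1)] mono[OF _ k(2)] mult[of 1 k] mult[of 1 "Suc k"] mult[of t n] \<open>0 \<le> t\<close> by auto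
    moreover have "real k * g 1 \<le> (real n * t) * g 1" "(real n * t) * g 1 \<le> real (Suc k) * g 1"
      using k g1 by (auto intro!: mult_right_mono simp del: of_nat_Suc)
    ultimately have "\<bar>real n * g t - real n * t * g 1\<bar> \<le> g 1"
      by (simp add: algebra_simps abs_le_iff)
    moreover have "\<bar>real n * g t - real n * t * g 1\<bar> = real n * \<bar>g t - t * g 1\<bar>"
      by (simp add: abs_mult mult.assoc flip: right_diff_distrib)
    ultimately show ?thesis by simp
  qed
  show ?thesis
  proof (rule ccontr)
    assume "g t \<noteq> t * g 1"
    then have "0 < \<bar>g t - t * g 1\<bar>" by simp
    then obtain n where "g 1 < real n * \<bar>g t - t * g 1\<bar>"
      using reals_Archimedean3 by blast
    with bound[of n] show False by simp
  qed
qed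

lemma subordinator_AE_nonneg:
  assumes S: "subordinator M S \<nu>" and "0 \<le> s" "s \<le> t"
  shows "AE \<omega> in M. 0 \<le> S s \<omega> \<and> S s \<omega> \<le> S t \<omega>"
proof -
  have "AE \<omega> in M. mono_on {0..} (\<lambda>t. S t \<omega>)" "AE \<omega> in M. S 0 \<omega> = 0"
    using S by (auto simp: subordinator_def elim!: eventually_mono)
  then show ?thesis
  proof eventually_elim
    fix \<omega> assume "mono_on {0..} (\<lambda>t. S t \<omega>)" "S 0 \<omega> = 0"
    then show "0 \<le> S s \<omega> \<and> S s \<omega> \<le> S t \<omega>"
      using assms(2,3) by (auto dest: mono_onD[where r = 0 and s = s] mono_onD[where r = s and s = t])
  qed
qed

text \<open>
  The exponent is only given at time 1. Independent stationary increments make the Laplace transform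
  multiplicative in time, non-decreasing paths make it monotone in time, and so its logarithm is linear.
\<close>
lemma subordinator_laplace_transform:
  assumes S: "subordinator M S \<nu>" and u: "0 \<le> u" and t: "0 \<le> t"
  shows "(LINT \<omega>|M. exp (- u * S t \<omega>)) = exp (- t * laplace_exponent \<nu> u)"
proof -
  interpret prob_space M using S by (simp add: subordinator_def)
  have meas[measurable]: "S t \<in> borel_measurable M" if "0 \<le> t" for t
    using S that by (simp add: subordinator_def)
  have int: "integrable M (\<lambda>\<omega>. exp (- u * S t \<omega>))" if "0 \<le> t" for t
  proof (rule integrable_const_bound[where B = 1])
    show "AE \<omega> in M. norm (exp (- u * S t \<omega>)) \<le> 1"
      using subordinator_AE_nonneg[OF S that order.refl] u by (auto elim!: eventually_mono)
  qed (use that in measurable)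
  define L where "L = (\<lambda>t. LINT \<omega>|M. exp (- u * S t \<omega>))"
  have pos: "0 < L t" if "0 \<le> t" for t
  proof -
    have "0 \<le> L t" by (simp add: L_def)
    moreover have "L t \<noteq> 0"
    proof
      assume "L t = 0"
      then have "AE \<omega> in M. exp (- u * S t \<omega>) = 0"
        using integral_nonneg_eq_0_iff_AE[OF int[OF that]] by (simp add: L_def)
      then show False by simp
    qed
    ultimately show ?thesis by simp
  qed
  have mult: "L (s + t) = L s * L t" if st: "0 \<le> s" "0 \<le> t" for s t
  proof -
    define r where "r = (\<lambda>i::nat. if i = 0 then 0 else if i = 1 then s else s + t)"
    define X where "X = (\<lambda>i \<omega>. S (r (Suc i)) \<omega> - S (r i) \<omega>)"
    have r0: "\<And>i. 0 \<le> r i" using st by (simp add: r_def)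
    have "\<forall>i<2. r i \<le> r (Suc i)" using st by (auto simp: r_def)
    then have "indep_vars (\<lambda>_. borel) X {..<2}"
      using S r0[of 0] unfolding subordinator_def X_def by blast
    then have ind: "indep_vars (\<lambda>_. borel) (\<lambda>i \<omega>. exp (- u * X i \<omega>)) {..<2}"
      by (rule indep_vars_compose2) auto
    have AEX: "AE \<omega> in M. 0 \<le> X i \<omega>" if "i < 2" for i
      using subordinator_AE_nonneg[OF S r0, of i "r (Suc i)"] st that
      by (auto elim!: eventually_mono simp: X_def r_def)
    have intX: "integrable M (\<lambda>\<omega>. exp (- u * X i \<omega>))" if "i < 2" for i
    proof (rule integrable_const_bound[where B = 1])
      show "AE \<omega> in M. norm (exp (- u * X i \<omega>)) \<le> 1"
        using AEX[OF that] u by (auto elim!: eventually_mono)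
      show "(\<lambda>\<omega>. exp (- u * X i \<omega>)) \<in> borel_measurable M"
        unfolding X_def using meas[OF r0] by measurable
    qed
    have "(LINT \<omega>|M. (\<Prod>i\<in>{..<2}. exp (- u * X i \<omega>))) = (\<Prod>i\<in>{..<2}. LINT \<omega>|M. exp (- u * X i \<omega>))"
      by (rule indep_vars_lebesgue_integral) (use ind intX in auto)
    moreover have "(LINT \<omega>|M. (\<Prod>i\<in>{..<2}. exp (- u * X i \<omega>))) = L (s + t)"
      unfolding L_def
    proof (rule integral_cong_AE)
      have "AE \<omega> in M. S 0 \<omega> = 0" using S by (simp add: subordinator_def)
      then show "AE \<omega> in M. (\<Prod>i\<in>{..<2}. exp (- u * X i \<omega>)) = exp (- u * S (s + t) \<omega>)"
        by eventually_elim (simp add: X_def r_def numeral_2_eq_2 algebra_simps flip: exp_add)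
    qed (use meas[OF r0] st in \<open>auto simp: X_def\<close>)
    moreover have "(LINT \<omega>|M. exp (- u * X 0 \<omega>)) = L s"
      unfolding L_def
    proof (rule integral_cong_AE)
      have "AE \<omega> in M. S 0 \<omega> = 0" using S by (simp add: subordinator_def)
      then show "AE \<omega> in M. exp (- u * X 0 \<omega>) = exp (- u * S s \<omega>)"
        by eventually_elim (simp add: X_def r_def)
    qed (use meas[OF r0] st in \<open>auto simp: X_def\<close>)
    moreover have "(LINT \<omega>|M. exp (- u * X 1 \<omega>)) = L t"
    proof -
      have X1: "X 1 = (\<lambda>\<omega>. S (s + t) \<omega> - S s \<omega>)" by (simp add: X_def r_def)
      have "(LINT \<omega>|M. exp (- u * X 1 \<omega>)) = (LINT x|distr M borel (\<lambda>\<omega>. S (s + t) \<omega> - S s \<omega>). exp (- u * x))"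
        using st unfolding X1 by (subst integral_distr) auto
      also have "distr M borel (\<lambda>\<omega>. S (s + t) \<omega> - S s \<omega>) = distr M borel (S t)"
        using S st by (simp add: subordinator_def)
      also have "(LINT x|distr M borel (S t). exp (- u * x)) = L t"
        using st unfolding L_def by (subst integral_distr) auto
      finally show ?thesis .
    qed
    ultimately show ?thesis by (simp add: numeral_2_eq_2)
  qed
  define g where "g = (\<lambda>t. - ln (L t))"
  have "g t = t * g 1"
  proof (rule additive_mono_imp_linear)
    fix s t :: real assume "0 \<le> s" "0 \<le> t"
    then show "g (s + t) = g s + g t" using pos[of s] pos[of t] by (simp add: g_def mult ln_mult_pos)
  next
    fix s t :: real assume st: "0 \<le> s" "s \<le> t"
    have "L t \<le> L s" unfolding L_def
    proof (rule integral_mono_AE)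
      show "AE \<omega> in M. exp (- u * S t \<omega>) \<le> exp (- u * S s \<omega>)"
        using subordinator_AE_nonneg[OF S st] by (rule eventually_mono) (use u in \<open>auto intro: mult_left_mono\<close>)
    qed (use int st in auto)
    then show "g s \<le> g t" using pos st by (simp add: g_def)
  qed fact
  moreover have "g 1 = laplace_exponent \<nu> u"
    using S u by (simp add: subordinator_def g_def L_def)
  ultimately have "g t = t * laplace_exponent \<nu> u" by simp
  then have "ln (L t) = - t * laplace_exponent \<nu> u" by (simp add: g_def)
  then have "L t = exp (- t * laplace_exponent \<nu> u)" using pos[OF t] by (metis exp_ln)
  then show ?thesis by (simp add: L_def)
qed

lemma nn_integral_exp_decay:
  fixes l :: real
  assumes "0 < l"
  shows "(\<integral>\<^sup>+ t\<in>{0<..}. ennreal (exp (- t * l)) \<partial>lborel) \<le> ennreal (1 / l)"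
proof -
  interpret prob_space "density lborel (exponential_density l)"
    by (rule prob_space_exponential_density) fact
  have "(\<integral>\<^sup>+ t\<in>{0<..}. ennreal (exp (- t * l)) \<partial>lborel)
      \<le> (\<integral>\<^sup>+ t. ennreal (1 / l) * ennreal (exponential_density l t) \<partial>lborel)"
    using assms by (intro nn_integral_mono)
      (auto simp: exponential_density_def ennreal_mult[symmetric] split: split_indicator)
  also have "\<dots> = ennreal (1 / l) * (\<integral>\<^sup>+ t. ennreal (exponential_density l t) \<partial>lborel)"
    by (intro nn_integral_cmult) simp
  also have "(\<integral>\<^sup>+ t. ennreal (exponential_density l t) \<partial>lborel) = 1"
    using emeasure_space_1 by (simp add: emeasure_density)
  finally show ?thesis by simp
qed

text \<open>
  The potential measure of a half-open interval. The integrand is measurable because the distribution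
  function of \<open>S t\<close> is monotone in \<open>t\<close> (\<open>subordinator_cdf_measurable\<close>).
\<close>
definition potential :: "'w measure \<Rightarrow> (real \<Rightarrow> 'w \<Rightarrow> real) \<Rightarrow> real \<Rightarrow> real \<Rightarrow> ennreal" where
  "potential M S a b = (\<integral>\<^sup>+ t\<in>{0<..}. emeasure (distr M borel (S t)) {a<..b} \<partial>lborel)"

lemma subordinator_nn_laplace:
  assumes S: "subordinator M S \<nu>" and u: "0 \<le> u" and t: "0 \<le> t"
  shows "(\<integral>\<^sup>+ s. ennreal (exp (- u * s)) \<partial>distr M borel (S t)) = ennreal (exp (- t * laplace_exponent \<nu> u))"
proof -
  interpret prob_space M using S by (simp add: subordinator_def)
  have meas[measurable]: "S t \<in> borel_measurable M"
    using S t by (simp add: subordinator_def)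
  have int: "integrable M (\<lambda>\<omega>. exp (- u * S t \<omega>))"
  proof (rule integrable_const_bound[where B = 1])
    show "AE \<omega> in M. norm (exp (- u * S t \<omega>)) \<le> 1"
      using subordinator_AE_nonneg[OF S t order.refl] u by (auto elim!: eventually_mono)
  qed measurable
  have "(\<integral>\<^sup>+ s. ennreal (exp (- u * s)) \<partial>distr M borel (S t)) = (\<integral>\<^sup>+ \<omega>. ennreal (exp (- u * S t \<omega>)) \<partial>M)"
    by (subst nn_integral_distr) auto
  also have "\<dots> = ennreal (LINT \<omega>|M. exp (- u * S t \<omega>))"
    by (rule nn_integral_eq_integral[OF int]) simp
  finally show ?thesis using subordinator_laplace_transform[OF S u t] by simp
qed

text \<open>
  Markov's inequality for \<open>exp (- S t / r)\<close>.
\<close>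
lemma subordinator_cdf_upper:
  assumes S: "subordinator M S \<nu>" and r: "0 < r" and t: "0 \<le> t"
  shows "emeasure (distr M borel (S t)) {..r} \<le> ennreal (exp (1 - t * laplace_exponent \<nu> (1 / r)))"
proof -
  have "emeasure (distr M borel (S t)) {..r} = (\<integral>\<^sup>+ s. indicator {..r} s \<partial>distr M borel (S t))"
    by simp
  also have "\<dots> \<le> (\<integral>\<^sup>+ s. ennreal (exp 1) * ennreal (exp (- (1 / r) * s)) \<partial>distr M borel (S t))"
    using r by (intro nn_integral_mono) (auto split: split_indicator simp: ennreal_mult[symmetric] simp flip: exp_add)
  also have "\<dots> = ennreal (exp 1) * (\<integral>\<^sup>+ s. ennreal (exp (- (1 / r) * s)) \<partial>distr M borel (S t))"
    by (intro nn_integral_cmult) simp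
  also have "\<dots> = ennreal (exp (1 - t * laplace_exponent \<nu> (1 / r)))"
    using r by (subst subordinator_nn_laplace[OF S _ t]) (auto simp: ennreal_mult[symmetric] exp_diff exp_minus divide_inverse)
  finally show ?thesis .
qed

lemma potential_upper:
  assumes S: "subordinator M S \<nu>" and r: "0 < r" and pos: "0 < laplace_exponent \<nu> (1 / r)"
  shows "potential M S a r \<le> ennreal (exp 1 / laplace_exponent \<nu> (1 / r))"
proof -
  let ?l = "laplace_exponent \<nu> (1 / r)"
  have "potential M S a r \<le> (\<integral>\<^sup>+ t. ennreal (exp 1) * (ennreal (exp (- t * ?l)) * indicator {0<..} t) \<partial>lborel)"
    unfolding potential_def
  proof (rule nn_integral_mono)
    fix t :: real
    have "emeasure (distr M borel (S t)) {a<..r} \<le> ennreal (exp (1 - t * ?l))" if "0 < t"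
      by (rule order.trans[OF emeasure_mono subordinator_cdf_upper[OF S r]]) (use that in auto)
    then show "emeasure (distr M borel (S t)) {a<..r} * indicator {0<..} t
        \<le> ennreal (exp 1) * (ennreal (exp (- t * ?l)) * indicator {0<..} t)"
      by (auto split: split_indicator simp: ennreal_mult[symmetric] exp_diff exp_minus divide_inverse)
  qed
  also have "\<dots> = ennreal (exp 1) * (\<integral>\<^sup>+ t\<in>{0<..}. ennreal (exp (- t * ?l)) \<partial>lborel)"
    by (intro nn_integral_cmult) simp
  also have "\<dots> \<le> ennreal (exp 1) * ennreal (1 / ?l)"
    by (intro mult_left_mono nn_integral_exp_decay pos) simp
  also have "\<dots> = ennreal (exp 1 / ?l)" using pos by (simp add: ennreal_mult[symmetric])
  finally show ?thesis .
qed

text \<open>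
  Markov's inequality for \<open>1 - exp (- S t / r)\<close>, which is at least 1/2 on the event.
\<close>
lemma subordinator_tail_upper:
  assumes S: "subordinator M S \<nu>" and r: "0 < r" and t: "0 \<le> t"
  shows "measure (distr M borel (S t)) {r<..} \<le> 2 * t * laplace_exponent \<nu> (1 / r)"
proof -
  interpret M: prob_space M using S by (simp add: subordinator_def)
  have meas[measurable]: "S t \<in> borel_measurable M"
    using S t by (simp add: subordinator_def)
  have int: "integrable M (\<lambda>\<omega>. exp (- (1 / r) * S t \<omega>))"
  proof (rule M.integrable_const_bound[where B = 1])
    show "AE \<omega> in M. norm (exp (- (1 / r) * S t \<omega>)) \<le> 1"
      using subordinator_AE_nonneg[OF S t order.refl] r by (auto elim!: eventually_mono)
  qed measurable
  have sets: "{\<omega> \<in> space M. r < S t \<omega>} \<in> sets M" by measurable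
  have "measure (distr M borel (S t)) {r<..} = measure M {\<omega> \<in> space M. r < S t \<omega>}"
    by (subst measure_distr) (auto intro!: arg_cong[where f = "measure M"])
  also have "\<dots> = (LINT \<omega>|M. indicator {\<omega> \<in> space M. r < S t \<omega>} \<omega>)" by simp
  also have "\<dots> \<le> (LINT \<omega>|M. 2 * (1 - exp (- (1 / r) * S t \<omega>)))"
  proof (rule integral_mono_AE)
    show "AE \<omega> in M. indicator {\<omega> \<in> space M. r < S t \<omega>} \<omega> \<le> 2 * (1 - exp (- (1 / r) * S t \<omega>))"
      using subordinator_AE_nonneg[OF S t order.refl]
    proof eventually_elim
      fix \<omega> assume "0 \<le> S t \<omega> \<and> S t \<omega> \<le> S t \<omega>"
      then have nn: "0 \<le> S t \<omega> / r" using r by simp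
      have "exp (- (S t \<omega> / r)) \<le> 1 / 2" if "r < S t \<omega>"
      proof -
        have "exp (S t \<omega> / r) \<ge> 1 + S t \<omega> / r" by (rule exp_ge_add_one_self)
        moreover have "S t \<omega> / r > 1" using r that by simp
        ultimately have "exp (S t \<omega> / r) \<ge> 2" by linarith
        then show ?thesis by (simp add: exp_minus field_simps)
      qed
      then show "indicator {\<omega> \<in> space M. r < S t \<omega>} \<omega> \<le> 2 * (1 - exp (- (1 / r) * S t \<omega>))"
        using nn by (auto split: split_indicator)
    qed
    show "integrable M (indicator {\<omega> \<in> space M. r < S t \<omega>} :: _ \<Rightarrow> real)"
      using sets by (intro integrable_real_indicator) (auto simp: less_top[symmetric])
  qed (use int in auto)
  also have "\<dots> = 2 * (1 - exp (- t * laplace_exponent \<nu> (1 / r)))"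
    using int subordinator_laplace_transform[OF S, of "1 / r" t] t r by (simp add: M.prob_space)
  also have "\<dots> \<le> 2 * t * laplace_exponent \<nu> (1 / r)"
    using exp_ge_add_one_self[of "- t * laplace_exponent \<nu> (1 / r)"] by simp
  finally show ?thesis .
qed

text \<open>
  A whole factor \<open>k\<close> of scales carries a fixed fraction of the potential of \<open>{0<..r}\<close>. Let \<open>\<phi>\<close> be the
  Laplace exponent. At times of order \<open>1 / \<phi> (1 / r)\<close> the process is below \<open>r\<close> with probability at
  least 1/2, whereas it has already left \<open>{..r / k}\<close> with probability at least 3/4 if \<open>\<phi>\<close> grows enough
  between \<open>1 / r\<close> and \<open>k / r\<close>. The times between \<open>1 / (8 * \<phi> (1 / r))\<close> and \<open>1 / (4 * \<phi> (1 / r))\<close> do: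
  there \<open>t * \<phi> (k / r) \<ge> 24 / 8 = 3\<close>, and \<open>exp (1 - 3) \<le> 1 / 4\<close>. They contribute at least
  1/4 times 1/8 of \<open>1 / \<phi> (1 / r)\<close>.
\<close>
lemma potential_lower:
  assumes S: "subordinator M S \<nu>" and r: "0 < r" "0 < k" and pos: "0 < laplace_exponent \<nu> (1 / r)"
    and k: "24 * laplace_exponent \<nu> (1 / r) \<le> laplace_exponent \<nu> (k / r)"
  shows "ennreal (1 / (32 * laplace_exponent \<nu> (1 / r))) \<le> potential M S (r / k) r"
proof -
  let ?l = "laplace_exponent \<nu> (1 / r)"
  have low: "ennreal (1 / 4) \<le> emeasure (distr M borel (S t)) {r / k<..r}"
    if t: "1 / (8 * ?l) < t" "t < 1 / (4 * ?l)" for t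
  proof -
    interpret M: prob_space M using S by (simp add: subordinator_def)
    have t0: "0 < t" using t pos by (meson divide_pos_pos less_trans mult_pos_pos zero_less_numeral zero_less_one)
    have meas: "S t \<in> borel_measurable M"
      using S t0 by (simp add: subordinator_def)
    interpret D: prob_space "distr M borel (S t)"
      by (rule M.prob_space_distr) (rule meas)
    let ?m = "measure (distr M borel (S t))"
    have tl: "1 < 8 * (t * ?l)" "4 * (t * ?l) < 1" using t pos by (simp_all add: field_simps)
    have 1: "?m {r<..} \<le> 1 / 2"
      using subordinator_tail_upper[OF S r(1), of t] t0 tl by simp
    have "t * (24 * ?l) \<le> t * laplace_exponent \<nu> (k / r)"
      using t0 by (intro mult_left_mono k) simp
    moreover have "t * (24 * ?l) = 24 * (t * ?l)" by simp
    ultimately have "3 \<le> t * laplace_exponent \<nu> (k / r)" using tl by linarith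
    then have "ennreal (exp (1 - t * laplace_exponent \<nu> (1 / (r / k)))) \<le> ennreal (exp (- 2))"
      by (intro ennreal_leI) simp
    with subordinator_cdf_upper[OF S, of "r / k" t] r t0
    have "emeasure (distr M borel (S t)) {..r / k} \<le> ennreal (exp (- 2))" by (auto intro: order.trans)
    then have "?m {..r / k} \<le> exp (- 2)" by (simp add: D.emeasure_eq_measure)
    moreover have "exp (- 2 :: real) \<le> 1 / 4"
    proof -
      have "(2 :: real) ^ 2 \<le> exp 1 ^ 2" 
        using exp_ge_add_one_self[of "1 :: real"] by (intro power_mono) auto
      then have "4 \<le> exp (2 :: real)" by (simp flip: exp_of_nat_mult)
      then show ?thesis by (simp add: exp_minus field_simps)
    qed
    ultimately have 2: "?m {..r / k} \<le> 1 / 4" by linarith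
    have "1 = ?m (({..r / k} \<union> {r / k<..r}) \<union> {r<..})"
    proof -
      have "({..r / k} \<union> {r / k<..r}) \<union> {r<..} = UNIV" by auto
      then show ?thesis using D.prob_space by simp
    qed
    also have "\<dots> \<le> ?m ({..r / k} \<union> {r / k<..r}) + ?m {r<..}"
      by (rule measure_Un_le) auto
    also have "?m ({..r / k} \<union> {r / k<..r}) \<le> ?m {..r / k} + ?m {r / k<..r}"
      by (rule measure_Un_le) auto
    finally have "1 / 4 \<le> ?m {r / k<..r}" using 1 2 by simp
    then show ?thesis unfolding D.emeasure_eq_measure by (rule ennreal_leI)
  qed
  have "ennreal (1 / (32 * ?l)) = ennreal (1 / 4) * emeasure lborel {1 / (8 * ?l)<..<1 / (4 * ?l)}"
    using pos by (simp add: ennreal_mult[symmetric] field_simps)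
  also have "\<dots> = (\<integral>\<^sup>+ t. ennreal (1 / 4) * indicator {1 / (8 * ?l)<..<1 / (4 * ?l)} t \<partial>lborel)"
    by (subst nn_integral_cmult_indicator) auto
  also have "\<dots> \<le> potential M S (r / k) r"
    unfolding potential_def
  proof (rule nn_integral_mono)
    fix t :: real
    have "0 < t" if "1 / (8 * ?l) < t" using that pos
      by (meson divide_pos_pos less_trans mult_pos_pos zero_less_numeral zero_less_one)
    then show "ennreal (1 / 4) * indicator {1 / (8 * ?l)<..<1 / (4 * ?l)} t
        \<le> emeasure (distr M borel (S t)) {r / k<..r} * indicator {0<..} t"
      using low[of t] by (auto split: split_indicator)
  qed
  finally show ?thesis .
qed

lemma subordinator_cdf_measurable:
  assumes S: "subordinator M S \<nu>"
  shows "(\<lambda>t. emeasure (distr M borel (S t)) {a<..b} * indicator {0<..} t) \<in> borel_measurable lborel"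
proof -
  interpret M: prob_space M using S by (simp add: subordinator_def)
  have meas: "S t \<in> borel_measurable M" if "0 \<le> t" for t
    using S that by (simp add: subordinator_def)
  define F where "F = (\<lambda>r t. measure M {\<omega> \<in> space M. S (max 0 t) \<omega> \<le> r})"
  have F: "F r \<in> borel_measurable borel" for r
  proof -
    have "mono (\<lambda>t. - F r t)"
    proof (rule monoI)
      fix s t :: real assume "s \<le> t"
      then have st: "max 0 s \<le> max 0 t" by simp
      note meas[of "max 0 s", measurable] meas[of "max 0 t", measurable]
      have "AE \<omega> in M. \<omega> \<in> {\<omega> \<in> space M. S (max 0 t) \<omega> \<le> r} \<longrightarrow> \<omega> \<in> {\<omega> \<in> space M. S (max 0 s) \<omega> \<le> r}"
        using subordinator_AE_nonneg[OF S max.cobounded1 st] by (rule eventually_mono) auto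
      then have "F r t \<le> F r s"
        unfolding F_def by (rule M.finite_measure_mono_AE) measurable
      then show "- F r s \<le> - F r t" by simp
    qed
    from borel_measurable_mono[OF this] show ?thesis by (simp add: borel_measurable_uminus_eq)
  qed
  have "(\<lambda>t. emeasure (distr M borel (S t)) {a<..b} * indicator {0<..} t)
      = (\<lambda>t. ennreal (F b t - F (min a b) t) * indicator {0<..} t)"
  proof
    fix t :: real
    have "emeasure (distr M borel (S t)) {a<..b} = ennreal (F b t - F (min a b) t)" if "0 < t"
    proof -
      note meas[of t, measurable]
      have "F b t - F (min a b) t = measure M ({\<omega> \<in> space M. S t \<omega> \<le> b} - {\<omega> \<in> space M. S t \<omega> \<le> min a b})"
        unfolding F_def using that by (subst M.finite_measure_Diff) auto
      also have "{\<omega> \<in> space M. S t \<omega> \<le> b} - {\<omega> \<in> space M. S t \<omega> \<le> min a b} = S t -` {a<..b} \<inter> space M"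
        by auto
      finally show ?thesis using that by (simp add: emeasure_distr M.emeasure_eq_measure)
    qed
    then show "emeasure (distr M borel (S t)) {a<..b} * indicator {0<..} t
        = ennreal (F b t - F (min a b) t) * indicator {0<..} t" by (simp split: split_indicator)
  qed
  then show ?thesis using F by simp
qed

section \<open>Scale functions and volumes\<close>

lemma scale_function_strict_mono:
  assumes "scale_function a b f" "0 \<le> r" "r < s"
  shows "f r < f s"
  using assms strict_mono_onD[of "{0..}" f r s] by (simp add: scale_function_def)

lemma scale_function_mono:
  assumes "scale_function a b f" "0 \<le> r" "r \<le> s"
  shows "f r \<le> f s"
  using scale_function_strict_mono[OF assms(1,2), of s] assms(3) by (cases "r = s") simp_all

lemma scale_function_pos:
  assumes "scale_function a b f" "0 < r"
  shows "0 < f r"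
proof -
  have "0 \<le> f 0" using assms by (simp add: scale_function_def)
  also have "f 0 < f r" using scale_function_strict_mono[OF assms(1) order.refl assms(2)] .
  finally show ?thesis .
qed

lemma scale_function_lower:
  assumes "scale_function a b f"
  obtains c where "0 < c" "\<And>r R. 0 < r \<Longrightarrow> r \<le> R \<Longrightarrow> c * (R / r) powr a * f r \<le> f R"
proof -
  obtain c where c: "0 < c" "\<And>r R. 0 < r \<Longrightarrow> r \<le> R \<Longrightarrow> c * (R / r) powr a \<le> f R / f r"
    using assms unfolding scale_function_def weak_scaling_def by blast
  show thesis
    by (rule that[OF c(1)]) (use c(2) scale_function_pos[OF assms] in \<open>simp add: pos_le_divide_eq\<close>)
qed

lemma scale_function_upper:
  assumes "scale_function a b f"
  obtains C where "0 < C" "\<And>r R. 0 < r \<Longrightarrow> r \<le> R \<Longrightarrow> f R \<le> C * (R / r) powr b * f r"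
proof -
  obtain C where C: "0 < C" "\<And>r R. 0 < r \<Longrightarrow> r \<le> R \<Longrightarrow> f R / f r \<le> C * (R / r) powr b"
    using assms unfolding scale_function_def weak_scaling_def by blast
  show thesis
    by (rule that[OF C(1)]) (use C(2) scale_function_pos[OF assms] in \<open>simp add: pos_divide_le_eq\<close>)
qed

lemma scale_function_exponents_pos:
  assumes "scale_function a b f"
  shows "0 < a" "0 < b"
  using assms by (simp_all add: scale_function_def weak_scaling_def)

lemma scale_function_exponents_le:
  assumes "scale_function a b f"
  shows "a \<le> b"
proof (rule ccontr)
  assume "\<not> a \<le> b"
  then have ab: "0 < a - b" by simp
  obtain c where c: "0 < c" "\<And>r R. 0 < r \<Longrightarrow> r \<le> R \<Longrightarrow> c * (R / r) powr a * f r \<le> f R"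
    using scale_function_lower[OF assms] by blast
  obtain C where C: "0 < C" "\<And>r R. 0 < r \<Longrightarrow> r \<le> R \<Longrightarrow> f R \<le> C * (R / r) powr b * f r"
    using scale_function_upper[OF assms] by blast
  obtain k where k: "1 \<le> k" "2 * C \<le> c * k powr (a - b)" using powr_exceeds[OF ab c(1)] by blast
  have "c * k powr a * f 1 \<le> C * k powr b * f 1" using c(2)[of 1 k] C(2)[of 1 k] k by simp
  then have "c * k powr a \<le> C * k powr b" using scale_function_pos[OF assms, of 1] by simp
  then have "c * k powr (a - b) \<le> C" using k by (simp add: powr_diff field_simps)
  with k C show False by simp
qed

text \<open>
  The lower power bound forces \<open>f r\<close> to 0 as \<open>r\<close> tends to 0, and \<open>f 0\<close> lies below all these values.
\<close>
lemma scale_function_zero: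
  assumes "scale_function a b f"
  shows "f 0 = 0"
proof (rule ccontr)
  assume "f 0 \<noteq> 0"
  moreover have "0 \<le> f 0" using assms by (simp add: scale_function_def)
  ultimately have f0: "0 < f 0" by simp
  obtain c where c: "0 < c" "\<And>r R. 0 < r \<Longrightarrow> r \<le> R \<Longrightarrow> c * (R / r) powr a * f r \<le> f R"
    using scale_function_lower[OF assms] by blast
  obtain k where k: "1 \<le> k" "2 * f 1 \<le> (c * f 0) * k powr a"
    using powr_exceeds[OF scale_function_exponents_pos(1)[OF assms] mult_pos_pos[OF c(1) f0]] by blast
  have "2 * f 1 \<le> c * k powr a * f 0" using k by (simp add: mult_ac)
  also have "\<dots> \<le> c * k powr a * f (1 / k)"
    using c k scale_function_mono[OF assms, of 0 "1 / k"] by (intro mult_left_mono) auto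
  also have "\<dots> \<le> f 1" using c(2)[of "1 / k" 1] k by simp
  finally show False using scale_function_pos[OF assms, of 1] by simp
qed

lemma scale_function_unbounded:
  assumes "scale_function a b f"
  shows "\<exists>r>0. t < f r"
proof -
  obtain c where c: "0 < c" "\<And>r R. 0 < r \<Longrightarrow> r \<le> R \<Longrightarrow> c * (R / r) powr a * f r \<le> f R"
    using scale_function_lower[OF assms] by blast
  obtain k where k: "1 \<le> k" "t + 1 \<le> (c * f 1) * k powr a"
    using powr_exceeds[OF scale_function_exponents_pos(1)[OF assms]
        mult_pos_pos[OF c(1) scale_function_pos[OF assms zero_less_one]]] by blast
  then have "t + 1 \<le> c * k powr a * f 1" by (simp add: mult_ac)
  also have "\<dots> \<le> f k" using c(2)[of 1 k] k by simp
  finally have "t < f k" by simp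
  moreover have "0 < k" using k by simp
  ultimately show ?thesis by blast
qed

lemma scale_inv_set:
  assumes "scale_function a b f"
  shows "{r. 0 \<le> r \<and> t < f r} \<noteq> {}" "bdd_below {r. 0 \<le> r \<and> t < f r}"
proof -
  obtain r where "0 < r" "t < f r" using scale_function_unbounded[OF assms] by blast
  then have "r \<in> {r. 0 \<le> r \<and> t < f r}" by simp
  then show "{r. 0 \<le> r \<and> t < f r} \<noteq> {}" by blast
  show "bdd_below {r. 0 \<le> r \<and> t < f r}" by (rule bdd_belowI[of _ 0]) simp
qed

text \<open>
  Exact in spite of possible jumps of \<open>f\<close>, because \<open>f\<close> is strictly increasing.
\<close>
lemma scale_inv_scale:
  assumes "scale_function a b f" "0 \<le> r"
  shows "scale_inv f (f r) = r"
proof -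
  have "{s. 0 \<le> s \<and> f r < f s} = {r<..}"
  proof (intro set_eqI iffI)
    fix s assume "s \<in> {s. 0 \<le> s \<and> f r < f s}"
    then show "s \<in> {r<..}" using scale_function_mono[OF assms(1), of s r] by (cases "s \<le> r") auto
  next
    fix s assume "s \<in> {r<..}"
    then show "s \<in> {s. 0 \<le> s \<and> f r < f s}"
      using scale_function_strict_mono[OF assms, of s] assms(2) by simp
  qed
  then show ?thesis by (simp add: scale_inv_def)
qed

lemma scale_inv_mono:
  assumes "scale_function a b f" "s \<le> t"
  shows "scale_inv f s \<le> scale_inv f t"
  unfolding scale_inv_def
  using scale_inv_set[OF assms(1)] assms(2) by (intro cInf_superset_mono) auto

lemma less_scale_inv_imp:
  assumes "scale_function a b f" "0 \<le> r" "r < scale_inv f t"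
  shows "f r \<le> t"
proof (rule ccontr)
  assume "\<not> f r \<le> t"
  then have "scale_inv f t \<le> r"
    unfolding scale_inv_def using scale_inv_set[OF assms(1)] assms(2) by (intro cInf_lower) auto
  with assms show False by simp
qed

lemma scale_inv_less_imp:
  assumes "scale_function a b f" "scale_inv f t < r"
  shows "t < f r"
proof -
  obtain s where "0 \<le> s" "t < f s" "s < r"
    using cInf_lessD[OF scale_inv_set(1)[OF assms(1)], of t r] assms(2) unfolding scale_inv_def by auto
  then show ?thesis using scale_function_strict_mono[OF assms(1), of s r] by simp
qed

lemma scale_inv_pos:
  assumes "scale_function a b f" "0 < t"
  shows "0 < scale_inv f t"
proof (rule ccontr)
  assume neg: "\<not> ?thesis"
  obtain c where c: "0 < c" "\<And>r R. 0 < r \<Longrightarrow> r \<le> R \<Longrightarrow> c * (R / r) powr a * f r \<le> f R"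
    using scale_function_lower[OF assms(1)] by blast
  have lt: "t < f r" if "0 < r" for r using scale_inv_less_imp[OF assms(1), of t r] neg that by simp
  obtain k where k: "1 \<le> k" "f 1 \<le> (c * t) * k powr a"
    using powr_exceeds[OF scale_function_exponents_pos(1)[OF assms(1)] mult_pos_pos[OF c(1) assms(2)]] by blast
  have "f 1 \<le> c * k powr a * t" using k by (simp add: mult_ac)
  also have "\<dots> < c * k powr a * f (1 / k)"
    using c k by (intro mult_strict_left_mono lt) auto
  also have "\<dots> \<le> f 1" using c(2)[of "1 / k" 1] k by simp
  finally show False by simp
qed

text \<open>
  \<open>f\<close> need not be continuous, so \<open>f (scale_inv f t)\<close> may differ from \<open>t\<close>; but \<open>t\<close> always lies between
  the values of \<open>f\<close> at half and at twice \<open>scale_inv f t\<close>, which costs only constants.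
\<close>
lemma scale_inv_bracket:
  assumes "scale_function a b f" "0 < t"
  shows "f (scale_inv f t / 2) \<le> t" "t < f (2 * scale_inv f t)"
  using less_scale_inv_imp[OF assms(1), of "scale_inv f t / 2" t]
    scale_inv_less_imp[OF assms(1), of t "2 * scale_inv f t"] scale_inv_pos[OF assms] by simp_all

lemma scale_inv_lower:
  assumes sf: "scale_function a b f"
  obtains c where "0 < c"
    "\<And>s t. 0 < s \<Longrightarrow> s \<le> t \<Longrightarrow> c * (t / s) powr (1 / b) \<le> scale_inv f t / scale_inv f s"
proof -
  obtain C where C: "0 < C" "\<And>r R. 0 < r \<Longrightarrow> r \<le> R \<Longrightarrow> f R \<le> C * (R / r) powr b * f r"
    using scale_function_upper[OF sf] by blast
  have b: "0 < b" using scale_function_exponents_pos[OF sf] by simp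
  show thesis
  proof (rule that[of "(1 / C) powr (1 / b) / 4"])
    show "0 < (1 / C) powr (1 / b) / 4" using C by simp
    fix s t :: real assume st: "0 < s" "s \<le> t"
    define p q where "p = scale_inv f s" and "q = scale_inv f t"
    have pq: "0 < p" "0 < q" "p \<le> q"
      using scale_inv_pos[OF sf] scale_inv_mono[OF sf] st by (auto simp: p_def q_def)
    have p: "f (p / 2) \<le> s" and q: "t < f (2 * q)"
      using scale_inv_bracket[OF sf] st by (auto simp: p_def q_def)
    have "t \<le> C * (2 * q / (p / 2)) powr b * f (p / 2)"
      using C(2)[of "p / 2" "2 * q"] pq q by simp
    also have "\<dots> \<le> C * (2 * q / (p / 2)) powr b * s"
      using p C by (intro mult_left_mono) auto
    finally have "1 / C * (t / s) \<le> (4 * (q / p)) powr b" using st C pq by (simp add: field_simps)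
    then have "(1 / C * (t / s)) powr (1 / b) \<le> ((4 * (q / p)) powr b) powr (1 / b)"
      using b st C by (intro powr_mono2) auto
    also have "\<dots> = 4 * (q / p)" using b pq by (simp add: powr_powr)
    also have "(1 / C * (t / s)) powr (1 / b) = (1 / C) powr (1 / b) * (t / s) powr (1 / b)" by (rule powr_mult)
    finally have "(1 / C) powr (1 / b) * (t / s) powr (1 / b) \<le> q / p * 4" by (simp add: mult.commute)
    then show "(1 / C) powr (1 / b) / 4 * (t / s) powr (1 / b) \<le> scale_inv f t / scale_inv f s"
      by (simp add: p_def q_def)
  qed
qed

lemma scale_inv_upper:
  assumes sf: "scale_function a b f"
  obtains C where "0 < C"
    "\<And>s t. 0 < s \<Longrightarrow> s \<le> t \<Longrightarrow> scale_inv f t / scale_inv f s \<le> C * (t / s) powr (1 / a)"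
proof -
  obtain c where c: "0 < c" "\<And>r R. 0 < r \<Longrightarrow> r \<le> R \<Longrightarrow> c * (R / r) powr a * f r \<le> f R"
    using scale_function_lower[OF sf] by blast
  have a: "0 < a" using scale_function_exponents_pos[OF sf] by simp
  define C where "C = max 4 (4 * (1 / c) powr (1 / a))"
  show thesis
  proof (rule that[of C])
    show "0 < C" by (simp add: C_def)
    fix s t :: real assume st: "0 < s" "s \<le> t"
    define p q where "p = scale_inv f s" and "q = scale_inv f t"
    have pq: "0 < p" "0 < q" "p \<le> q"
      using scale_inv_pos[OF sf] scale_inv_mono[OF sf] st by (auto simp: p_def q_def)
    have p: "s < f (2 * p)" and q: "f (q / 2) \<le> t"
      using scale_inv_bracket[OF sf] st by (auto simp: p_def q_def)
    show "scale_inv f t / scale_inv f s \<le> C * (t / s) powr (1 / a)"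
    proof (cases "q \<le> 4 * p")
      case True
      have "q / p \<le> 4 * 1" using True pq by (simp add: field_simps)
      also have "\<dots> \<le> C * (t / s) powr (1 / a)"
        using st a by (intro mult_mono) (auto simp: C_def ge_one_powr_ge_zero)
      finally show ?thesis by (simp add: p_def q_def)
    next
      case False
      have "c * (q / (4 * p)) powr a * s \<le> c * (q / 2 / (2 * p)) powr a * f (2 * p)"
        using p c by (simp add: mult_left_mono)
      also have "\<dots> \<le> f (q / 2)" using False pq by (intro c) auto
      also have "\<dots> \<le> t" by (rule q)
      finally have "(q / (4 * p)) powr a \<le> 1 / c * (t / s)" using st c by (simp add: field_simps)
      then have "((q / (4 * p)) powr a) powr (1 / a) \<le> (1 / c * (t / s)) powr (1 / a)"
        using a by (intro powr_mono2) auto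
      also have "\<dots> = (1 / c) powr (1 / a) * (t / s) powr (1 / a)" by (rule powr_mult)
      finally have "q / p \<le> 4 * (1 / c) powr (1 / a) * (t / s) powr (1 / a)"
        using a pq by (simp add: powr_powr field_simps)
      also have "\<dots> \<le> C * (t / s) powr (1 / a)" by (intro mult_right_mono) (auto simp: C_def)
      finally show ?thesis by (simp add: p_def q_def)
    qed
  qed
qed

lemma scale_function_doubling:
  assumes "scale_function a b f" "1 \<le> k"
  shows "\<exists>C\<ge>1. \<forall>r\<ge>0. f (k * r) \<le> C * f r"
proof -
  obtain C where C: "0 < C" and sc: "\<And>r R. 0 < r \<Longrightarrow> r \<le> R \<Longrightarrow> f R \<le> C * (R / r) powr b * f r"
    using scale_function_upper[OF assms(1)] by blast
  have "f (k * r) \<le> max 1 (C * k powr b) * f r" if "0 \<le> r" for r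
  proof (cases "r = 0")
    case True
    then show ?thesis using scale_function_zero[OF assms(1)] by simp
  next
    case False
    then have r: "0 < r" using that by simp
    have "f (k * r) \<le> C * k powr b * f r" using sc[of r "k * r"] r assms(2) by simp
    also have "\<dots> \<le> max 1 (C * k powr b) * f r"
      using scale_function_pos[OF assms(1) r] by (intro mult_right_mono) auto
    finally show ?thesis .
  qed
  then show ?thesis by (intro exI[of _ "max 1 (C * k powr b)"]) auto
qed

lemma emeasure_ball_finite:
  fixes m :: "'a::{heine_borel, second_countable_topology} measure"
  assumes "radon_measure m"
  shows "emeasure m (ball x r) < \<infinity>"
proof -
  have "emeasure m (ball x r) \<le> emeasure m (cball x r)"
    using assms by (intro emeasure_mono) (auto simp: radon_measure_def)
  also have "\<dots> < \<infinity>" using assms by (auto simp: radon_measure_def)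
  finally show ?thesis .
qed

lemma vol_mono:
  fixes m :: "'a::{heine_borel, second_countable_topology} measure"
  assumes "radon_measure m" "dist x y + r \<le> s"
  shows "vol m x r \<le> vol m y s"
  unfolding vol_def
proof (rule measure_mono_fmeasurable)
  have "dist y z < s" if "dist x z < r" for z
    using dist_triangle[of y z x] that assms(2) by (simp add: dist_commute)
  then show "ball x r \<subseteq> ball y s" by auto
  show "ball x r \<in> sets m" using assms by (simp add: radon_measure_def)
  show "ball y s \<in> fmeasurable m"
    using emeasure_ball_finite[OF assms(1)] assms by (auto simp: radon_measure_def intro!: fmeasurableI)
qed

lemma vol_pos:
  fixes m :: "'a::{heine_borel, second_countable_topology} measure"
  assumes "radon_measure m" "full_support m" "0 < r"
  shows "0 < vol m x r"
proof -
  have "0 < emeasure m (ball x r)" using assms by (auto simp: full_support_def)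
  then show ?thesis using emeasure_ball_finite[OF assms(1), of x r]
    unfolding vol_def by (simp add: measure_def enn2real_positive_iff)
qed

text \<open>
  The parameter \<open>a\<close> of the volume condition serves to cover any bounded range of radii, at the price of
  the constant; if \<open>R\<^sub>E = \<infinity>\<close> all radii are covered at once.
\<close>
lemma volume_scaling_up_to:
  assumes "volume_scaling m R\<^sub>E d1 d2"
  obtains C where "1 \<le> C" "\<And>x r R. 0 < r \<Longrightarrow> r \<le> R \<Longrightarrow> R \<le> L \<or> R\<^sub>E = \<infinity> \<Longrightarrow>
    (R / r) powr d1 / C \<le> vol m x R / vol m x r \<and> vol m x R / vol m x r \<le> C * (R / r) powr d2"
proof -
  have "0 < R\<^sub>E" using assms by (simp add: volume_scaling_def)
  obtain a where a: "1 \<le> a" "ereal L < ereal a * R\<^sub>E"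
  proof (cases R\<^sub>E)
    case (real r)
    then have r: "0 < r" using \<open>0 < R\<^sub>E\<close> by simp
    define a where "a = max 1 ((\<bar>L\<bar> + 1) / r)"
    have "\<bar>L\<bar> + 1 \<le> a * r" using r by (simp add: a_def field_simps max_def)
    then have "ereal L < ereal a * R\<^sub>E" using real by simp
    moreover have "1 \<le> a" by (simp add: a_def)
    ultimately show thesis using that by blast
  next
    case PInf
    then show thesis using that[of 1] by simp
  qed (use \<open>0 < R\<^sub>E\<close> in auto)
  obtain C where C: "1 \<le> C" "\<And>x r R. 0 < r \<Longrightarrow> r \<le> R \<Longrightarrow> ereal R < ereal a * R\<^sub>E \<Longrightarrow>
    (R / r) powr d1 / C \<le> vol m x R / vol m x r \<and> vol m x R / vol m x r \<le> C * (R / r) powr d2"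
    using assms a(1) unfolding volume_scaling_def by blast
  show thesis
  proof (rule that[OF C(1)])
    fix x r R assume r: "0 < r" "r \<le> R" "R \<le> L \<or> R\<^sub>E = \<infinity>"
    have "ereal R < ereal a * R\<^sub>E"
    proof (cases "R\<^sub>E = \<infinity>")
      case True
      then show ?thesis using a(1) by simp
    next
      case False
      then have "ereal R \<le> ereal L" using r by simp
      then show ?thesis using a(2) by (rule le_less_trans)
    qed
    then show "(R / r) powr d1 / C \<le> vol m x R / vol m x r \<and> vol m x R / vol m x r \<le> C * (R / r) powr d2"
      by (rule C(2)[OF r(1,2)])
  qed
qed

text \<open>
  Uniformity over centres in a bounded set: all these balls are contained in one ball, and a fixed multiple
  of each contains a fixed unit ball.
\<close>
lemma vol_bounded_set:
  fixes m :: "'a::{heine_borel, second_countable_topology} measure"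
  assumes m: "radon_measure m" "full_support m" "volume_scaling m R\<^sub>E d1 d2"
    and D: "bounded D" "D \<noteq> {}" and r: "0 < r0" "r0 \<le> r1"
  obtains c C where "0 < c" "0 < C"
    "\<And>x r. x \<in> D \<Longrightarrow> r0 \<le> r \<Longrightarrow> r \<le> r1 \<Longrightarrow> c \<le> vol m x r \<and> vol m x r \<le> C"
proof -
  obtain x0 where x0: "x0 \<in> D" using D by auto
  define R where "R = r0 + diameter D + 1"
  have R: "r0 \<le> R" "0 < R" using diameter_ge_0[OF D(1)] r by (auto simp: R_def)
  obtain A where A: "1 \<le> A" "\<And>x r R'. 0 < r \<Longrightarrow> r \<le> R' \<Longrightarrow> R' \<le> R \<or> R\<^sub>E = \<infinity> \<Longrightarrow>
    (R' / r) powr d1 / A \<le> vol m x R' / vol m x r \<and> vol m x R' / vol m x r \<le> A * (R' / r) powr d2"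
    using volume_scaling_up_to[OF m(3), of R] by blast
  define c where "c = vol m x0 1 / (A * (R / r0) powr d2)"
  define C where "C = vol m x0 (r1 + diameter D)"
  have d: "dist x x0 \<le> diameter D" if "x \<in> D" for x
    using diameter_bounded_bound[OF D(1) that x0] .
  show thesis
  proof (rule that[of c C])
    show "0 < c" using A(1) R r vol_pos[OF m(1,2), of 1 x0] by (simp add: c_def)
    show "0 < C" unfolding C_def using r diameter_ge_0[OF D(1)] by (intro vol_pos m) auto
    fix x q assume x: "x \<in> D" and q: "r0 \<le> q" "q \<le> r1"
    have "vol m x q \<le> C" unfolding C_def using q d[OF x] by (intro vol_mono m) auto
    moreover have "c \<le> vol m x r0"
    proof -
      have "vol m x0 1 \<le> vol m x R"
        using d[OF x] r by (intro vol_mono m) (auto simp: R_def dist_commute)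
      also have "\<dots> \<le> A * (R / r0) powr d2 * vol m x r0"
        using A(2)[of r0 R x] r R vol_pos[OF m(1,2) r(1), of x] by (simp add: pos_divide_le_eq)
      finally show ?thesis using A(1) R r by (simp add: c_def pos_divide_le_eq mult.commute)
    qed
    moreover have "vol m x r0 \<le> vol m x q" using q by (intro vol_mono m) auto
    ultimately show "c \<le> vol m x q \<and> vol m x q \<le> C" by simp
  qed
qed

section \<open>Green integrals and sums over geometric grids\<close>

definition green_integral :: "'w measure \<Rightarrow> (real \<Rightarrow> 'w \<Rightarrow> real) \<Rightarrow> (real \<Rightarrow> real) \<Rightarrow> ennreal" where
  "green_integral M S k =
     (\<integral>\<^sup>+ t\<in>{0<..}. (\<integral>\<^sup>+ s\<in>{0<..}. ennreal (k s) \<partial>distr M borel (S t)) \<partial>lborel)"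

lemma green_function_eq_green_integral:
  "green_function P S p x y = green_integral (P (Some x)) S (\<lambda>s. p s x y)"
  by (simp add: green_function_def subordinate_kernel_def green_integral_def)

text \<open>
  All kernels below are compared with step functions on countably many intervals, for which the iterated
  integral is a combination of potentials.
\<close>
lemma green_integral_step_function:
  assumes S: "subordinator M S \<nu>"
  shows "(\<integral>\<^sup>+ t. (\<integral>\<^sup>+ s. (\<Sum>n. ennreal (a n) * indicator {l n<..r n} s) \<partial>distr M borel (S t)) * indicator {0<..} t \<partial>lborel)
       = (\<Sum>n. ennreal (a n) * potential M S (l n) (r n))"
proof -
  note [measurable] = subordinator_cdf_measurable[OF S]
  have "(\<integral>\<^sup>+ t. (\<integral>\<^sup>+ s. (\<Sum>n. ennreal (a n) * indicator {l n<..r n} s) \<partial>distr M borel (S t)) * indicator {0<..} t \<partial>lborel)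
      = (\<integral>\<^sup>+ t. (\<Sum>n. ennreal (a n) * (emeasure (distr M borel (S t)) {l n<..r n} * indicator {0<..} t)) \<partial>lborel)"
  proof (rule nn_integral_cong)
    fix t :: real
    have "(\<integral>\<^sup>+ s. (\<Sum>n. ennreal (a n) * indicator {l n<..r n} s) \<partial>distr M borel (S t))
        = (\<Sum>n. ennreal (a n) * emeasure (distr M borel (S t)) {l n<..r n})"
      by (subst nn_integral_suminf) (auto simp: nn_integral_cmult_indicator)
    then show "(\<integral>\<^sup>+ s. (\<Sum>n. ennreal (a n) * indicator {l n<..r n} s) \<partial>distr M borel (S t)) * indicator {0<..} t
        = (\<Sum>n. ennreal (a n) * (emeasure (distr M borel (S t)) {l n<..r n} * indicator {0<..} t))"
      by (simp split: split_indicator)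
  qed
  also have "\<dots> = (\<Sum>n. ennreal (a n) * potential M S (l n) (r n))"
    unfolding potential_def by (subst nn_integral_suminf) (auto simp: nn_integral_cmult)
  finally show ?thesis .
qed

lemma green_integral_lower:
  assumes S: "subordinator M S \<nu>"
    and le: "\<And>s. 0 < s \<Longrightarrow> (\<Sum>n. ennreal (a n) * indicator {l n<..r n} s) \<le> ennreal (k s)"
    and l: "\<And>n. 0 \<le> l n"
  shows "(\<Sum>n. ennreal (a n) * potential M S (l n) (r n)) \<le> green_integral M S k"
  unfolding green_integral_step_function[OF S, symmetric] green_integral_def
proof (intro nn_integral_mono mult_right_mono)
  fix s :: real
  have "(\<Sum>n. ennreal (a n) * indicator {l n<..r n} s) = 0" if "s \<le> 0"
  proof (rule suminf_eq_zero_iff[THEN iffD2])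
    have "s \<notin> {l n<..r n}" for n using l[of n] that by auto
    then show "\<forall>n. ennreal (a n) * indicator {l n<..r n} s = 0" by simp
  qed auto
  then show "(\<Sum>n. ennreal (a n) * indicator {l n<..r n} s) \<le> ennreal (k s) * indicator {0<..} s"
    using le[of s] by (cases "0 < s") auto
qed auto

text \<open>
  Two families of intervals, for times below and above a reference time, and an exponential tail.
\<close>
lemma green_integral_upper:
  assumes S: "subordinator M S \<nu>"
    and le: "\<And>s. 0 < s \<Longrightarrow> ennreal (k s) \<le>
       (\<Sum>n. ennreal (a n) * indicator {l n<..r n} s) + (\<Sum>n. ennreal (a' n) * indicator {l' n<..r' n} s)
       + ennreal (e * exp (- u * s))"
    and u: "0 \<le> u" "0 < laplace_exponent \<nu> u" and e: "0 \<le> e"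
  shows "green_integral M S k \<le> (\<Sum>n. ennreal (a n) * potential M S (l n) (r n))
     + (\<Sum>n. ennreal (a' n) * potential M S (l' n) (r' n)) + ennreal (e / laplace_exponent \<nu> u)"
proof -
  note [measurable] = subordinator_cdf_measurable[OF S]
  define F where "F = (\<lambda>a l r s. \<Sum>n::nat. ennreal (a n) * indicator {l n<..r n::real} s)"
  have F[measurable]: "F a l r \<in> borel_measurable borel" for a l r unfolding F_def by measurable
  have meas: "(\<lambda>t. (\<integral>\<^sup>+ s. F a l r s \<partial>distr M borel (S t)) * indicator {0<..} t) \<in> borel_measurable lborel" for a l r
  proof -
    have eq: "(\<integral>\<^sup>+ s. F a l r s \<partial>distr M borel (S t)) * indicator {0<..} t
       = (\<Sum>n. ennreal (a n) * (emeasure (distr M borel (S t)) {l n<..r n} * indicator {0<..} t))" for t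
      unfolding F_def by (subst nn_integral_suminf) (auto simp: nn_integral_cmult_indicator split: split_indicator)
    show ?thesis unfolding eq by measurable
  qed
  have "green_integral M S k \<le> (\<integral>\<^sup>+ t. ((\<integral>\<^sup>+ s. F a l r s \<partial>distr M borel (S t)) * indicator {0<..} t
      + (\<integral>\<^sup>+ s. F a' l' r' s \<partial>distr M borel (S t)) * indicator {0<..} t)
      + ennreal e * (ennreal (exp (- t * laplace_exponent \<nu> u)) * indicator {0<..} t) \<partial>lborel)"
    unfolding green_integral_def
  proof (rule nn_integral_mono)
    fix t :: real
    have "(\<integral>\<^sup>+ s\<in>{0<..}. ennreal (k s) \<partial>distr M borel (S t))
       \<le> (\<integral>\<^sup>+ s. (F a l r s + F a' l' r' s) + ennreal e * ennreal (exp (- u * s)) \<partial>distr M borel (S t))"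
      using le e by (intro nn_integral_mono) (auto simp: F_def ennreal_mult[symmetric] split: split_indicator)
    also have "\<dots> = (\<integral>\<^sup>+ s. F a l r s \<partial>distr M borel (S t)) + (\<integral>\<^sup>+ s. F a' l' r' s \<partial>distr M borel (S t))
        + ennreal e * (\<integral>\<^sup>+ s. ennreal (exp (- u * s)) \<partial>distr M borel (S t))"
      by (simp add: nn_integral_add nn_integral_cmult)
    finally have "(\<integral>\<^sup>+ s\<in>{0<..}. ennreal (k s) \<partial>distr M borel (S t))
       \<le> (\<integral>\<^sup>+ s. F a l r s \<partial>distr M borel (S t)) + (\<integral>\<^sup>+ s. F a' l' r' s \<partial>distr M borel (S t))
        + ennreal e * ennreal (exp (- t * laplace_exponent \<nu> u))" if "0 < t"
      using subordinator_nn_laplace[OF S u(1), of t] that by simp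
    then show "(\<integral>\<^sup>+ s\<in>{0<..}. ennreal (k s) \<partial>distr M borel (S t)) * indicator {0<..} t
       \<le> ((\<integral>\<^sup>+ s. F a l r s \<partial>distr M borel (S t)) * indicator {0<..} t
      + (\<integral>\<^sup>+ s. F a' l' r' s \<partial>distr M borel (S t)) * indicator {0<..} t)
      + ennreal e * (ennreal (exp (- t * laplace_exponent \<nu> u)) * indicator {0<..} t)"
      by (auto split: split_indicator)
  qed
  also have "\<dots> = (\<integral>\<^sup>+ t. (\<integral>\<^sup>+ s. F a l r s \<partial>distr M borel (S t)) * indicator {0<..} t \<partial>lborel)
      + (\<integral>\<^sup>+ t. (\<integral>\<^sup>+ s. F a' l' r' s \<partial>distr M borel (S t)) * indicator {0<..} t \<partial>lborel)
      + ennreal e * (\<integral>\<^sup>+ t\<in>{0<..}. ennreal (exp (- t * laplace_exponent \<nu> u)) \<partial>lborel)"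
    using meas by (simp add: nn_integral_add nn_integral_cmult)
  also have "\<dots> \<le> (\<Sum>n. ennreal (a n) * potential M S (l n) (r n))
     + (\<Sum>n. ennreal (a' n) * potential M S (l' n) (r' n)) + ennreal e * ennreal (1 / laplace_exponent \<nu> u)"
    unfolding F_def green_integral_step_function[OF S]
    by (intro add_mono order.refl mult_left_mono nn_integral_exp_decay u) simp
  also have "ennreal e * ennreal (1 / laplace_exponent \<nu> u) = ennreal (e / laplace_exponent \<nu> u)"
    using e u by (simp add: ennreal_mult[symmetric])
  finally show ?thesis .
qed

lemma geometric_interval_above:
  fixes K T s :: real
  assumes "1 < K" "0 < T" "T < s"
  shows "\<exists>n. K ^ n * T < s \<and> s \<le> K ^ Suc n * T"
proof -
  obtain m where "s / T < K ^ m" using real_arch_pow[OF assms(1)] by blast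
  then have "s \<le> K ^ m * T" using assms by (simp add: field_simps)
  then have ex: "\<exists>m. s \<le> K ^ m * T" ..
  define m where "m = (LEAST m. s \<le> K ^ m * T)"
  have m: "s \<le> K ^ m * T" unfolding m_def by (rule LeastI_ex) (rule ex)
  have "m \<noteq> 0" using m assms by (cases m) auto
  then obtain n where n: "m = Suc n" by (cases m) auto
  have "\<not> s \<le> K ^ n * T" using not_less_Least[of n "\<lambda>m. s \<le> K ^ m * T"] n by (simp add: m_def)
  then have "K ^ n * T < s \<and> s \<le> K ^ Suc n * T" using m n by auto
  then show ?thesis ..
qed

lemma geometric_interval_below:
  fixes K T s :: real
  assumes "1 < K" "0 < s" "s \<le> T"
  shows "\<exists>n. T / K ^ Suc n < s \<and> s \<le> T / K ^ n"
proof -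
  obtain m where "T / s < K ^ m" using real_arch_pow[OF assms(1)] by blast
  then have "T < K ^ m * s" using assms by (simp add: field_simps)
  then have ex: "\<exists>m. T < K ^ m * s" ..
  define m where "m = (LEAST m. T < K ^ m * s)"
  have m: "T < K ^ m * s" unfolding m_def by (rule LeastI_ex) (rule ex)
  have "m \<noteq> 0" using m assms by (cases m) auto
  then obtain n where n: "m = Suc n" by (cases m) auto
  have "\<not> T < K ^ n * s" using not_less_Least[of n "\<lambda>m. T < K ^ m * s"] n by (simp add: m_def)
  then show ?thesis using m n assms by (intro exI[of _ n]) (auto simp: field_simps)
qed

lemma le_suminf_ennreal: "f n \<le> (\<Sum>i. f i :: ennreal)"
  using sum_le_suminf[of f "{n}"] by simp

text \<open>
  The predicate \<open>adm\<close> cuts the grid off at the scale of the diameter; it is always true in unbounded sets.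
\<close>
definition scale_series :: "real \<Rightarrow> (real \<Rightarrow> bool) \<Rightarrow> real \<Rightarrow> (real \<Rightarrow> real) \<Rightarrow> ennreal" where
  "scale_series K adm T A = (\<Sum>n. ennreal (if adm (K ^ n * T) then A (K ^ n * T) else 0))"

lemma le_scale_series:
  assumes "adm (K ^ n * T)"
  shows "ennreal (A (K ^ n * T)) \<le> scale_series K adm T A"
  unfolding scale_series_def
  using le_suminf_ennreal[of "\<lambda>n. ennreal (if adm (K ^ n * T) then A (K ^ n * T) else 0)" n] assms
  by simp

text \<open>
  The intervals \<open>{s / K<..s}\<close> with \<open>s\<close> in the grid are disjoint, \<open>v\<close> is smallest at their right end points,
  and each has potential of order \<open>1 / laplace_exponent \<nu> (1 / s)\<close>.
\<close>
lemma green_integral_lower_series: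
  assumes S: "subordinator M S \<nu>" and K: "1 < K" and T: "0 < T"
    and \<phi>: "\<And>u. 0 < u \<Longrightarrow> 0 < laplace_exponent \<nu> u"
    and growth: "\<And>r. 0 < r \<Longrightarrow> adm r \<Longrightarrow> 24 * laplace_exponent \<nu> (1 / r) \<le> laplace_exponent \<nu> (K / r)"
    and v: "\<And>s. 0 < s \<Longrightarrow> 0 \<le> v s" "\<And>s t. 0 < s \<Longrightarrow> s \<le> t \<Longrightarrow> v t \<le> v s"
    and adm: "\<And>s t. 0 < s \<Longrightarrow> s \<le> t \<Longrightarrow> adm t \<Longrightarrow> adm s"
    and c: "0 < c" and k: "\<And>s. T / K \<le> s \<Longrightarrow> adm s \<Longrightarrow> c * v s \<le> k s"
  shows "ennreal (c / 32) * scale_series K adm T (\<lambda>s. v s / laplace_exponent \<nu> (1 / s))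
     \<le> green_integral M S k"
proof -
  define \<sigma> where "\<sigma> = (\<lambda>n. K ^ n * T)"
  have \<sigma>: "0 < \<sigma> n" for n using K T by (simp add: \<sigma>_def)
  have \<sigma>_mono: "\<sigma> m \<le> \<sigma> n" if "m \<le> n" for m n
    using K T that by (auto simp: \<sigma>_def intro!: mult_right_mono power_increasing)
  have \<sigma>K: "\<sigma> (Suc n) / K = \<sigma> n" "\<sigma> 0 / K = T / K" for n using K by (simp_all add: \<sigma>_def)
  define a where "a = (\<lambda>n. if adm (\<sigma> n) then c * v (\<sigma> n) else 0)"
  have "(\<Sum>n. ennreal (a n) * indicator {\<sigma> n / K<..\<sigma> n} s) \<le> ennreal (k s)" if "0 < s" for s
  proof (cases "\<exists>n. s \<in> {\<sigma> n / K<..\<sigma> n} \<and> adm (\<sigma> n)")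
    case False
    then have "(\<Sum>n. ennreal (a n) * indicator {\<sigma> n / K<..\<sigma> n} s) = 0"
      by (intro suminf_eq_zero_iff[THEN iffD2]) (auto split: split_indicator simp: a_def)
    then show ?thesis by simp
  next
    case True
    then obtain n where n: "\<sigma> n / K < s" "s \<le> \<sigma> n" "adm (\<sigma> n)" by auto
    have "s \<notin> {\<sigma> m / K<..\<sigma> m}" if "m \<noteq> n" for m
    proof
      assume m: "s \<in> {\<sigma> m / K<..\<sigma> m}"
      show False
      proof (cases m n rule: linorder_cases)
        case less
        then obtain n' where "n = Suc n'" "m \<le> n'" by (cases n) auto
        then show False using n(1) m \<sigma>_mono[of m n'] by (simp add: \<sigma>K)
      next
        case greater
        then obtain m' where "m = Suc m'" "n \<le> m'" by (cases m) auto
        then show False using n(2) m \<sigma>_mono[of n m'] by (simp add: \<sigma>K)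
      qed (use that in simp)
    qed
    then have "(\<lambda>m. ennreal (a m) * indicator {\<sigma> m / K<..\<sigma> m} s) sums (\<Sum>m\<in>{n}. ennreal (a m) * indicator {\<sigma> m / K<..\<sigma> m} s)"
      by (intro sums_finite) auto
    then have "(\<Sum>m. ennreal (a m) * indicator {\<sigma> m / K<..\<sigma> m} s) = ennreal (c * v (\<sigma> n))"
      using n by (simp add: sums_iff a_def)
    also have "\<dots> \<le> ennreal (k s)"
    proof (rule ennreal_leI)
      have "T / K \<le> \<sigma> n / K" using \<sigma>_mono[of 0 n] K by (simp add: \<sigma>_def divide_right_mono)
      then have "c * v s \<le> k s" using n that adm by (intro k) auto
      moreover have "c * v (\<sigma> n) \<le> c * v s" using c v(2) n that by (intro mult_left_mono) auto
      ultimately show "c * v (\<sigma> n) \<le> k s" by linarith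
    qed
    finally show ?thesis .
  qed
  then have "(\<Sum>n. ennreal (a n) * potential M S (\<sigma> n / K) (\<sigma> n)) \<le> green_integral M S k"
    using \<sigma> K by (intro green_integral_lower[OF S]) (auto intro: less_imp_le)
  moreover have "ennreal (c / 32) * scale_series K adm T (\<lambda>s. v s / laplace_exponent \<nu> (1 / s))
      \<le> (\<Sum>n. ennreal (a n) * potential M S (\<sigma> n / K) (\<sigma> n))"
    unfolding scale_series_def ennreal_suminf_cmult[symmetric] \<sigma>_def[symmetric]
  proof (intro suminf_le summableI)
    fix n
    show "ennreal (c / 32) * ennreal (if adm (K ^ n * T) then v (K ^ n * T) / laplace_exponent \<nu> (1 / (K ^ n * T)) else 0)
       \<le> ennreal (a n) * potential M S (\<sigma> n / K) (\<sigma> n)"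
    proof (cases "adm (\<sigma> n)")
      case True
      have l: "0 < laplace_exponent \<nu> (1 / \<sigma> n)" using \<phi> \<sigma> by simp
      have "ennreal (c / 32) * ennreal (v (\<sigma> n) / laplace_exponent \<nu> (1 / \<sigma> n))
         = ennreal (a n) * ennreal (1 / (32 * laplace_exponent \<nu> (1 / \<sigma> n)))"
        using c v(1)[OF \<sigma>] l True by (simp add: a_def ennreal_mult[symmetric])
      also have "\<dots> \<le> ennreal (a n) * potential M S (\<sigma> n / K) (\<sigma> n)"
        using K \<sigma> l True by (intro mult_left_mono potential_lower[OF S] growth) auto
      finally show ?thesis using True by (simp add: \<sigma>_def)
    qed (simp add: \<sigma>_def)
  qed
  ultimately show ?thesis by (rule order.trans[rotated])
qed

text \<open>
  Times below \<open>T\<close> are cut into the intervals between consecutive \<open>T / K ^ n\<close>. There the kernel is at most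
  \<open>(s / T) powr \<theta>\<close> times its envelope at \<open>T\<close>, while the potential decreases like \<open>K powr (- n * \<beta>)\<close>; since
  \<open>\<theta> + \<beta> > 0\<close>, the resulting geometric series is of the order of the first term of the grid sum. The
  tail, which decays exponentially, is absorbed by one suitable grid point.
\<close>
lemma green_integral_upper_series:
  assumes S: "subordinator M S \<nu>" and K: "1 < K" and T: "0 < T" "adm T"
    and \<nu>: "levy_measure \<nu>"
    and \<phi>: "\<And>u. 0 < u \<Longrightarrow> 0 < laplace_exponent \<nu> u"
    and \<phi>_low: "\<And>s t. 0 < s \<Longrightarrow> s \<le> t \<Longrightarrow> adm t \<Longrightarrow>
       c * (t / s) powr \<beta> * laplace_exponent \<nu> (1 / t) \<le> laplace_exponent \<nu> (1 / s)" and c: "0 < c"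
    and \<theta>: "\<theta> \<le> 0" "0 < \<theta> + \<beta>"
    and v: "\<And>s. 0 < s \<Longrightarrow> 0 \<le> v s" "\<And>s t. 0 < s \<Longrightarrow> s \<le> t \<Longrightarrow> v t \<le> v s"
    and adm: "\<And>s t. 0 < s \<Longrightarrow> s \<le> t \<Longrightarrow> adm t \<Longrightarrow> adm s"
    and C1: "0 \<le> C1"
    and k1: "\<And>s. 0 < s \<Longrightarrow> s \<le> T \<Longrightarrow> k s \<le> C1 * v T * (s / T) powr \<theta>"
    and k2: "\<And>s. T \<le> s \<Longrightarrow> adm s \<Longrightarrow> k s \<le> C1 * v s"
    and k3: "\<And>s. 0 < s \<Longrightarrow> \<not> adm s \<Longrightarrow> k s \<le> e * exp (- u * s)"
    and e: "0 \<le> e" "0 < u" "adm (K ^ N * T)"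
       "e / laplace_exponent \<nu> u \<le> C2 * (v (K ^ N * T) / laplace_exponent \<nu> (1 / (K ^ N * T)))"
    and C2: "0 \<le> C2"
  shows "green_integral M S k \<le>
     ennreal (C1 * exp 1 * K powr (- \<theta>) / (c * (1 - K powr (- (\<theta> + \<beta>)))) + C1 * exp 1 * K + C2)
     * scale_series K adm T (\<lambda>s. v s / laplace_exponent \<nu> (1 / s))"
proof -
  let ?l = "\<lambda>t. laplace_exponent \<nu> (1 / t)"
  let ?G = "scale_series K adm T (\<lambda>s. v s / ?l s)"
  define \<sigma> where "\<sigma> = (\<lambda>n. K ^ n * T)"
  have \<sigma>: "0 < \<sigma> n" for n using K T by (simp add: \<sigma>_def)
  define q where "q = K powr (- (\<theta> + \<beta>))"
  have q: "0 < q" "q < 1" using K \<theta> by (auto simp: q_def powr_less_one)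
  define a where "a = (\<lambda>n::nat. C1 * v T * (1 / K ^ Suc n) powr \<theta>)"
  define b where "b = (\<lambda>n. if adm (\<sigma> n) then C1 * v (\<sigma> n) else 0)"
  have a0: "0 \<le> a n" and b0: "0 \<le> b n" for n
    using C1 v(1) T \<sigma> by (auto simp: a_def b_def)
  have "ennreal (k s) \<le> (\<Sum>n. ennreal (a n) * indicator {T / K ^ Suc n<..T / K ^ n} s)
      + (\<Sum>n. ennreal (b n) * indicator {\<sigma> n<..\<sigma> (Suc n)} s) + ennreal (e * exp (- u * s))" if s: "0 < s" for s
  proof (cases "s \<le> T")
    case True
    then obtain n where n: "T / K ^ Suc n < s" "s \<le> T / K ^ n"
      using geometric_interval_below[OF K s] by blast
    have "1 / K ^ Suc n \<le> s / T" using n T K by (simp add: field_simps)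
    then have "(s / T) powr \<theta> \<le> (1 / K ^ Suc n) powr \<theta>"
      using \<theta> K by (intro powr_mono2') auto
    then have "k s \<le> a n" using k1[OF s True] C1 v(1)[OF T(1)] unfolding a_def
      by (meson mult_left_mono mult_nonneg_nonneg order.trans)
    then have "ennreal (k s) \<le> ennreal (a n) * indicator {T / K ^ Suc n<..T / K ^ n} s"
      using n by (simp add: ennreal_leI)
    also have "\<dots> \<le> (\<Sum>n. ennreal (a n) * indicator {T / K ^ Suc n<..T / K ^ n} s)"
      by (rule le_suminf_ennreal)
    finally show ?thesis by (simp add: add_increasing2)
  next
    case False
    show ?thesis
    proof (cases "adm s")
      case True
      obtain n where n: "\<sigma> n < s" "s \<le> \<sigma> (Suc n)"
        using geometric_interval_above[OF K T(1)] False unfolding \<sigma>_def by (metis not_le)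
      have d: "adm (\<sigma> n)" using adm[OF \<sigma> _ True] n by simp
      have "k s \<le> C1 * v s" using k2 True False by simp
      also have "\<dots> \<le> C1 * v (\<sigma> n)" using n \<sigma> C1 by (intro mult_left_mono v) auto
      also have "\<dots> = b n" using d by (simp add: b_def)
      finally have "ennreal (k s) \<le> ennreal (b n) * indicator {\<sigma> n<..\<sigma> (Suc n)} s"
        using n by (simp add: ennreal_leI)
      also have "\<dots> \<le> (\<Sum>n. ennreal (b n) * indicator {\<sigma> n<..\<sigma> (Suc n)} s)"
        by (rule le_suminf_ennreal)
      finally show ?thesis by (simp add: add_increasing add_increasing2)
    next
      case False
      then show ?thesis using k3[OF s False] by (simp add: add_increasing ennreal_leI)
    qed
  qed
  then have "green_integral M S k \<le> (\<Sum>n. ennreal (a n) * potential M S (T / K ^ Suc n) (T / K ^ n))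
     + (\<Sum>n. ennreal (b n) * potential M S (\<sigma> n) (\<sigma> (Suc n))) + ennreal (e / laplace_exponent \<nu> u)"
    by (rule green_integral_upper[OF S]) (use e \<phi> in auto)
  also have "\<dots> \<le> ennreal (C1 * exp 1 * K powr (- \<theta>) / (c * (1 - q))) * ?G + ennreal (C1 * exp 1 * K) * ?G
      + ennreal C2 * ?G"
  proof (rule add_mono[OF add_mono])
    have G0: "ennreal (v T / ?l T) \<le> ?G"
      using le_scale_series[of adm K 0 T "\<lambda>s. v s / ?l s"] T by simp
    define H where "H = C1 * exp 1 * K powr (- \<theta>) / c * (v T / ?l T)"
    have H: "0 \<le> H" using C1 c v(1) T \<phi>[of "1 / T"] by (simp add: H_def)
    have "(\<Sum>n. ennreal (a n) * potential M S (T / K ^ Suc n) (T / K ^ n)) \<le> (\<Sum>n. ennreal (H * q ^ n))"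
    proof (intro suminf_le summableI)
      fix n
      have r: "0 < T / K ^ n" "T / K ^ n \<le> T" using K T by (auto simp: field_simps)
      have lr: "0 < ?l (T / K ^ n)" "0 < ?l T" using \<phi>[of "1 / (T / K ^ n)"] \<phi>[of "1 / T"] r(1) T(1) K by simp_all
      have Kn: "T / (T / K ^ n) = K ^ n" using K T by simp
      have Kp: "(K ^ n) powr x = K powr (x * real n)" for x
      proof -
        have "(K ^ n) powr x = (K powr real n) powr x" using K by (simp add: powr_realpow)
        then show ?thesis by (simp add: powr_powr mult.commute)
      qed
      have qn: "q ^ n = (K ^ n) powr (- \<theta>) * (K ^ n) powr (- \<beta>)"
        unfolding Kp q_def using K
        by (simp add: powr_power flip: powr_add) (simp add: algebra_simps)
      have "ennreal (a n) * potential M S (T / K ^ Suc n) (T / K ^ n)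
         \<le> ennreal (a n) * ennreal (exp 1 / ?l (T / K ^ n))"
        by (intro mult_left_mono potential_upper[OF S]) (use r lr in auto)
      also have "\<dots> = ennreal (a n * (exp 1 / ?l (T / K ^ n)))"
        by (rule ennreal_mult[symmetric]) (use a0 lr(1) in \<open>auto intro!: divide_nonneg_pos\<close>)
      also have "\<dots> \<le> ennreal (H * q ^ n)"
      proof (rule ennreal_leI)
        have "c * (K ^ n) powr \<beta> * ?l T \<le> ?l (T / K ^ n)"
          using \<phi>_low[OF r T(2)] unfolding Kn by simp
        then have "exp 1 / ?l (T / K ^ n) \<le> exp 1 / (c * (K ^ n) powr \<beta> * ?l T)"
          using c K lr by (intro divide_left_mono mult_pos_pos) auto
        then have "a n * (exp 1 / ?l (T / K ^ n)) \<le> a n * (exp 1 / (c * (K ^ n) powr \<beta> * ?l T))"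
          using a0 by (rule mult_left_mono)
        also have "\<dots> = H * q ^ n"
        proof -
          have "(1 / K ^ Suc n) powr \<theta> = K powr (- \<theta>) * (K ^ n) powr (- \<theta>)"
            using K by (simp add: powr_divide powr_mult powr_minus) (simp add: divide_inverse)
          then show ?thesis unfolding a_def H_def qn powr_minus[of _ \<beta>] by (simp add: field_simps)
        qed
        finally show "a n * (exp 1 / ?l (T / K ^ n)) \<le> H * q ^ n" .
      qed
      finally show "ennreal (a n) * potential M S (T / K ^ Suc n) (T / K ^ n) \<le> ennreal (H * q ^ n)" .
    qed
    also have "\<dots> = ennreal (H * (1 / (1 - q)))"
    proof (rule suminf_ennreal_eq)
      show "(\<lambda>n. H * q ^ n) sums (H * (1 / (1 - q)))"
        using q by (intro sums_mult geometric_sums) auto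
    qed (use H q in simp)
    also have "\<dots> = ennreal (C1 * exp 1 * K powr (- \<theta>) / (c * (1 - q))) * ennreal (v T / ?l T)"
      using C1 c q v(1) T \<phi>[of "1 / T"] by (subst ennreal_mult[symmetric]) (auto simp: H_def)
    also have "\<dots> \<le> ennreal (C1 * exp 1 * K powr (- \<theta>) / (c * (1 - q))) * ?G"
      by (intro mult_left_mono G0) simp
    finally show "(\<Sum>n. ennreal (a n) * potential M S (T / K ^ Suc n) (T / K ^ n))
      \<le> ennreal (C1 * exp 1 * K powr (- \<theta>) / (c * (1 - q))) * ?G" .
    show "(\<Sum>n. ennreal (b n) * potential M S (\<sigma> n) (\<sigma> (Suc n))) \<le> ennreal (C1 * exp 1 * K) * ?G"
      unfolding scale_series_def ennreal_suminf_cmult[symmetric] \<sigma>_def[symmetric]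
    proof (intro suminf_le summableI)
      fix n
      show "ennreal (b n) * potential M S (\<sigma> n) (\<sigma> (Suc n))
         \<le> ennreal (C1 * exp 1 * K) * ennreal (if adm (K ^ n * T) then v (K ^ n * T) / ?l (K ^ n * T) else 0)"
      proof (cases "adm (\<sigma> n)")
        case True
        have l: "0 < ?l (\<sigma> n)" "0 < ?l (\<sigma> (Suc n))" using \<phi> \<sigma> by auto
        have "?l (\<sigma> n) \<le> K * ?l (\<sigma> (Suc n))"
          using laplace_exponent_mult_le[OF \<nu>, of "1 / \<sigma> (Suc n)" K] K \<sigma>[of "Suc n"] by (simp add: \<sigma>_def)
        then have "exp 1 / ?l (\<sigma> (Suc n)) \<le> exp 1 * K / ?l (\<sigma> n)"
          using l by (simp add: field_simps)
        then have le: "b n * (exp 1 / ?l (\<sigma> (Suc n))) \<le> b n * (exp 1 * K / ?l (\<sigma> n))"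
          using b0 by (rule mult_left_mono)
        have "ennreal (b n) * potential M S (\<sigma> n) (\<sigma> (Suc n))
           \<le> ennreal (b n) * ennreal (exp 1 / ?l (\<sigma> (Suc n)))"
          by (intro mult_left_mono potential_upper[OF S]) (use \<sigma> l in auto)
        also have "\<dots> \<le> ennreal (b n * (exp 1 * K / ?l (\<sigma> n)))"
          using b0 l le by (subst ennreal_mult[symmetric]) (auto intro!: ennreal_leI)
        also have "\<dots> = ennreal (C1 * exp 1 * K) * ennreal (v (\<sigma> n) / ?l (\<sigma> n))"
          using True C1 K v(1)[OF \<sigma>] l by (subst ennreal_mult[symmetric]) (auto simp: b_def mult_ac)
        finally show ?thesis using True by (simp add: \<sigma>_def)
      qed (simp add: b_def \<sigma>_def)
    qed
    have "ennreal (e / laplace_exponent \<nu> u) \<le> ennreal C2 * ennreal (v (\<sigma> N) / ?l (\<sigma> N))"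
      using e(4) C2 v(1)[OF \<sigma>] \<phi>[of "1 / \<sigma> N"] \<sigma>[of N]
      by (subst ennreal_mult[symmetric]) (auto simp: \<sigma>_def intro!: ennreal_leI)
    also have "ennreal (v (\<sigma> N) / ?l (\<sigma> N)) \<le> ?G"
      unfolding \<sigma>_def by (rule le_scale_series[of adm K N T "\<lambda>s. v s / ?l s", OF e(3)])
    finally show "ennreal (e / laplace_exponent \<nu> u) \<le> ennreal C2 * ?G" by (simp add: mult_left_mono)
  qed
  also have "\<dots> = ennreal (C1 * exp 1 * K powr (- \<theta>) / (c * (1 - q)) + C1 * exp 1 * K + C2) * ?G"
    using C1 C2 K c q by (simp add: ennreal_plus[symmetric] distrib_right[symmetric] del: ennreal_plus)
  finally show ?thesis by (simp add: q_def)
qed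

lemma scale_series_mono:
  assumes "1 < K" "0 < T" "\<And>s. T \<le> s \<Longrightarrow> adm s \<Longrightarrow> A s \<le> B s"
  shows "scale_series K adm T A \<le> scale_series K adm T B"
  unfolding scale_series_def
proof (intro suminf_le summableI)
  fix n
  have "T \<le> K ^ n * T" using assms(1,2) by simp
  then show "ennreal (if adm (K ^ n * T) then A (K ^ n * T) else 0)
      \<le> ennreal (if adm (K ^ n * T) then B (K ^ n * T) else 0)"
    using assms(3) by (auto intro!: ennreal_leI)
qed

lemma scale_series_add:
  assumes "1 < K" "0 < T" "\<And>s. T \<le> s \<Longrightarrow> 0 \<le> A s" "\<And>s. T \<le> s \<Longrightarrow> 0 \<le> B s"
  shows "scale_series K adm T (\<lambda>s. A s + B s) = scale_series K adm T A + scale_series K adm T B"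
proof -
  have T: "T \<le> K ^ n * T" for n using assms(1,2) by simp
  show ?thesis
    unfolding scale_series_def using assms(3,4)[OF T]
    by (subst suminf_add) (auto intro!: suminf_cong simp: ennreal_plus)
qed

text \<open>
  A power decay beyond \<open>\<Delta>\<close>: a geometric series starting at the first grid point above \<open>\<Delta>\<close>.
\<close>
lemma scale_series_tail:
  assumes K: "1 < K" and T: "0 < T" and \<Delta>: "0 < \<Delta>" and q: "0 < q" and H: "0 \<le> H"
  shows "scale_series K adm T (\<lambda>s. if \<Delta> \<le> s then H * (\<Delta> / s) powr q else 0)
     \<le> ennreal (H / (1 - K powr (- q)))"
proof -
  define r where "r = K powr (- q)"
  have r: "0 < r" "r < 1" using K q by (auto simp: r_def powr_less_one)
  obtain m where "\<Delta> / T < K ^ m" using real_arch_pow[OF K] by blast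
  then have "\<Delta> \<le> K ^ m * T" using T by (simp add: field_simps)
  then have ex: "\<exists>m. \<Delta> \<le> K ^ m * T" ..
  define n0 where "n0 = (LEAST m. \<Delta> \<le> K ^ m * T)"
  have n0: "\<Delta> \<le> K ^ n0 * T" unfolding n0_def by (rule LeastI_ex) (rule ex)
  have less: "\<not> \<Delta> \<le> K ^ n * T" if "n < n0" for n using that unfolding n0_def by (rule not_less_Least)
  define f where "f = (\<lambda>n. ennreal (if adm (K ^ n * T) then if \<Delta> \<le> K ^ n * T then H * (\<Delta> / (K ^ n * T)) powr q else 0 else 0))"
  have "(\<Sum>n. f n) = (\<Sum>n. f (n + n0)) + (\<Sum>n<n0. f n)"
    by (rule suminf_offset) simp
  also have "(\<Sum>n<n0. f n) = 0" using less by (auto simp: f_def)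
  also have "(\<Sum>n. f (n + n0)) \<le> (\<Sum>n. ennreal (H * r ^ n))"
  proof (intro suminf_le summableI)
    fix n
    have "\<Delta> / (K ^ (n + n0) * T) \<le> 1 / K ^ n"
      using n0 K T by (simp add: power_add field_simps)
    then have "(\<Delta> / (K ^ (n + n0) * T)) powr q \<le> (1 / K ^ n) powr q"
      using q K T \<Delta> by (intro powr_mono2) auto
    also have "(1 / K ^ n) powr q = r ^ n"
    proof -
      have "(1 / K ^ n) powr q = (K powr (- real n)) powr q"
        using K by (simp add: powr_minus_divide powr_realpow)
      also have "\<dots> = r ^ n" using K by (simp add: r_def powr_powr powr_power)
      finally show ?thesis .
    qed
    finally have "H * (\<Delta> / (K ^ (n + n0) * T)) powr q \<le> H * r ^ n" using H by (rule mult_left_mono)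
    moreover have "0 \<le> H * r ^ n" using H r by simp
    ultimately show "f (n + n0) \<le> ennreal (H * r ^ n)" by (auto simp: f_def intro!: ennreal_leI)
  qed
  also have "(\<Sum>n. ennreal (H * r ^ n)) = ennreal (H * (1 / (1 - r)))"
  proof (rule suminf_ennreal_eq)
    show "(\<lambda>n. H * r ^ n) sums (H * (1 / (1 - r)))"
      using r by (intro sums_mult geometric_sums) auto
  qed (use H r in simp)
  finally show ?thesis by (simp add: scale_series_def f_def r_def add_right_mono)
qed

text \<open>
  A power growth up to \<open>\<Delta>\<close>: a geometric series read backwards from the last grid point below \<open>\<Delta>\<close>.
\<close>
lemma scale_series_head:
  assumes K: "1 < K" and T: "0 < T" and \<Delta>: "0 < \<Delta>" and q: "0 < q" and H: "0 \<le> H"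
  shows "scale_series K adm T (\<lambda>s. if s \<le> \<Delta> then H * (s / \<Delta>) powr q else 0)
     \<le> ennreal (H / (1 - K powr (- q)))"
proof -
  define r where "r = K powr (- q)"
  have r: "0 < r" "r < 1" using K q by (auto simp: r_def powr_less_one)
  define f where "f = (\<lambda>n. ennreal (if adm (K ^ n * T) then if K ^ n * T \<le> \<Delta> then H * (K ^ n * T / \<Delta>) powr q else 0 else 0))"
  show ?thesis
  proof (cases "T \<le> \<Delta>")
    case False
    have "\<not> K ^ n * T \<le> \<Delta>" for n
      using False K T by (smt (verit) mult_le_cancel_right1 one_le_power)
    then have "f n = 0" for n by (auto simp: f_def)
    then have "(\<Sum>n. f n) = 0" by simp
    then show ?thesis by (simp add: scale_series_def f_def)
  next
    case True
    obtain N where N: "\<Delta> / K ^ Suc N < T" "T \<le> \<Delta> / K ^ N"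
      using geometric_interval_below[OF K T True] by blast
    have z: "f n = 0" if "n \<notin> {..N}" for n
    proof -
      have "K ^ Suc N * T \<le> K ^ n * T" using that K T by (intro mult_right_mono power_increasing) auto
      moreover have "\<Delta> < K ^ Suc N * T" using N(1) K by (simp add: field_simps)
      ultimately have "\<not> K ^ n * T \<le> \<Delta>" by linarith
      then show ?thesis by (simp add: f_def)
    qed
    have "(\<Sum>n. f n) = (\<Sum>n\<le>N. f n)" by (rule suminf_finite) (use z in auto)
    also have "\<dots> \<le> (\<Sum>n\<le>N. ennreal (H * r ^ (N - n)))"
    proof (rule sum_mono)
      fix n assume n: "n \<in> {..N}"
      have "K ^ N = K ^ n * K ^ (N - n)" using n by (simp flip: power_add)
      then have "K ^ n * T / \<Delta> \<le> 1 / K ^ (N - n)"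
        using N(2) K \<Delta> by (simp add: field_simps)
      then have "(K ^ n * T / \<Delta>) powr q \<le> (1 / K ^ (N - n)) powr q"
        using q K T \<Delta> by (intro powr_mono2) auto
      also have "(1 / K ^ (N - n)) powr q = r ^ (N - n)"
      proof -
        have "(1 / K ^ (N - n)) powr q = (K powr (- real (N - n))) powr q"
          using K by (simp add: powr_minus_divide powr_realpow del: of_nat_diff)
        also have "\<dots> = r ^ (N - n)" using K by (simp add: r_def powr_powr powr_power del: of_nat_diff)
        finally show ?thesis .
      qed
      finally have "H * (K ^ n * T / \<Delta>) powr q \<le> H * r ^ (N - n)" using H by (rule mult_left_mono)
      moreover have "0 \<le> H * r ^ (N - n)" using H r by simp
      ultimately show "f n \<le> ennreal (H * r ^ (N - n))" by (auto simp: f_def intro!: ennreal_leI)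
    qed
    also have "\<dots> = (\<Sum>n\<le>N. ennreal (H * r ^ n))"
      using sum.nat_diff_reindex[of "\<lambda>n. ennreal (H * r ^ n)" "Suc N"] by (simp add: lessThan_Suc_atMost)
    also have "\<dots> \<le> (\<Sum>n. ennreal (H * r ^ n))" by (rule sum_le_suminf) auto
    also have "\<dots> = ennreal (H * (1 / (1 - r)))"
    proof (rule suminf_ennreal_eq)
      show "(\<lambda>n. H * r ^ n) sums (H * (1 / (1 - r)))"
        using r by (intro sums_mult geometric_sums) auto
    qed (use H r in simp)
    finally show ?thesis by (simp add: scale_series_def f_def r_def)
  qed
qed

lemma scale_index_set:
  fixes K :: real
  assumes K: "1 < K" and T: "0 < T" and \<Delta>: "0 < \<Delta>1" "0 < \<Delta>2"
  shows "{n. \<Delta>1 \<le> K ^ n * T \<and> K ^ n * T \<le> \<Delta>2} = {n. log K (\<Delta>1 / T) \<le> real n \<and> real n \<le> log K (\<Delta>2 / T)}"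
proof -
  have "(\<Delta>1 \<le> K ^ n * T) = (log K (\<Delta>1 / T) \<le> real n)" for n
    using assms by (simp add: log_le_iff powr_realpow field_simps)
  moreover have "(K ^ n * T \<le> \<Delta>2) = (real n \<le> log K (\<Delta>2 / T))" for n
    using assms by (simp add: le_log_iff powr_realpow field_simps)
  ultimately show ?thesis by simp
qed

lemma card_nat_interval_upper:
  fixes a b :: real
  assumes "a \<le> b"
  shows "finite {n. a \<le> real n \<and> real n \<le> b}" "real (card {n. a \<le> real n \<and> real n \<le> b}) \<le> 1 + (b - a)"
proof -
  let ?A = "{n. a \<le> real n \<and> real n \<le> b}"
  have "?A \<subseteq> {..nat \<lfloor>b\<rfloor>}" by (auto simp: le_nat_iff le_floor_iff)
  then show fin: "finite ?A" by (rule finite_subset) simp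
  have "int ` ?A \<subseteq> {\<lceil>a\<rceil>..\<lfloor>b\<rfloor>}" by (auto simp: le_floor_iff ceiling_le_iff)
  then have "card (int ` ?A) \<le> card {\<lceil>a\<rceil>..\<lfloor>b\<rfloor>}" by (intro card_mono) auto
  then have "card ?A \<le> nat (\<lfloor>b\<rfloor> + 1 - \<lceil>a\<rceil>)" by (simp add: card_image)
  then have "real (card ?A) \<le> real (nat (\<lfloor>b\<rfloor> + 1 - \<lceil>a\<rceil>))" by simp
  also have "\<dots> \<le> 1 + (b - a)"
    using assms by linarith
  finally show "real (card ?A) \<le> 1 + (b - a)" .
qed

lemma card_nat_interval_lower:
  fixes a b :: real
  assumes "0 \<le> a"
  shows "b - a - 1 \<le> real (card {n. a \<le> real n \<and> real n \<le> b})"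
proof (cases "a \<le> b")
  case True
  let ?A = "{n. a \<le> real n \<and> real n \<le> b}"
  have "{nat \<lceil>a\<rceil>..nat \<lfloor>b\<rfloor>} \<subseteq> ?A"
    using assms True by (auto simp: le_nat_iff nat_le_iff le_floor_iff ceiling_le_iff)
  then have "card {nat \<lceil>a\<rceil>..nat \<lfloor>b\<rfloor>} \<le> card ?A"
    using card_nat_interval_upper[OF True] by (intro card_mono) auto
  then have "real (Suc (nat \<lfloor>b\<rfloor>) - nat \<lceil>a\<rceil>) \<le> real (card ?A)" by simp
  moreover have "b - a - 1 \<le> real (Suc (nat \<lfloor>b\<rfloor>) - nat \<lceil>a\<rceil>)"
    using assms True by linarith
  ultimately show ?thesis by linarith
qed simp

text \<open>
  A constant summand turns the grid sum into a count of grid points, that is, into a logarithm.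
\<close>
lemma scale_series_count_upper:
  assumes K: "1 < K" and T: "0 < T" and \<Delta>: "0 < \<Delta>1" "\<Delta>1 \<le> \<Delta>2" and H: "0 \<le> H"
  shows "scale_series K adm T (\<lambda>s. if \<Delta>1 \<le> s \<and> s \<le> \<Delta>2 then H else 0)
     \<le> ennreal (H * (1 + log K (\<Delta>2 / \<Delta>1)))"
proof -
  have "0 < \<Delta>2" using \<Delta> by simp
  let ?A = "{n. \<Delta>1 \<le> K ^ n * T \<and> K ^ n * T \<le> \<Delta>2}"
  have A: "?A = {n. log K (\<Delta>1 / T) \<le> real n \<and> real n \<le> log K (\<Delta>2 / T)}"
    using scale_index_set[OF K T] \<Delta> by auto
  have "log K (\<Delta>1 / T) \<le> log K (\<Delta>2 / T)"
    using \<Delta> K T by (simp add: divide_right_mono)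
  note c = card_nat_interval_upper[OF this]
  have d: "log K (\<Delta>2 / T) - log K (\<Delta>1 / T) = log K (\<Delta>2 / \<Delta>1)"
    using \<Delta> K T by (simp add: log_divide)
  have "scale_series K adm T (\<lambda>s. if \<Delta>1 \<le> s \<and> s \<le> \<Delta>2 then H else 0)
      \<le> (\<Sum>n. ennreal (if n \<in> ?A then H else 0))"
    unfolding scale_series_def by (intro suminf_le summableI) (auto intro!: ennreal_leI H)
  also have "\<dots> = (\<Sum>n\<in>?A. ennreal (if n \<in> ?A then H else 0))"
    by (rule suminf_finite) (use c(1) A in auto)
  also have "\<dots> = ennreal (real (card ?A) * H)"
    using H by (simp add: ennreal_mult ennreal_of_nat_eq_real_of_nat)
  also have "\<dots> \<le> ennreal (H * (1 + log K (\<Delta>2 / \<Delta>1)))"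
    using c(2) H unfolding A d by (intro ennreal_leI) (simp add: mult.commute mult_left_mono)
  finally show ?thesis .
qed

lemma scale_series_count_lower:
  assumes K: "1 < K" and T: "0 < T" and \<Delta>: "T \<le> \<Delta>1" "\<Delta>1 \<le> \<Delta>2" and H: "0 \<le> H"
    and A: "\<And>s. \<Delta>1 \<le> s \<Longrightarrow> s \<le> \<Delta>2 \<Longrightarrow> adm s \<and> H \<le> A s"
  shows "ennreal (H * (log K (\<Delta>2 / \<Delta>1) - 1)) \<le> scale_series K adm T A"
proof -
  have pos: "0 < \<Delta>1" "0 < \<Delta>2" using \<Delta> T by auto
  let ?A = "{n. \<Delta>1 \<le> K ^ n * T \<and> K ^ n * T \<le> \<Delta>2}"
  have A': "?A = {n. log K (\<Delta>1 / T) \<le> real n \<and> real n \<le> log K (\<Delta>2 / T)}"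
    using scale_index_set[OF K T] pos by auto
  have le: "log K (\<Delta>1 / T) \<le> log K (\<Delta>2 / T)" "0 \<le> log K (\<Delta>1 / T)"
    using \<Delta> K T pos by (simp_all add: divide_right_mono)
  have d: "log K (\<Delta>2 / T) - log K (\<Delta>1 / T) = log K (\<Delta>2 / \<Delta>1)"
    using pos K T by (simp add: log_divide)
  have "ennreal (H * (log K (\<Delta>2 / \<Delta>1) - 1)) \<le> ennreal (real (card ?A) * H)"
    using card_nat_interval_lower[OF le(2), of "log K (\<Delta>2 / T)"] H
    unfolding A' d by (intro ennreal_leI) (simp add: mult.commute mult_left_mono)
  also have "\<dots> = (\<Sum>n\<in>?A. ennreal H)"
    using H by (simp add: ennreal_mult ennreal_of_nat_eq_real_of_nat)
  also have "\<dots> \<le> (\<Sum>n\<in>?A. ennreal (if adm (K ^ n * T) then A (K ^ n * T) else 0))"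
    using A by (intro sum_mono) (auto intro!: ennreal_leI)
  also have "\<dots> \<le> scale_series K adm T A"
    unfolding scale_series_def
    by (rule sum_le_suminf) (use card_nat_interval_upper(1)[OF le(1)] A' in auto)
  finally show ?thesis .
qed

lemma scale_series_infinite:
  assumes K: "1 < K" and T: "0 < T" and H: "0 < H"
    and A: "\<And>s. T \<le> s \<Longrightarrow> adm s \<and> H \<le> A s"
  shows "scale_series K adm T A = \<infinity>"
proof -
  have "ennreal (real n) \<le> scale_series K adm T A" for n
  proof -
    define N where "N = nat \<lceil>real n / H\<rceil> + 1"
    have "ennreal (real n) \<le> ennreal (H * (log K (K ^ N * T / T) - 1))"
    proof (rule ennreal_leI)
      have "real n / H \<le> real N - 1" by (simp add: N_def) linarith
      then show "real n \<le> H * (log K (K ^ N * T / T) - 1)"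
        using T K H by (simp add: log_nat_power field_simps)
    qed
    also have "\<dots> \<le> scale_series K adm T A"
      using T K H A by (intro scale_series_count_lower) auto
    finally show ?thesis .
  qed
  then have "(SUP n. ennreal (real n)) \<le> scale_series K adm T A" by (rule SUP_least)
  then show ?thesis
    unfolding ennreal_of_nat_eq_real_of_nat[symmetric] ennreal_SUP_of_nat_eq_top
    by (simp add: top_unique)
qed

section \<open>Weights and heat kernel profiles\<close>

text \<open>
  The second property of boundary functions, solved for \<open>h s x y\<close>.
\<close>
lemma boundary_function_doubling:
  assumes "boundary_function \<Phi> D \<gamma> h"
  obtains C where "1 \<le> C"
    "\<And>x y s t. x \<in> D \<Longrightarrow> y \<in> D \<Longrightarrow> 0 < s \<Longrightarrow> s \<le> t \<Longrightarrow> ereal t < 4 * scale_diam \<Phi> D + 1 \<Longrightarrow>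
      h s x y \<le> C * (t / s) powr \<gamma> * h t x y"
proof -
  obtain C where C: "0 < C" "\<And>x y s t. x \<in> D \<Longrightarrow> y \<in> D \<Longrightarrow> 0 < s \<Longrightarrow> s \<le> t \<Longrightarrow>
      ereal t < 4 * scale_diam \<Phi> D + 1 \<Longrightarrow> s powr \<gamma> * h s x y \<le> C * (t powr \<gamma> * h t x y)"
    using assms unfolding boundary_function_def by blast
  show thesis
  proof (rule that[of "max 1 C"])
    fix x y s t assume xy: "x \<in> D" "y \<in> D" and st: "0 < s" "s \<le> t" "ereal t < 4 * scale_diam \<Phi> D + 1"
    have h0: "0 \<le> h t x y" using assms xy st by (simp add: boundary_function_def)
    have "s powr \<gamma> * h s x y \<le> C * (t powr \<gamma> * h t x y)" using C(2)[OF xy st] .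
    then have "h s x y \<le> C * (t / s) powr \<gamma> * h t x y"
      using st by (simp add: powr_divide field_simps)
    also have "\<dots> \<le> max 1 C * (t / s) powr \<gamma> * h t x y"
      using h0 by (intro mult_right_mono) auto
    finally show "h s x y \<le> max 1 C * (t / s) powr \<gamma> * h t x y" .
  qed simp
qed

text \<open>
  Compares with a single term of the exponential series.
\<close>
lemma power_times_gaussian_bounded:
  fixes c q :: real
  assumes "0 < c"
  shows "\<exists>M>0. \<forall>z\<ge>1. z powr q * exp (- c * z\<^sup>2) \<le> M"
proof -
  define N where "N = nat \<lceil>q\<rceil>"
  have qN: "q \<le> real (2 * N)" by (simp add: N_def) linarith
  have "z powr q * exp (- c * z\<^sup>2) \<le> fact N / c ^ N" if "1 \<le> z" for z :: real
  proof -
    have "(c * z\<^sup>2) ^ N / fact N \<le> exp (c * z\<^sup>2)"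
    proof -
      have "(\<Sum>n\<in>{N}. (c * z\<^sup>2) ^ n /\<^sub>R fact n) \<le> (\<Sum>n. (c * z\<^sup>2) ^ n /\<^sub>R fact n)"
        using assms by (intro sum_le_suminf sums_summable[OF exp_converges]) auto
      also have "\<dots> = exp (c * z\<^sup>2)" by (rule sums_unique[OF exp_converges, symmetric])
      finally show ?thesis by (simp add: divide_inverse mult.commute)
    qed
    have "z powr q \<le> z powr real (2 * N)" using that qN by (intro powr_mono) auto
    also have "\<dots> = (z\<^sup>2) ^ N" using that by (subst powr_realpow) (auto simp: power_mult)
    finally have 1: "z powr q \<le> (z\<^sup>2) ^ N" .
    have "c ^ N * (z\<^sup>2) ^ N \<le> fact N * exp (c * z\<^sup>2)"
      using \<open>(c * z\<^sup>2) ^ N / fact N \<le> exp (c * z\<^sup>2)\<close> by (simp add: power_mult_distrib field_simps)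
    then have "(z\<^sup>2) ^ N \<le> fact N / c ^ N * exp (c * z\<^sup>2)" using assms by (simp add: field_simps)
    with 1 have "z powr q \<le> fact N / c ^ N * exp (c * z\<^sup>2)" by linarith
    then have "z powr q * exp (- c * z\<^sup>2) \<le> fact N / c ^ N * exp (c * z\<^sup>2) * exp (- c * z\<^sup>2)"
      by (intro mult_right_mono) auto
    also have "\<dots> = fact N / c ^ N" by (simp add: mult.assoc flip: exp_add)
    finally show ?thesis .
  qed
  moreover have "0 < fact N / c ^ N" using assms by simp
  ultimately show ?thesis by blast
qed

lemma vol_scale_inv_scaling:
  assumes sf: "scale_function \<alpha>1 \<alpha>2 \<Phi>"
    and vol_pos: "\<And>x r. 0 < r \<Longrightarrow> 0 < vol m x r"
    and vs: "volume_scaling m R\<^sub>E d1 d2"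
  obtains C where "1 \<le> C"
    "\<And>x s t. 0 < s \<Longrightarrow> s \<le> t \<Longrightarrow> scale_inv \<Phi> t \<le> L \<or> R\<^sub>E = \<infinity> \<Longrightarrow>
       (t / s) powr (d1 / \<alpha>2) * vol m x (scale_inv \<Phi> s) \<le> C * vol m x (scale_inv \<Phi> t) \<and>
       vol m x (scale_inv \<Phi> t) \<le> C * (t / s) powr (d2 / \<alpha>1) * vol m x (scale_inv \<Phi> s)"
proof -
  obtain A where A: "1 \<le> A" "\<And>x r R. 0 < r \<Longrightarrow> r \<le> R \<Longrightarrow> R \<le> L \<or> R\<^sub>E = \<infinity> \<Longrightarrow>
    (R / r) powr d1 / A \<le> vol m x R / vol m x r \<and> vol m x R / vol m x r \<le> A * (R / r) powr d2"
    using volume_scaling_up_to[OF vs, of L] by blast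
  obtain c where c: "0 < c"
    and low: "\<And>s t. 0 < s \<Longrightarrow> s \<le> t \<Longrightarrow> c * (t / s) powr (1 / \<alpha>2) \<le> scale_inv \<Phi> t / scale_inv \<Phi> s"
    using scale_inv_lower[OF sf] by blast
  obtain C where C: "0 < C"
    and up: "\<And>s t. 0 < s \<Longrightarrow> s \<le> t \<Longrightarrow> scale_inv \<Phi> t / scale_inv \<Phi> s \<le> C * (t / s) powr (1 / \<alpha>1)"
    using scale_inv_upper[OF sf] by blast
  have d: "0 < d1" "0 < d2" using vs by (auto simp: volume_scaling_def)
  define B where "B = max 1 (max (A * (1 / c) powr d1) (A * C powr d2))"
  show thesis
  proof (rule that[of B])
    show "1 \<le> B" by (simp add: B_def)
    fix x s t assume st: "0 < s" "s \<le> t" and R: "scale_inv \<Phi> t \<le> L \<or> R\<^sub>E = \<infinity>"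
    let ?I = "scale_inv \<Phi>" and ?V = "\<lambda>s. vol m x (scale_inv \<Phi> s)"
    have I: "0 < ?I s" "?I s \<le> ?I t" "0 < ?I t"
      using scale_inv_pos[OF sf] scale_inv_mono[OF sf st(2)] st by auto
    have V: "0 < ?V s" "0 < ?V t" using vol_pos I by auto
    note vv = A(2)[OF I(1,2) R, of x]
    have "(t / s) powr (d1 / \<alpha>2) = ((t / s) powr (1 / \<alpha>2)) powr d1" by (simp add: powr_powr)
    also have "\<dots> \<le> (?I t / ?I s / c) powr d1"
    proof (intro powr_mono2)
      show "(t / s) powr (1 / \<alpha>2) \<le> ?I t / ?I s / c"
        unfolding pos_le_divide_eq[OF c] using low[OF st] by (simp add: mult.commute)
    qed (use d in auto)
    also have "?I t / ?I s / c = 1 / c * (?I t / ?I s)" by simp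
    also have "\<dots> powr d1 = (1 / c) powr d1 * (?I t / ?I s) powr d1" by (rule powr_mult)
    also have "\<dots> \<le> (1 / c) powr d1 * (A * (?V t / ?V s))"
      using vv A(1) by (intro mult_left_mono) (auto simp: pos_divide_le_eq mult.commute)
    also have "\<dots> = (A * (1 / c) powr d1) * (?V t / ?V s)" by simp
    also have "\<dots> \<le> B * (?V t / ?V s)" using V by (intro mult_right_mono) (auto simp: B_def)
    finally have 1: "(t / s) powr (d1 / \<alpha>2) * ?V s \<le> B * ?V t" using V by (simp add: pos_le_divide_eq)
    have "?V t / ?V s \<le> A * (?I t / ?I s) powr d2" using vv by simp
    also have "\<dots> \<le> A * (C * (t / s) powr (1 / \<alpha>1)) powr d2"
      using up[OF st] A(1) d I by (intro mult_left_mono powr_mono2) auto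
    also have "\<dots> = A * C powr d2 * (t / s) powr (d2 / \<alpha>1)"
      by (simp add: powr_mult powr_powr)
    also have "\<dots> \<le> B * (t / s) powr (d2 / \<alpha>1)" by (intro mult_right_mono) (auto simp: B_def)
    finally have "?V t \<le> B * (t / s) powr (d2 / \<alpha>1) * ?V s" using V by (simp add: pos_divide_le_eq)
    with 1 show "(t / s) powr (d1 / \<alpha>2) * ?V s \<le> B * ?V t \<and> ?V t \<le> B * (t / s) powr (d2 / \<alpha>1) * ?V s" by simp
  qed
qed

text \<open>
  The factor of a summand of the Green series that stems from volume and potential; up to constants it is
  \<open>1 / vol m x r\<close> times the potential of \<open>{0<..s}\<close>, where \<open>r\<close> is the radius with \<open>\<Phi> r = s\<close>.
\<close>
definition green_weight :: "'a::metric_space measure \<Rightarrow> (real \<Rightarrow> real) \<Rightarrow> real measure \<Rightarrow> real \<Rightarrow> 'a \<Rightarrow> real" where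
  "green_weight m \<Phi> \<nu> s x = 1 / (vol m x (scale_inv \<Phi> s) * laplace_exponent \<nu> (1 / s))"

lemma psi_over_vol_eq_weight:
  assumes "scale_function \<alpha>1 \<alpha>2 \<Phi>" "0 \<le> r"
  shows "psi \<nu> \<Phi> r / vol m x r = green_weight m \<Phi> \<nu> (\<Phi> r) x"
  using scale_inv_scale[OF assms] by (simp add: psi_def green_weight_def)

lemma green_weight_scaling:
  assumes sf: "scale_function \<alpha>1 \<alpha>2 \<Phi>"
    and vol_pos: "\<And>x r. 0 < r \<Longrightarrow> 0 < vol m x r"
    and vs: "volume_scaling m R\<^sub>E d1 d2"
    and \<phi>_pos: "\<And>u. 0 < u \<Longrightarrow> 0 < laplace_exponent \<nu> u"
    and \<phi>: "0 < c" "0 < C" "\<And>s t. 0 < s \<Longrightarrow> s \<le> t \<Longrightarrow> adm t \<Longrightarrow>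
       c * (t / s) powr \<beta>1 * laplace_exponent \<nu> (1 / t) \<le> laplace_exponent \<nu> (1 / s) \<and>
       laplace_exponent \<nu> (1 / s) \<le> C * (t / s) powr \<beta>2 * laplace_exponent \<nu> (1 / t)"
    and L: "\<And>t. 0 < t \<Longrightarrow> adm t \<Longrightarrow> scale_inv \<Phi> t \<le> L \<or> R\<^sub>E = \<infinity>"
  shows "\<exists>c>0. \<exists>C>0. \<forall>x s t. 0 < s \<and> s \<le> t \<and> adm t \<longrightarrow>
     c * (t / s) powr (\<beta>1 - d2 / \<alpha>1) * green_weight m \<Phi> \<nu> s x \<le> green_weight m \<Phi> \<nu> t x \<and>
     green_weight m \<Phi> \<nu> t x \<le> C * (t / s) powr (\<beta>2 - d1 / \<alpha>2) * green_weight m \<Phi> \<nu> s x"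
proof -
  obtain A where A: "1 \<le> A"
    "\<And>x s t. 0 < s \<Longrightarrow> s \<le> t \<Longrightarrow> scale_inv \<Phi> t \<le> L \<or> R\<^sub>E = \<infinity> \<Longrightarrow>
       (t / s) powr (d1 / \<alpha>2) * vol m x (scale_inv \<Phi> s) \<le> A * vol m x (scale_inv \<Phi> t) \<and>
       vol m x (scale_inv \<Phi> t) \<le> A * (t / s) powr (d2 / \<alpha>1) * vol m x (scale_inv \<Phi> s)"
    using vol_scale_inv_scaling[OF sf vol_pos vs, of L] by blast
  have "c / A * (t / s) powr (\<beta>1 - d2 / \<alpha>1) * green_weight m \<Phi> \<nu> s x \<le> green_weight m \<Phi> \<nu> t x \<and>
     green_weight m \<Phi> \<nu> t x \<le> C * A * (t / s) powr (\<beta>2 - d1 / \<alpha>2) * green_weight m \<Phi> \<nu> s x"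
    if st: "0 < s" "s \<le> t" "adm t" for x s t
  proof -
    define k where "k = t / s"
    define V W p q where "V = vol m x (scale_inv \<Phi> s)" and "W = vol m x (scale_inv \<Phi> t)"
      and "p = laplace_exponent \<nu> (1 / s)" and "q = laplace_exponent \<nu> (1 / t)"
    have pos: "0 < V" "0 < W" "0 < p" "0 < q" "0 < k"
      using st vol_pos scale_inv_pos[OF sf] \<phi>_pos by (auto simp: V_def W_def p_def q_def k_def)
    have v: "k powr (d1 / \<alpha>2) * V \<le> A * W" "W \<le> A * k powr (d2 / \<alpha>1) * V"
      using A(2)[OF st(1,2) L] st by (auto simp: V_def W_def k_def)
    have f: "c * k powr \<beta>1 * q \<le> p" "p \<le> C * k powr \<beta>2 * q"
      using \<phi>(3)[OF st] by (auto simp: p_def q_def k_def)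
    have "(c * k powr \<beta>1 * q) * W \<le> p * (A * k powr (d2 / \<alpha>1) * V)"
      using f v pos \<phi>(1) by (intro mult_mono) auto
    then have 1: "c / A * k powr (\<beta>1 - d2 / \<alpha>1) * (1 / (V * p)) \<le> 1 / (W * q)"
      using pos A(1) by (simp add: powr_diff field_simps)
    have "p * (k powr (d1 / \<alpha>2) * V) \<le> (C * k powr \<beta>2 * q) * (A * W)"
      using pos \<phi>(2) by (intro mult_mono[OF f(2) v(1)]) auto
    then have 2: "1 / (W * q) \<le> C * A * k powr (\<beta>2 - d1 / \<alpha>2) * (1 / (V * p))"
      using pos A(1) by (simp add: powr_diff field_simps)
    show ?thesis using 1 2 unfolding green_weight_def V_def W_def p_def q_def k_def by blast
  qed
  moreover have "0 < c / A" "0 < C * A" using \<phi> A by auto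
  ultimately show ?thesis by blast
qed

text \<open>
  The choice of the ratio of the grid; 24 is what \<open>potential_lower\<close> needs.
\<close>
lemma laplace_growth_factor:
  assumes "0 < c" "0 < \<beta>" and \<phi>: "\<And>s t. 0 < s \<Longrightarrow> s \<le> t \<Longrightarrow> adm t \<Longrightarrow>
       c * (t / s) powr \<beta> * laplace_exponent \<nu> (1 / t) \<le> laplace_exponent \<nu> (1 / s)"
    and \<phi>_pos: "\<And>u. 0 < u \<Longrightarrow> 0 < laplace_exponent \<nu> u"
  obtains K where "1 < K" "\<And>r. 0 < r \<Longrightarrow> adm r \<Longrightarrow> 24 * laplace_exponent \<nu> (1 / r) \<le> laplace_exponent \<nu> (K / r)"
proof -
  obtain k where k: "1 \<le> k" "24 \<le> c * k powr \<beta>" using powr_exceeds[OF assms(2,1)] by blast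
  define K where "K = k + 1"
  have K: "1 < K" using k by (simp add: K_def)
  have "c * k powr \<beta> \<le> c * K powr \<beta>"
    using k assms by (intro mult_left_mono powr_mono2) (auto simp: K_def)
  with k(2) have cK: "24 \<le> c * K powr \<beta>" by linarith
  show thesis
  proof (rule that[OF K])
    fix r :: real assume r: "0 < r" "adm r"
    have "24 * laplace_exponent \<nu> (1 / r) \<le> c * K powr \<beta> * laplace_exponent \<nu> (1 / r)"
      using cK \<phi>_pos[of "1 / r"] r by (intro mult_right_mono) auto
    also have "\<dots> = c * (r / (r / K)) powr \<beta> * laplace_exponent \<nu> (1 / r)" using r K by simp
    also have "\<dots> \<le> laplace_exponent \<nu> (1 / (r / K))"
      using r K by (intro \<phi>) (auto simp: pos_divide_le_eq)
    finally show "24 * laplace_exponent \<nu> (1 / r) \<le> laplace_exponent \<nu> (K / r)" by simp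
  qed
qed

text \<open>
  At times that are at least a fixed fraction of \<open>\<Phi> (dist x y)\<close>, the exponent of the Gaussian factor is bounded.
\<close>
lemma hk_profile_lower:
  assumes sf: "scale_function \<alpha>1 \<alpha>2 \<Phi>" and \<Psi>: "\<And>r. 0 \<le> r \<Longrightarrow> 0 \<le> \<Psi> r" and C0: "0 \<le> C0" and K: "1 < K" and c: "0 < c"
  obtains k where "0 < k" "\<And>x y t. x \<noteq> y \<Longrightarrow> 0 < t \<Longrightarrow> \<Phi> (dist x y) / K \<le> t \<Longrightarrow>
     k / vol m x (scale_inv \<Phi> t) \<le> hk_profile m \<Phi> \<Psi> C0 c t x y"
proof -
  obtain C where C: "0 < C" and up: "\<And>s t. 0 < s \<Longrightarrow> s \<le> t \<Longrightarrow> scale_inv \<Phi> t / scale_inv \<Phi> s \<le> C * (t / s) powr (1 / \<alpha>1)"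
    using scale_inv_upper[OF sf] by blast
  note a = scale_function_exponents_pos[OF sf]
  define B where "B = max 1 (C * K powr (1 / \<alpha>1))"
  show thesis
  proof (rule that[of "exp (- c * B\<^sup>2)"])
    fix x y :: 'a and t :: real
    assume xy: "x \<noteq> y" and t: "0 < t" "\<Phi> (dist x y) / K \<le> t"
    have I: "0 < scale_inv \<Phi> t" using scale_inv_pos[OF sf t(1)] .
    have Ir: "scale_inv \<Phi> (\<Phi> (dist x y)) = dist x y" by (rule scale_inv_scale[OF sf]) simp
    have Tp: "0 < \<Phi> (dist x y)" using scale_function_pos[OF sf] xy by simp
    have zB: "dist x y / scale_inv \<Phi> t \<le> B"
    proof (cases "\<Phi> (dist x y) \<le> t")
      case True
      then have "dist x y \<le> scale_inv \<Phi> t" using scale_inv_mono[OF sf True] Ir by simp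
      then have "dist x y / scale_inv \<Phi> t \<le> 1" using I by simp
      then show ?thesis by (simp add: B_def)
    next
      case False
      have "dist x y / scale_inv \<Phi> t \<le> C * (\<Phi> (dist x y) / t) powr (1 / \<alpha>1)"
        using up[OF t(1), of "\<Phi> (dist x y)"] False Ir by simp
      also have "\<dots> \<le> C * K powr (1 / \<alpha>1)"
        using t K a C Tp by (intro mult_left_mono powr_mono2) (auto simp: field_simps)
      finally show ?thesis by (simp add: B_def)
    qed
    have "(dist x y / scale_inv \<Phi> t)\<^sup>2 \<le> B\<^sup>2" using zB I by (intro power_mono) auto
    then have "c * (dist x y / scale_inv \<Phi> t)\<^sup>2 \<le> c * B\<^sup>2" using c by (intro mult_left_mono) auto
    then have e: "exp (- c * B\<^sup>2) \<le> exp (- c * (dist x y)\<^sup>2 / (scale_inv \<Phi> t)\<^sup>2)"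
      by (simp add: power_divide)
    have V: "0 \<le> 1 / vol m x (scale_inv \<Phi> t)" by (simp add: vol_def)
    have "exp (- c * B\<^sup>2) \<le> 1" using c by simp
    then have 1: "exp (- c * B\<^sup>2) * (1 / vol m x (scale_inv \<Phi> t)) \<le> 1 * (1 / vol m x (scale_inv \<Phi> t))"
      using V by (rule mult_right_mono)
    have "exp (- c * B\<^sup>2) * (1 / vol m x (scale_inv \<Phi> t))
       \<le> exp (- c * (dist x y)\<^sup>2 / (scale_inv \<Phi> t)\<^sup>2) * (1 / vol m x (scale_inv \<Phi> t))"
      using e V by (rule mult_right_mono)
    moreover have "0 \<le> C0 * t / (vol m x (dist x y) * \<Psi> (dist x y))"
      using C0 t \<Psi>[of "dist x y"] by (simp add: vol_def)
    ultimately show "exp (- c * B\<^sup>2) / vol m x (scale_inv \<Phi> t) \<le> hk_profile m \<Phi> \<Psi> C0 c t x y"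
      using 1 by (simp add: hk_profile_def)
  qed simp
qed

lemma hk_profile_upper: "hk_profile m \<Phi> \<Psi> C0 c t x y \<le> 1 / vol m x (scale_inv \<Phi> t)"
  by (simp add: hk_profile_def)

text \<open>
  At times \<open>t\<close> below \<open>T = \<Phi> (dist x y)\<close>, the boundary function may exceed its value at \<open>T\<close> by the
  factor \<open>(T / t) powr \<gamma>\<close>. The jump part of the profile is linear in \<open>t\<close>, which leaves \<open>(t / T) powr (1 - \<gamma>)\<close>.
  The Gaussian part absorbs this factor, and the ratio of the volumes, altogether. So \<open>\<theta>\<close> may be any
  non-positive number, below \<open>1 - \<gamma>\<close> if jumps are present.
\<close>
lemma hk_profile_far:
  assumes sf: "scale_function \<alpha>1 \<alpha>2 \<Phi>" and \<Phi>\<Psi>: "\<And>r. 0 \<le> r \<Longrightarrow> \<Phi> r \<le> \<Psi> r"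
    and vol_pos: "\<And>x r. 0 < r \<Longrightarrow> 0 < vol m x r" and vs: "volume_scaling m R\<^sub>E d1 d2"
    and bf: "boundary_function \<Phi> D \<gamma> h" and c: "0 < c" and C0: "C0 \<in> {0, 1}"
    and L: "\<And>x y. x \<in> D \<Longrightarrow> y \<in> D \<Longrightarrow> dist x y \<le> L \<or> R\<^sub>E = \<infinity>"
    and dom: "\<And>x y. x \<in> D \<Longrightarrow> y \<in> D \<Longrightarrow> x \<noteq> y \<Longrightarrow> ereal (\<Phi> (dist x y)) < 4 * scale_diam \<Phi> D + 1"
    and \<theta>: "\<theta> \<le> 0" "C0 = 0 \<or> \<theta> \<le> 1 - \<gamma>"
  obtains C where "0 < C" "\<And>x y t. x \<in> D \<Longrightarrow> y \<in> D \<Longrightarrow> x \<noteq> y \<Longrightarrow> 0 < t \<Longrightarrow> t \<le> \<Phi> (dist x y) \<Longrightarrow>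
     h t x y * hk_profile m \<Phi> \<Psi> C0 c t x y
       \<le> C * (h (\<Phi> (dist x y)) x y / vol m x (scale_inv \<Phi> (\<Phi> (dist x y)))) * (t / \<Phi> (dist x y)) powr \<theta>"
proof -
  obtain Ch where Ch: "1 \<le> Ch" "\<And>x y s t. x \<in> D \<Longrightarrow> y \<in> D \<Longrightarrow> 0 < s \<Longrightarrow> s \<le> t \<Longrightarrow> ereal t < 4 * scale_diam \<Phi> D + 1 \<Longrightarrow>
      h s x y \<le> Ch * (t / s) powr \<gamma> * h t x y"
    using boundary_function_doubling[OF bf] by blast
  have \<gamma>: "0 \<le> \<gamma>" using bf by (simp add: boundary_function_def)
  obtain A where A: "1 \<le> A" "\<And>x r R. 0 < r \<Longrightarrow> r \<le> R \<Longrightarrow> R \<le> L \<or> R\<^sub>E = \<infinity> \<Longrightarrow>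
    (R / r) powr d1 / A \<le> vol m x R / vol m x r \<and> vol m x R / vol m x r \<le> A * (R / r) powr d2"
    using volume_scaling_up_to[OF vs, of L] by blast
  obtain c' where c': "0 < c'"
    and low: "\<And>s t. 0 < s \<Longrightarrow> s \<le> t \<Longrightarrow> c' * (t / s) powr (1 / \<alpha>2) \<le> scale_inv \<Phi> t / scale_inv \<Phi> s"
    using scale_inv_lower[OF sf] by blast
  note a = scale_function_exponents_pos[OF sf]
  obtain M where M: "0 < M" "\<And>z. 1 \<le> z \<Longrightarrow> z powr (d2 + \<alpha>2 * \<gamma>) * exp (- c * z\<^sup>2) \<le> M"
    using power_times_gaussian_bounded[OF c] by blast
  define B where "B = Ch * A * (1 / c') powr (\<alpha>2 * \<gamma>) * M"
  have B: "0 < B" using Ch(1) A(1) c' M(1) by (simp add: B_def)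
  show thesis
  proof (rule that[of "Ch + B"])
    show "0 < Ch + B" using Ch(1) B by simp
    fix x y t assume xy: "x \<in> D" "y \<in> D" "x \<noteq> y" and t: "0 < t" "t \<le> \<Phi> (dist x y)"
    define \<rho> T I where "\<rho> = dist x y" and "T = \<Phi> (dist x y)" and "I = scale_inv \<Phi> t"
    have \<rho>: "0 < \<rho>" using xy by (simp add: \<rho>_def)
    have T: "0 < T" "t \<le> T" using scale_function_pos[OF sf] xy t by (auto simp: T_def)
    have IT: "scale_inv \<Phi> T = \<rho>" unfolding T_def \<rho>_def by (rule scale_inv_scale[OF sf]) simp
    have I: "0 < I" "I \<le> \<rho>" using scale_inv_pos[OF sf t(1)] scale_inv_mono[OF sf T(2)] IT by (auto simp: I_def)
    have V: "0 < vol m x \<rho>" "0 < vol m x I" using vol_pos \<rho> I by auto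
    have h: "0 \<le> h t x y" "0 \<le> h T x y" using bf xy t T by (auto simp: boundary_function_def)
    have hT: "h t x y \<le> Ch * (T / t) powr \<gamma> * h T x y"
      by (rule Ch(2)[OF xy(1,2) t(1) T(2)]) (use dom[OF xy] in \<open>simp add: T_def\<close>)
    have th1: "1 \<le> (t / T) powr \<theta>"
      using powr_mono2'[of "- \<theta>" 1 1] t T \<theta> powr_mono'[of \<theta> 0 "t / T"] by simp
    define z where "z = \<rho> / I"
    have z: "1 \<le> z" using I by (simp add: z_def)
    have part1: "h t x y * (C0 * t / (vol m x \<rho> * \<Psi> \<rho>)) \<le> Ch * (h T x y / vol m x \<rho>) * (t / T) powr \<theta>"
    proof (cases "C0 = 0")
      case True
      then show ?thesis using Ch(1) h V by simp
    next
      case False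
      then have C1: "C0 = 1" and th: "\<theta> \<le> 1 - \<gamma>" using C0 \<theta> by auto
      have "T \<le> \<Psi> \<rho>" using \<Phi>\<Psi>[of \<rho>] \<rho> by (simp add: T_def \<rho>_def)
      then have "t / (vol m x \<rho> * \<Psi> \<rho>) \<le> t / (vol m x \<rho> * T)"
        using V T t by (intro divide_left_mono mult_left_mono mult_pos_pos) auto
      then have "h t x y * (t / (vol m x \<rho> * \<Psi> \<rho>)) \<le> (Ch * (T / t) powr \<gamma> * h T x y) * (t / (vol m x \<rho> * T))"
        using hT h t V T Ch(1) \<open>T \<le> \<Psi> \<rho>\<close> by (intro mult_mono) auto
      also have "(T / t) powr \<gamma> = (t / T) powr (- \<gamma>)"
        using t T by (simp add: powr_divide powr_minus field_simps)
      also have "(Ch * (t / T) powr (- \<gamma>) * h T x y) * (t / (vol m x \<rho> * T))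
          = Ch * (h T x y / vol m x \<rho>) * ((t / T) powr 1 * (t / T) powr (- \<gamma>))"
        using t T by (simp add: field_simps)
      also have "(t / T) powr 1 * (t / T) powr (- \<gamma>) = (t / T) powr (1 - \<gamma>)" by (subst powr_add[symmetric]) simp
      also have "Ch * (h T x y / vol m x \<rho>) * (t / T) powr (1 - \<gamma>) \<le> Ch * (h T x y / vol m x \<rho>) * (t / T) powr \<theta>"
        using Ch(1) h V t T th by (intro mult_left_mono powr_mono') auto
      finally show ?thesis by (simp add: C1)
    qed
    have part2: "h t x y * (1 / vol m x I * exp (- c * \<rho>\<^sup>2 / I\<^sup>2)) \<le> B * (h T x y / vol m x \<rho>) * (t / T) powr \<theta>"
    proof -
      have v: "1 / vol m x I \<le> A * z powr d2 / vol m x \<rho>"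
        using A(2)[OF I, of x] L[OF xy(1,2)] V by (simp add: z_def \<rho>_def field_simps)
      have "(T / t) powr \<gamma> = ((T / t) powr (1 / \<alpha>2)) powr (\<alpha>2 * \<gamma>)" using a by (simp add: powr_powr)
      also have "\<dots> \<le> (z / c') powr (\<alpha>2 * \<gamma>)"
      proof (intro powr_mono2)
        show "(T / t) powr (1 / \<alpha>2) \<le> z / c'"
          unfolding pos_le_divide_eq[OF c'] using low[OF t(1) T(2)]
          by (simp add: IT I_def[symmetric] z_def mult.commute)
      qed (use a \<gamma> in auto)
      also have "\<dots> = (1 / c') powr (\<alpha>2 * \<gamma>) * z powr (\<alpha>2 * \<gamma>)" using c' z by (simp add: powr_divide)
      finally have Tt: "(T / t) powr \<gamma> \<le> (1 / c') powr (\<alpha>2 * \<gamma>) * z powr (\<alpha>2 * \<gamma>)" .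
      have "h t x y \<le> Ch * ((1 / c') powr (\<alpha>2 * \<gamma>) * z powr (\<alpha>2 * \<gamma>)) * h T x y"
        using hT mult_right_mono[OF mult_left_mono[OF Tt, of Ch] h(2)] Ch(1) by linarith
      then have "h t x y * (1 / vol m x I * exp (- c * \<rho>\<^sup>2 / I\<^sup>2))
         \<le> (Ch * ((1 / c') powr (\<alpha>2 * \<gamma>) * z powr (\<alpha>2 * \<gamma>)) * h T x y) * (A * z powr d2 / vol m x \<rho> * exp (- c * z\<^sup>2))"
        using v h V Ch(1) A(1) by (intro mult_mono) (auto simp: z_def power_divide)
      also have "\<dots> = Ch * A * (1 / c') powr (\<alpha>2 * \<gamma>) * (z powr d2 * z powr (\<alpha>2 * \<gamma>) * exp (- c * z\<^sup>2)) * (h T x y / vol m x \<rho>)"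
        by (simp add: mult_ac)
      also have "z powr d2 * z powr (\<alpha>2 * \<gamma>) = z powr (d2 + \<alpha>2 * \<gamma>)" by (simp add: powr_add)
      also have "Ch * A * (1 / c') powr (\<alpha>2 * \<gamma>) * (z powr (d2 + \<alpha>2 * \<gamma>) * exp (- c * z\<^sup>2)) * (h T x y / vol m x \<rho>)
         \<le> B * (h T x y / vol m x \<rho>)"
        unfolding B_def using M(2)[OF z] Ch(1) A(1) h V by (intro mult_right_mono mult_left_mono) auto
      also have "\<dots> \<le> B * (h T x y / vol m x \<rho>) * (t / T) powr \<theta>"
        using mult_left_mono[OF th1, of "B * (h T x y / vol m x \<rho>)"] B h V by simp
      finally show ?thesis .
    qed
    have "h t x y * hk_profile m \<Phi> \<Psi> C0 c t x y
       \<le> h t x y * (C0 * t / (vol m x \<rho> * \<Psi> \<rho>) + 1 / vol m x I * exp (- c * \<rho>\<^sup>2 / I\<^sup>2))"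
      using h(1) by (intro mult_left_mono) (auto simp: hk_profile_def \<rho>_def I_def)
    also have "\<dots> \<le> Ch * (h T x y / vol m x \<rho>) * (t / T) powr \<theta> + B * (h T x y / vol m x \<rho>) * (t / T) powr \<theta>"
      using part1 part2 by (simp only: distrib_left add_mono)
    also have "\<dots> = (Ch + B) * (h T x y / vol m x \<rho>) * (t / T) powr \<theta>"
      by (simp add: distrib_right add_divide_distrib)
    finally show "h t x y * hk_profile m \<Phi> \<Psi> C0 c t x y
       \<le> (Ch + B) * (h (\<Phi> (dist x y)) x y / vol m x (scale_inv \<Phi> (\<Phi> (dist x y)))) * (t / \<Phi> (dist x y)) powr \<theta>"
      using IT by (simp add: T_def)
  qed
qed

section \<open>The Green series\<close>

lemma comparable_off_diagonal_cong:
  assumes G: "comparable_off_diagonal D G f" and c: "0 < c" "0 < C"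
    and fg: "\<And>x y. x \<in> D \<Longrightarrow> y \<in> D \<Longrightarrow> x \<noteq> y \<Longrightarrow> c * g x y \<le> f x y \<and> f x y \<le> C * g x y"
  shows "comparable_off_diagonal D G g"
proof -
  obtain a A where a: "0 < a" "0 < A" and *: "\<And>x y. x \<in> D \<Longrightarrow> y \<in> D \<Longrightarrow> x \<noteq> y \<Longrightarrow>
      ennreal (a * f x y) \<le> G x y \<and> G x y \<le> ennreal (A * f x y)"
    using G unfolding comparable_off_diagonal_def by blast
  have "ennreal (a * c * g x y) \<le> G x y \<and> G x y \<le> ennreal (A * C * g x y)"
    if xy: "x \<in> D" "y \<in> D" "x \<noteq> y" for x y
  proof
    have "ennreal (a * c * g x y) \<le> ennreal (a * f x y)"
      using fg[OF xy] a by (intro ennreal_leI) (simp add: mult.assoc mult_left_mono)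
    then show "ennreal (a * c * g x y) \<le> G x y" using *[OF xy] by (auto intro: order.trans)
    have "ennreal (A * f x y) \<le> ennreal (A * C * g x y)"
      using fg[OF xy] a by (intro ennreal_leI) (simp add: mult.assoc mult_left_mono)
    then show "G x y \<le> ennreal (A * C * g x y)" using *[OF xy] by (auto intro: order.trans)
  qed
  moreover have "0 < a * c" "0 < A * C" using a c by auto
  ultimately show ?thesis unfolding comparable_off_diagonal_def by blast
qed

lemma delta_max_minus_dist_le:
  "delta_max D x y - dist x y \<le> delta_min D x y"
  using infdist_triangle[of x "- D" y] infdist_triangle[of y "- D" x]
  by (auto simp: delta_max_def delta_min_def delta_def dist_commute)

text \<open>
  Covers both signs of the exponent at once.
\<close>
lemma powr_le_powr_abs:
  fixes z :: real
  assumes "1 \<le> z" "z \<le> k"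
  shows "z powr p \<le> k powr \<bar>p\<bar>"
proof -
  have "z powr p \<le> z powr \<bar>p\<bar>" using assms by (intro powr_mono) auto
  also have "\<dots> \<le> k powr \<bar>p\<bar>" using assms by (intro powr_mono2) auto
  finally show ?thesis .
qed

text \<open>
  What the estimates use about the Green function: up to constants it is the grid sum of
  \<open>A x y s = h s x y * b s x\<close>, where \<open>b\<close> changes between scales at least like the power \<open>p1\<close> and at most like
  the power \<open>p2\<close>. The grid starts at \<open>\<Phi> (dist x y)\<close> and ends at the scale of the diameter, if there is one.
\<close>
locale green_series =
  fixes D :: "'a::metric_space set" and \<Phi> :: "real \<Rightarrow> real" and \<alpha>1 \<alpha>2 \<gamma> \<gamma>' p1 p2 K :: real
    and h :: "real \<Rightarrow> 'a \<Rightarrow> 'a \<Rightarrow> real" and b :: "real \<Rightarrow> 'a \<Rightarrow> real"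
    and G :: "'a \<Rightarrow> 'a \<Rightarrow> ennreal"
  assumes scale: "scale_function \<alpha>1 \<alpha>2 \<Phi>"
    and D: "open D" "D \<noteq> UNIV"
    and boundary: "boundary_function \<Phi> D \<gamma> h"
    and regular: "regular_boundary_function \<Phi> D h"
    and H2_star: "H2_star \<Phi> D \<gamma>' h"
    and K: "1 < K"
    and b_pos: "\<And>x s. x \<in> D \<Longrightarrow> 0 < s \<Longrightarrow> 0 < b s x"
    and b_scaling: "\<exists>c>0. \<exists>C>0. \<forall>x\<in>D. \<forall>s t. 0 < s \<and> s \<le> t \<and> ereal t \<le> scale_diam \<Phi> D \<longrightarrow>
       c * (t / s) powr p1 * b s x \<le> b t x \<and> b t x \<le> C * (t / s) powr p2 * b s x"
    and G_series: "\<exists>c>0. \<exists>C>0. \<forall>x\<in>D. \<forall>y\<in>D. x \<noteq> y \<longrightarrow>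
       ennreal c * scale_series K (\<lambda>t. ereal t \<le> scale_diam \<Phi> D) (\<Phi> (dist x y)) (\<lambda>s. h s x y * b s x) \<le> G x y \<and>
       G x y \<le> ennreal C * scale_series K (\<lambda>t. ereal t \<le> scale_diam \<Phi> D) (\<Phi> (dist x y)) (\<lambda>s. h s x y * b s x)"
begin

abbreviation "adm t \<equiv> ereal t \<le> scale_diam \<Phi> D"
abbreviation "A x y s \<equiv> h s x y * b s x"
abbreviation "series x y \<equiv> scale_series K adm (\<Phi> (dist x y)) (A x y)"

text \<open>
  Beyond the scale \<open>\<Phi> (reach x y)\<close> the boundary is felt and the boundary function decays. In a bounded
  set this scale can lie above the scale of the diameter, for instance when a component of the space
  separates the set from its complement; \<open>\<Delta>\<close> is truncated there.
\<close>
definition reach :: "'a \<Rightarrow> 'a \<Rightarrow> real" where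
  "reach x y = max (dist x y) (delta_max D x y)"

definition \<Delta> :: "'a \<Rightarrow> 'a \<Rightarrow> real" where
  "\<Delta> x y = (if adm (\<Phi> (reach x y)) then \<Phi> (reach x y) else \<Phi> (diameter D))"

lemma adm_iff: "adm t \<longleftrightarrow> (bounded D \<longrightarrow> t \<le> \<Phi> (diameter D))"
  by (simp add: scale_diam_def)

lemma adm_mono: "s \<le> t \<Longrightarrow> adm t \<Longrightarrow> adm s"
  by (auto simp: adm_iff)

lemma comparable_seriesI:
  assumes "0 < c" "0 < C"
    "\<And>x y. x \<in> D \<Longrightarrow> y \<in> D \<Longrightarrow> x \<noteq> y \<Longrightarrow> ennreal (c * f x y) \<le> series x y"
    "\<And>x y. x \<in> D \<Longrightarrow> y \<in> D \<Longrightarrow> x \<noteq> y \<Longrightarrow> series x y \<le> ennreal (C * f x y)"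
  shows "comparable_off_diagonal D G f"
proof -
  obtain a a' where a: "0 < a" "0 < a'" and *: "\<And>x y. x \<in> D \<Longrightarrow> y \<in> D \<Longrightarrow> x \<noteq> y \<Longrightarrow>
      ennreal a * series x y \<le> G x y \<and> G x y \<le> ennreal a' * series x y"
    using G_series by blast
  have "ennreal (a * c * f x y) \<le> G x y \<and> G x y \<le> ennreal (a' * C * f x y)"
    if xy: "x \<in> D" "y \<in> D" "x \<noteq> y" for x y
  proof
    have "ennreal (a * c * f x y) = ennreal a * ennreal (c * f x y)"
      using a by (simp add: mult.assoc ennreal_mult')
    also have "\<dots> \<le> ennreal a * series x y" by (intro mult_left_mono assms(3) xy) simp
    finally show "ennreal (a * c * f x y) \<le> G x y" using *[OF xy] by (auto intro: order.trans)
    have "ennreal a' * series x y \<le> ennreal a' * ennreal (C * f x y)"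
      by (intro mult_left_mono assms(4) xy) simp
    also have "\<dots> = ennreal (a' * C * f x y)"
      using a by (simp add: mult.assoc ennreal_mult')
    finally show "G x y \<le> ennreal (a' * C * f x y)" using *[OF xy] by (auto intro: order.trans)
  qed
  moreover have "0 < a * c" "0 < a' * C" using a assms by auto
  ultimately show ?thesis unfolding comparable_off_diagonal_def by blast
qed

context
  fixes x y assumes xy: "x \<in> D" "y \<in> D" "x \<noteq> y"
begin

lemma T_pos: "0 < \<Phi> (dist x y)"
  using scale_function_pos[OF scale] xy by simp

lemma dist_le_diameter: "bounded D \<Longrightarrow> dist x y \<le> diameter D"
  using diameter_bounded_bound xy by blast

lemma T_adm: "adm (\<Phi> (dist x y))"
  using scale_function_mono[OF scale _ dist_le_diameter] by (simp add: adm_iff)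

lemma scale_diam_pos: "0 < scale_diam \<Phi> D"
  using T_pos T_adm by (meson ereal_less(2) less_le_trans)

lemma adm_less:
  assumes "adm t" shows "ereal t < 4 * scale_diam \<Phi> D + 1" "ereal t < 2 * scale_diam \<Phi> D"
  using assms scale_diam_pos by (cases "scale_diam \<Phi> D"; auto)+

lemma reach_ge: "dist x y \<le> reach x y" "delta_max D x y \<le> reach x y"
  by (simp_all add: reach_def)

lemma delta_max_nonneg: "0 \<le> delta_max D x y"
  by (auto simp: delta_max_def delta_def infdist_nonneg le_max_iff_disj)

lemma reach_pos: "0 < reach x y"
  using xy by (simp add: reach_def less_max_iff_disj)

lemma T_le_reach: "\<Phi> (dist x y) \<le> \<Phi> (reach x y)"
  using reach_ge by (intro scale_function_mono[OF scale]) auto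

lemma T_le_\<Delta>: "\<Phi> (dist x y) \<le> \<Delta> x y"
  using T_le_reach T_adm by (auto simp: \<Delta>_def adm_iff)

lemma \<Delta>_pos: "0 < \<Delta> x y"
  using T_le_\<Delta> T_pos by simp

lemma \<Delta>_adm: "adm (\<Delta> x y)"
  by (auto simp: \<Delta>_def adm_iff)

lemma \<Delta>_le_reach: "\<Delta> x y \<le> \<Phi> (reach x y)"
  by (auto simp: \<Delta>_def adm_iff)

lemma \<Delta>_eq: "\<Delta> x y < s \<Longrightarrow> adm s \<Longrightarrow> \<Delta> x y = \<Phi> (reach x y)"
  by (auto simp: \<Delta>_def adm_iff split: if_splits)

lemma h_nonneg: "0 < t \<Longrightarrow> 0 \<le> h t x y"
  using boundary xy by (simp add: boundary_function_def)

lemma h_le_1: "0 < t \<Longrightarrow> h t x y \<le> 1"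
  using boundary xy by (simp add: boundary_function_def)

lemma h_antimono: "0 < s \<Longrightarrow> s \<le> t \<Longrightarrow> h t x y \<le> h s x y"
  using boundary xy unfolding boundary_function_def by blast

lemma A_nonneg: "0 < s \<Longrightarrow> 0 \<le> A x y s"
  using h_nonneg b_pos[OF xy(1)] by (simp add: less_imp_le)

lemma A_le_series:
  assumes "adm (K ^ n * \<Phi> (dist x y))"
  shows "ennreal (A x y (K ^ n * \<Phi> (dist x y))) \<le> series x y"
  using le_scale_series[of adm K n "\<Phi> (dist x y)" "A x y"] assms by simp

lemma A_T_le_series: "ennreal (A x y (\<Phi> (dist x y))) \<le> series x y"
  using A_le_series[of 0] T_adm by simp

lemma grid_point_below:
  assumes "\<Phi> (dist x y) \<le> u" "adm u"
  obtains n where "0 < K ^ n * \<Phi> (dist x y)" "K ^ n * \<Phi> (dist x y) \<le> u" "u \<le> K * (K ^ n * \<Phi> (dist x y))"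
    "adm (K ^ n * \<Phi> (dist x y))"
proof -
  have "\<exists>n. K ^ n * \<Phi> (dist x y) \<le> u \<and> u \<le> K ^ Suc n * \<Phi> (dist x y)"
  proof (cases "\<Phi> (dist x y) < u")
    case True
    then show ?thesis using geometric_interval_above[OF K T_pos] by (meson less_imp_le)
  next
    case False
    then show ?thesis using assms K T_pos by (intro exI[of _ 0]) auto
  qed
  then obtain n where n: "K ^ n * \<Phi> (dist x y) \<le> u" "u \<le> K ^ Suc n * \<Phi> (dist x y)" by blast
  show thesis
    by (rule that[of n]) (use n T_pos K adm_mono[OF n(1) assms(2)] in \<open>auto simp: mult.assoc\<close>)
qed

end

lemma h_doubling:
  obtains C where "1 \<le> C"
    "\<And>x y s t. x \<in> D \<Longrightarrow> y \<in> D \<Longrightarrow> x \<noteq> y \<Longrightarrow> 0 < s \<Longrightarrow> s \<le> t \<Longrightarrow> adm t \<Longrightarrow>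
      h s x y \<le> C * (t / s) powr \<gamma> * h t x y"
proof -
  obtain C where C: "1 \<le> C" "\<And>x y s t. x \<in> D \<Longrightarrow> y \<in> D \<Longrightarrow> 0 < s \<Longrightarrow> s \<le> t \<Longrightarrow>
      ereal t < 4 * scale_diam \<Phi> D + 1 \<Longrightarrow> h s x y \<le> C * (t / s) powr \<gamma> * h t x y"
    using boundary_function_doubling[OF boundary] by blast
  show thesis by (rule that[OF C(1)]) (use C(2) adm_less(1) in blast)
qed

text \<open>
  For \<open>s = t\<close> the bound is trivial; this covers the case that \<open>\<Delta> x y\<close> is the scale of the diameter,
  where the decay condition says nothing.
\<close>
lemma h_decay:
  obtains C where "1 \<le> C"
    "\<And>x y s t. x \<in> D \<Longrightarrow> y \<in> D \<Longrightarrow> x \<noteq> y \<Longrightarrow> \<Delta> x y \<le> s \<Longrightarrow> s \<le> t \<Longrightarrow> adm t \<Longrightarrow>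
      h t x y \<le> C * (s / t) powr \<gamma>' * h s x y"
proof -
  obtain c where c: "0 < c" "\<And>x y s t. x \<in> D \<Longrightarrow> y \<in> D \<Longrightarrow> \<Phi> (delta_max D x y) \<le> s \<Longrightarrow> s \<le> t \<Longrightarrow>
      ereal t < 2 * scale_diam \<Phi> D \<Longrightarrow> c * (t powr \<gamma>' * h t x y) \<le> s powr \<gamma>' * h s x y"
    using H2_star unfolding H2_star_def by blast
  show thesis
  proof (rule that[of "max 1 (1 / c)"])
    fix x y s t assume xy: "x \<in> D" "y \<in> D" "x \<noteq> y" and st: "\<Delta> x y \<le> s" "s \<le> t" "adm t"
    have s: "0 < s" using st \<Delta>_pos[OF xy] by simp
    show "h t x y \<le> max 1 (1 / c) * (s / t) powr \<gamma>' * h s x y"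
    proof (cases "s = t")
      case True
      have "1 * h s x y \<le> max 1 (1 / c) * h s x y" using h_nonneg[OF xy s] by (intro mult_right_mono) auto
      then show ?thesis using True s by simp
    next
      case False
      then have "\<Delta> x y = \<Phi> (reach x y)" using \<Delta>_eq[OF xy, of t] st by simp
      moreover have "\<Phi> (delta_max D x y) \<le> \<Phi> (reach x y)"
        using reach_ge[OF xy] delta_max_nonneg[OF xy] by (intro scale_function_mono[OF scale]) auto
      ultimately have "c * (t powr \<gamma>' * h t x y) \<le> s powr \<gamma>' * h s x y"
        using st by (intro c xy adm_less(2)[OF xy]) auto
      then have "h t x y \<le> 1 / c * (s / t) powr \<gamma>' * h s x y"
        using st s c(1) by (simp add: powr_divide field_simps)
      also have "\<dots> \<le> max 1 (1 / c) * (s / t) powr \<gamma>' * h s x y"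
        using h_nonneg[OF xy s] by (intro mult_right_mono) auto
      finally show ?thesis .
    qed
  qed simp
qed

lemma b_bounds:
  obtains C where "1 \<le> C"
    "\<And>x s t. x \<in> D \<Longrightarrow> 0 < s \<Longrightarrow> s \<le> t \<Longrightarrow> adm t \<Longrightarrow> b s x \<le> C * (s / t) powr p1 * b t x"
    "\<And>x s t. x \<in> D \<Longrightarrow> 0 < s \<Longrightarrow> s \<le> t \<Longrightarrow> adm t \<Longrightarrow> b t x \<le> C * (t / s) powr p2 * b s x"
proof -
  obtain c C where c: "0 < c" "0 < C" "\<And>x s t. x \<in> D \<Longrightarrow> 0 < s \<Longrightarrow> s \<le> t \<Longrightarrow> adm t \<Longrightarrow>
       c * (t / s) powr p1 * b s x \<le> b t x \<and> b t x \<le> C * (t / s) powr p2 * b s x"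
    using b_scaling by blast
  define C' where "C' = max 1 (max C (1 / c))"
  show thesis
  proof (rule that[of C'])
    fix x s t assume x: "x \<in> D" and st: "0 < s" "s \<le> t" "adm t"
    have bp: "0 < b s x" "0 < b t x" using b_pos[OF x] st by auto
    note * = c(3)[OF x st]
    have "b s x \<le> 1 / c * (s / t) powr p1 * b t x"
      using * st c(1) by (simp add: powr_divide field_simps)
    also have "\<dots> \<le> C' * (s / t) powr p1 * b t x"
      using bp by (intro mult_right_mono) (auto simp: C'_def)
    finally show "b s x \<le> C' * (s / t) powr p1 * b t x" .
    have "b t x \<le> C * (t / s) powr p2 * b s x" using * by simp
    also have "\<dots> \<le> C' * (t / s) powr p2 * b s x"
      using bp by (intro mult_right_mono) (auto simp: C'_def)
    finally show "b t x \<le> C' * (t / s) powr p2 * b s x" .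
  qed (simp add: C'_def)
qed

text \<open>
  Points that are close to each other compared with their distance to the boundary are both at distance at
  least \<open>delta_max D x y / 2\<close> from the complement. Regularity then bounds \<open>h\<close> below up to the scale of this
  distance, and doubling extends the bound to the scale of \<open>delta_max D x y\<close>.
\<close>
lemma regular_scales:
  obtains c where "0 < c" "c \<le> 1"
    "\<And>x y s. x \<in> D \<Longrightarrow> y \<in> D \<Longrightarrow> x \<noteq> y \<Longrightarrow> 2 * dist x y \<le> delta_max D x y \<Longrightarrow> 0 < s \<Longrightarrow> s \<le> \<Delta> x y \<Longrightarrow> c \<le> h s x y"
proof -
  obtain cr where cr: "0 < cr" "\<And>x y t. x \<in> D \<Longrightarrow> y \<in> D \<Longrightarrow> 0 < t \<Longrightarrow> ereal t < 4 * scale_diam \<Phi> D + 1 \<Longrightarrow>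
      scale_inv \<Phi> t \<le> delta_min D x y \<Longrightarrow> cr \<le> h t x y"
    using regular unfolding regular_boundary_function_def by blast
  obtain C where C: "1 \<le> C"
    "\<And>x y s t. x \<in> D \<Longrightarrow> y \<in> D \<Longrightarrow> x \<noteq> y \<Longrightarrow> 0 < s \<Longrightarrow> s \<le> t \<Longrightarrow> adm t \<Longrightarrow>
      h s x y \<le> C * (t / s) powr \<gamma> * h t x y"
    using h_doubling by blast
  obtain Cd where Cd: "1 \<le> Cd" "\<And>r. 0 \<le> r \<Longrightarrow> \<Phi> (2 * r) \<le> Cd * \<Phi> r"
    using scale_function_doubling[OF scale, of 2] by auto
  have \<gamma>: "0 \<le> \<gamma>" using boundary by (simp add: boundary_function_def)
  define c where "c = min 1 (cr / (C * Cd powr \<gamma>))"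
  show thesis
  proof (rule that[of c])
    show "0 < c" using cr C Cd by (simp add: c_def)
    show "c \<le> 1" by (simp add: c_def)
    fix x y s assume xy: "x \<in> D" "y \<in> D" "x \<noteq> y" and d: "2 * dist x y \<le> delta_max D x y"
      and s: "0 < s" "s \<le> \<Delta> x y"
    let ?d = "delta_max D x y"
    have dp: "0 < ?d" using d xy by (smt (verit) zero_less_dist_iff)
    have R: "reach x y = ?d" using d xy by (simp add: reach_def max_def) (smt (verit) zero_le_dist)
    define s' where "s' = min s (\<Phi> (?d / 2))"
    have s': "0 < s'" "s' \<le> s" using s scale_function_pos[OF scale, of "?d / 2"] dp by (auto simp: s'_def)
    have adm_s: "adm s" using adm_mono[OF s(2) \<Delta>_adm[OF xy]] .
    have "scale_inv \<Phi> s' \<le> scale_inv \<Phi> (\<Phi> (?d / 2))"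
      by (intro scale_inv_mono[OF scale]) (simp add: s'_def)
    also have "\<dots> = ?d / 2" using dp by (intro scale_inv_scale[OF scale]) simp
    also have "\<dots> \<le> delta_min D x y" using delta_max_minus_dist_le[of D x y] d by simp
    finally have inv: "scale_inv \<Phi> s' \<le> delta_min D x y" .
    have "cr \<le> h s' x y"
      by (intro cr xy s' inv adm_less[OF xy] adm_mono[OF s'(2) adm_s])
    also have "\<dots> \<le> C * (s / s') powr \<gamma> * h s x y"
      by (intro C xy s' adm_s)
    also have "\<dots> \<le> C * Cd powr \<gamma> * h s x y"
    proof -
      have "s / s' \<le> Cd"
      proof (cases "s \<le> \<Phi> (?d / 2)")
        case True
        then show ?thesis using Cd(1) s by (simp add: s'_def min_def)
      next
        case False
        have "s \<le> \<Phi> ?d" using s(2) \<Delta>_le_reach[OF xy] R by simp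
        also have "\<dots> \<le> Cd * \<Phi> (?d / 2)" using Cd(2)[of "?d / 2"] dp by simp
        finally show ?thesis using False s' by (simp add: s'_def min_def pos_divide_le_eq)
      qed
      then have "(s / s') powr \<gamma> \<le> Cd powr \<gamma>" using s s' \<gamma> by (intro powr_mono2) auto
      then show ?thesis using C(1) h_nonneg[OF xy s(1)] by (intro mult_right_mono mult_left_mono) auto
    qed
    finally have "cr / (C * Cd powr \<gamma>) \<le> h s x y"
      using C(1) Cd(1) by (simp add: pos_divide_le_eq mult_ac)
    then show "c \<le> h s x y" by (simp add: c_def)
  qed
qed

text \<open>
  The complementary case: the scales from \<open>\<Phi> (dist x y)\<close> to \<open>\<Delta> x y\<close> span a bounded factor.
\<close>
lemma \<Delta>_le_near_boundary:
  obtains C where "1 \<le> C"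
    "\<And>x y. x \<in> D \<Longrightarrow> y \<in> D \<Longrightarrow> x \<noteq> y \<Longrightarrow> \<not> 2 * dist x y \<le> delta_max D x y \<Longrightarrow> \<Delta> x y \<le> C * \<Phi> (dist x y)"
proof -
  obtain Cd where Cd: "1 \<le> Cd" "\<And>r. 0 \<le> r \<Longrightarrow> \<Phi> (2 * r) \<le> Cd * \<Phi> r"
    using scale_function_doubling[OF scale, of 2] by auto
  show thesis
  proof (rule that[OF Cd(1)])
    fix x y assume xy: "x \<in> D" "y \<in> D" "x \<noteq> y" and d: "\<not> 2 * dist x y \<le> delta_max D x y"
    have "\<Delta> x y \<le> \<Phi> (reach x y)" by (rule \<Delta>_le_reach[OF xy])
    also have "\<dots> \<le> \<Phi> (2 * dist x y)"
      using d reach_pos[OF xy] by (intro scale_function_mono[OF scale]) (auto simp: reach_def)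
    also have "\<dots> \<le> Cd * \<Phi> (dist x y)" by (intro Cd) simp
    finally show "\<Delta> x y \<le> Cd * \<Phi> (dist x y)" .
  qed
qed

text \<open>
  Every distance to the complement is at most the distance to one fixed point of the complement.
\<close>
lemma reach_bounded:
  assumes "bounded D" "D \<noteq> {}"
  obtains L where "0 < L" "\<And>x y. x \<in> D \<Longrightarrow> y \<in> D \<Longrightarrow> reach x y \<le> L"
proof -
  obtain x0 z where x0: "x0 \<in> D" and z: "z \<in> - D" using D assms by auto
  define L where "L = diameter D + dist x0 z + 1"
  have dd: "dist x y \<le> diameter D" if "x \<in> D" "y \<in> D" for x y
    using diameter_bounded_bound[OF assms(1) that] .
  have del: "delta D x \<le> diameter D + dist x0 z" if "x \<in> D" for x
  proof -
    have "delta D x \<le> dist x z" unfolding delta_def by (rule infdist_le[OF z])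
    also have "\<dots> \<le> dist x x0 + dist x0 z" by (rule dist_triangle)
    finally show ?thesis using dd[OF that x0] by simp
  qed
  show thesis
  proof (rule that[of L])
    show "0 < L" unfolding L_def using diameter_ge_0[OF assms(1)] by (smt (verit) zero_le_dist)
    fix x y assume xy: "x \<in> D" "y \<in> D"
    have "dist x y \<le> L" "delta D x \<le> L" "delta D y \<le> L"
      using dd[OF xy] del[OF xy(1)] del[OF xy(2)] zero_le_dist[of x0 z] unfolding L_def by linarith+
    then show "reach x y \<le> L" by (simp add: reach_def delta_max_def)
  qed
qed

text \<open>
  The truncation of \<open>\<Delta>\<close> costs only a constant, since \<open>reach\<close> is bounded by a multiple of the diameter.
\<close>
lemma \<Delta>_ge_reach:
  obtains c where "0 < c" "c \<le> 1" "\<And>x y. x \<in> D \<Longrightarrow> y \<in> D \<Longrightarrow> x \<noteq> y \<Longrightarrow>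
     c * (reach x y / dist x y) powr \<alpha>1 * \<Phi> (dist x y) \<le> \<Delta> x y"
proof -
  obtain c where c: "0 < c"
    and sc: "\<And>r R. 0 < r \<Longrightarrow> r \<le> R \<Longrightarrow> c * (R / r) powr \<alpha>1 * \<Phi> r \<le> \<Phi> R"
    using scale_function_lower[OF scale] by blast
  have a: "0 < \<alpha>1" using scale_function_exponents_pos[OF scale] by simp
  have "\<exists>k>0. k \<le> 1 \<and> (\<forall>x\<in>D. \<forall>y\<in>D. x \<noteq> y \<longrightarrow> bounded D \<longrightarrow> k * reach x y \<le> diameter D)"
  proof (cases "bounded D \<and> 0 < diameter D")
    case True
    then have "D \<noteq> {}" by auto
    then obtain L where L: "0 < L" "\<And>x y. x \<in> D \<Longrightarrow> y \<in> D \<Longrightarrow> reach x y \<le> L"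
      using reach_bounded True by blast
    define k where "k = min 1 (diameter D / L)"
    have "k * reach x y \<le> diameter D" if xy: "x \<in> D" "y \<in> D" "x \<noteq> y" for x y
    proof -
      have "k * reach x y \<le> diameter D / L * L"
        using L True xy reach_pos[OF xy] by (intro mult_mono) (auto simp: k_def)
      then show ?thesis using L by simp
    qed
    moreover have "0 < k" "k \<le> 1" using L True by (auto simp: k_def)
    ultimately show ?thesis by blast
  next
    case False
    have "0 < diameter D" if "bounded D" "x \<in> D" "y \<in> D" "x \<noteq> y" for x y
      using dist_le_diameter[OF that(2-4) that(1)] that(4) by (smt (verit) zero_less_dist_iff)
    then show ?thesis using False by (intro exI[of _ 1]) auto
  qed
  then obtain k where k: "0 < k" "k \<le> 1" and
    kd: "\<And>x y. x \<in> D \<Longrightarrow> y \<in> D \<Longrightarrow> x \<noteq> y \<Longrightarrow> bounded D \<Longrightarrow> k * reach x y \<le> diameter D" by blast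
  define c' where "c' = min 1 (c * k powr \<alpha>1)"
  show thesis
  proof (rule that[of c'])
    show "0 < c'" "c' \<le> 1" using c k by (auto simp: c'_def)
    fix x y assume xy: "x \<in> D" "y \<in> D" "x \<noteq> y"
    have dp: "0 < dist x y" using xy by simp
    have Tp: "0 \<le> \<Phi> (dist x y)" using T_pos[OF xy] by simp
    show "c' * (reach x y / dist x y) powr \<alpha>1 * \<Phi> (dist x y) \<le> \<Delta> x y"
    proof (cases "k * reach x y \<le> dist x y")
      case True
      have "c' * (reach x y / dist x y) powr \<alpha>1 \<le> 1"
      proof -
        have le1: "c * (dist x y / dist x y) powr \<alpha>1 * \<Phi> (dist x y) \<le> \<Phi> (dist x y)" using sc dp by blast
        then have "c \<le> 1" using T_pos[OF xy] dp by simp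
        have "c' * (reach x y / dist x y) powr \<alpha>1 \<le> (c * k powr \<alpha>1) * (reach x y / dist x y) powr \<alpha>1"
          by (intro mult_right_mono) (auto simp: c'_def)
        also have "\<dots> = c * (k * reach x y / dist x y) powr \<alpha>1"
          using k reach_pos[OF xy] dp by (simp add: powr_mult powr_divide)
        also have "\<dots> \<le> 1 * 1"
          using \<open>c \<le> 1\<close> c True k reach_pos[OF xy] dp a by (intro mult_mono powr_le1) auto
        finally show ?thesis by simp
      qed
      then have "c' * (reach x y / dist x y) powr \<alpha>1 * \<Phi> (dist x y) \<le> 1 * \<Phi> (dist x y)"
        using Tp by (rule mult_right_mono)
      also have "\<dots> \<le> \<Delta> x y" using T_le_\<Delta>[OF xy] by simp
      finally show ?thesis .
    next
      case False
      have "c' * (reach x y / dist x y) powr \<alpha>1 * \<Phi> (dist x y)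
          \<le> (c * k powr \<alpha>1) * (reach x y / dist x y) powr \<alpha>1 * \<Phi> (dist x y)"
        using Tp by (intro mult_right_mono) (auto simp: c'_def)
      also have "\<dots> = c * (k * reach x y / dist x y) powr \<alpha>1 * \<Phi> (dist x y)"
        using k reach_pos[OF xy] dp by (simp add: powr_mult powr_divide)
      also have "\<dots> \<le> \<Phi> (k * reach x y)" using False dp by (intro sc) auto
      also have "\<dots> \<le> \<Delta> x y"
      proof (cases "adm (\<Phi> (reach x y))")
        case True
        have "\<Phi> (k * reach x y) \<le> \<Phi> (reach x y)"
          using k reach_pos[OF xy] by (intro scale_function_mono[OF scale]) (auto simp: mult_left_le_one_le)
        then show ?thesis using True by (simp add: \<Delta>_def)
      next
        case nadm: False
        then have "bounded D" by (simp add: adm_iff)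
        then have "\<Phi> (k * reach x y) \<le> \<Phi> (diameter D)"
          using kd[OF xy] k reach_pos[OF xy] by (intro scale_function_mono[OF scale]) auto
        then show ?thesis using nadm by (simp add: \<Delta>_def)
      qed
      finally show ?thesis .
    qed
  qed
qed

end

text \<open>
  Merges a lower bound by one term with a lower bound by a count of terms, which is void for few terms.
\<close>
lemma count_combine:
  assumes X: "ennreal H \<le> X" "ennreal (H * (log K z - 1)) \<le> X" and H: "0 \<le> H" and K: "1 < K" and z: "1 \<le> z"
  shows "ennreal (H / (3 * max 1 (ln K)) * (1 + ln z)) \<le> X"
proof -
  define L where "L = log K z"
  have lnK: "0 < ln K" using K by simp
  have L: "0 \<le> L" "ln z = L * ln K" using K z by (simp_all add: L_def log_def)
  have "1 + ln z \<le> max 1 (ln K) * (1 + L)"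
  proof -
    have "L * ln K \<le> L * max 1 (ln K)" using L(1) by (intro mult_left_mono) auto
    moreover have "L * max 1 (ln K) = max 1 (ln K) * L" by simp
    ultimately show ?thesis unfolding L(2) distrib_left by simp
  qed
  then have "H / (3 * max 1 (ln K)) * (1 + ln z) \<le> H / (3 * max 1 (ln K)) * (max 1 (ln K) * (1 + L))"
    using H by (intro mult_left_mono) auto
  also have "\<dots> = H * ((1 + L) / 3)" using lnK by (simp add: max_def)
  finally have le: "H / (3 * max 1 (ln K)) * (1 + ln z) \<le> H * ((1 + L) / 3)" .
  show ?thesis
  proof (cases "L \<le> 2")
    case True
    have "H * ((1 + L) / 3) \<le> H * 1" using True H by (intro mult_left_mono) auto
    with le have "ennreal (H / (3 * max 1 (ln K)) * (1 + ln z)) \<le> ennreal H" by (intro ennreal_leI) simp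
    then show ?thesis using X(1) by (rule order.trans)
  next
    case False
    have "H * ((1 + L) / 3) \<le> H * (L - 1)" using False H by (intro mult_left_mono) auto
    with le have "ennreal (H / (3 * max 1 (ln K)) * (1 + ln z)) \<le> ennreal (H * (log K z - 1))"
      by (intro ennreal_leI) (simp add: L_def)
    then show ?thesis using X(2) by (rule order.trans)
  qed
qed

lemma one_plus_log_le:
  assumes "1 < K" "1 \<le> z"
  shows "1 + log K z \<le> max 1 (1 / ln K) * (1 + ln z)"
proof -
  have "1 / ln K * ln z \<le> max 1 (1 / ln K) * ln z" using assms by (intro mult_right_mono) auto
  then show ?thesis using assms by (simp add: log_def distrib_left)
qed

text \<open>
  A logarithm of a ratio of scales is comparable to the logarithm of the corresponding ratio of distances.
\<close>
lemma one_plus_ln_comparable: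
  fixes k C a1 a2 q w :: real
  assumes k: "0 < k" "k \<le> 1" and C: "0 < C" and a: "0 < a1" "0 < a2" and q: "0 \<le> q" and w: "1 \<le> w"
    and low: "k * (max 1 q) powr a1 \<le> w" and up: "w \<le> C * (max 1 q) powr a2"
  shows "1 / (2 + (1 - ln k) / a1) * ln (exp 1 + q) \<le> 1 + ln w"
    and "1 + ln w \<le> (1 + \<bar>ln C\<bar> + a2) * ln (exp 1 + q)"
proof -
  define B where "B = 2 + (1 - ln k) / a1"
  have lnk: "ln k \<le> 0" using k by simp
  then have "0 \<le> (1 - ln k) / a1" using a by simp
  then have B: "0 < B" by (simp add: B_def)
  define Z where "Z = ln w"
  have Z0: "0 \<le> Z" using w by (simp add: Z_def)
  define W where "W = ln (exp 1 + q)"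
  have W1: "1 \<le> W"
  proof -
    have "0 < exp 1 + q" using q by (simp add: add_pos_nonneg)
    then show ?thesis using q by (simp add: W_def ln_ge_iff)
  qed
  have mW: "ln (max 1 q) \<le> W"
  proof -
    have "1 + 0 \<le> exp 1 + q" using q by (intro add_mono) auto
    moreover have "q \<le> exp 1 + q" by simp
    ultimately have "max 1 q \<le> exp 1 + q" by simp
    then show ?thesis unfolding W_def by (intro ln_mono) auto
  qed
  have Wm: "W \<le> 2 + ln (max 1 q)"
  proof -
    have e: "exp 1 + q \<le> (exp 1 + 1) * max 1 q"
      using q exp_gt_zero[of "1::real"]
      by (cases "q \<le> 1") (auto simp: max_def algebra_simps)
    then have "W \<le> ln ((exp 1 + 1) * max 1 q)" unfolding W_def using q
      by (intro ln_mono) (auto intro: add_pos_nonneg)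
    also have "\<dots> = ln (exp 1 + 1) + ln (max 1 q)" by (simp add: ln_mult_pos add_pos_pos)
    also have "ln (exp 1 + 1 :: real) \<le> 2"
    proof -
      have "exp 1 + 1 \<le> exp (1::real) * exp 1"
      proof -
        have "(2::real) \<le> exp 1" using exp_ge_add_one_self[of "1::real"] by simp
        then have "2 * exp (1::real) \<le> exp 1 * exp 1" by (intro mult_right_mono) auto
        then show ?thesis using \<open>2 \<le> exp 1\<close> by linarith
      qed
      also have "\<dots> = exp 2" by (simp flip: exp_add)
      finally have "ln (exp 1 + 1 :: real) \<le> ln (exp 2)" by (intro ln_mono) (auto simp: add_pos_pos)
      then show ?thesis by simp
    qed
    finally show ?thesis by simp
  qed
  have "Z \<le> ln (C * (max 1 q) powr a2)" unfolding Z_def using up w C by (intro ln_mono) auto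
  also have "\<dots> = ln C + a2 * ln (max 1 q)" using C by (simp add: ln_mult_pos ln_powr)
  also have "\<dots> \<le> \<bar>ln C\<bar> + a2 * W" using mW a by (intro add_mono mult_left_mono) auto
  finally have Zup: "Z \<le> \<bar>ln C\<bar> + a2 * W" .
  have "ln (k * (max 1 q) powr a1) \<le> Z" unfolding Z_def using low k w by (intro ln_mono) auto
  then have dn: "a1 * ln (max 1 q) \<le> Z - ln k" using k by (simp add: ln_mult_pos ln_powr)
  have "1 / B * W \<le> 1 + Z"
  proof -
    have "ln (max 1 q) \<le> (Z - ln k) / a1" using dn a by (simp add: pos_le_divide_eq mult.commute)
    then have "W \<le> 2 + (Z - ln k) / a1" using Wm by simp
    also have "\<dots> \<le> B * (1 + Z)"
    proof -
      have "0 \<le> Z * (2 - ln k / a1) + 1 / a1"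
        using Z0 lnk a by (intro add_nonneg_nonneg mult_nonneg_nonneg) (auto simp: divide_nonpos_pos intro: order.trans[of _ 0])
      then show ?thesis by (simp add: B_def algebra_simps diff_divide_distrib add_divide_distrib)
    qed
    finally show ?thesis using B by (simp add: pos_divide_le_eq mult.commute)
  qed
  then show "1 / (2 + (1 - ln k) / a1) * ln (exp 1 + q) \<le> 1 + ln w" by (simp add: B_def W_def Z_def)
  have "1 + Z \<le> 1 * W + \<bar>ln C\<bar> * W + a2 * W"
    using Zup W1 mult_left_mono[OF W1, of "\<bar>ln C\<bar>"] by simp
  then show "1 + ln w \<le> (1 + \<bar>ln C\<bar> + a2) * ln (exp 1 + q)"
    by (simp add: distrib_right W_def Z_def)
qed

context green_series
begin

lemma series_split:
  assumes xy: "x \<in> D" "y \<in> D" "x \<noteq> y"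
    and f: "\<And>s. \<Phi> (dist x y) \<le> s \<Longrightarrow> 0 \<le> f s" "\<And>s. \<Phi> (dist x y) \<le> s \<Longrightarrow> 0 \<le> g s"
    and A: "\<And>s. \<Phi> (dist x y) \<le> s \<Longrightarrow> adm s \<Longrightarrow> A x y s \<le> f s + g s"
    and F: "scale_series K adm (\<Phi> (dist x y)) f \<le> ennreal F" "scale_series K adm (\<Phi> (dist x y)) g \<le> ennreal F'"
      "0 \<le> F" "0 \<le> F'"
  shows "series x y \<le> ennreal (F + F')"
proof -
  have "series x y \<le> scale_series K adm (\<Phi> (dist x y)) (\<lambda>s. f s + g s)"
    by (rule scale_series_mono[OF K T_pos[OF xy] A])
  also have "\<dots> = scale_series K adm (\<Phi> (dist x y)) f + scale_series K adm (\<Phi> (dist x y)) g"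
    by (rule scale_series_add[OF K T_pos[OF xy] f])
  also have "\<dots> \<le> ennreal F + ennreal F'" by (intro add_mono F)
  also have "\<dots> = ennreal (F + F')" using F by simp
  finally show ?thesis .
qed

text \<open>
  All summands are dominated by a geometric series that starts with the first one.
\<close>
lemma green_local_scale:
  assumes p2: "p2 < 0"
  shows "comparable_off_diagonal D G (\<lambda>x y. h (\<Phi> (dist x y)) x y * b (\<Phi> (dist x y)) x)"
proof -
  obtain C where C: "1 \<le> C"
    "\<And>x s t. x \<in> D \<Longrightarrow> 0 < s \<Longrightarrow> s \<le> t \<Longrightarrow> adm t \<Longrightarrow> b s x \<le> C * (s / t) powr p1 * b t x"
    "\<And>x s t. x \<in> D \<Longrightarrow> 0 < s \<Longrightarrow> s \<le> t \<Longrightarrow> adm t \<Longrightarrow> b t x \<le> C * (t / s) powr p2 * b s x"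
    using b_bounds by blast
  have K1: "K powr p2 < 1" using K p2 by (simp add: powr_less_one)
  show ?thesis
  proof (rule comparable_seriesI[where c = 1 and C = "C / (1 - K powr p2)"])
    show "0 < C / (1 - K powr p2)" using C K1 by simp
    fix x y assume xy: "x \<in> D" "y \<in> D" "x \<noteq> y"
    let ?T = "\<Phi> (dist x y)"
    note T = T_pos[OF xy]
    show "ennreal (1 * A x y ?T) \<le> series x y" using A_T_le_series[OF xy] by simp
    have "series x y \<le> scale_series K adm ?T (\<lambda>s. if ?T \<le> s then (C * A x y ?T) * (?T / s) powr (- p2) else 0)"
    proof (rule scale_series_mono[OF K T])
      fix s assume s: "?T \<le> s" "adm s"
      have "h s x y * b s x \<le> h ?T x y * (C * (s / ?T) powr p2 * b ?T x)"
        using h_antimono[OF xy T s(1)] C(3)[OF xy(1) T s] h_nonneg[OF xy T] b_pos[OF xy(1), of s] T s(1)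
        by (intro mult_mono) auto
      also have "(s / ?T) powr p2 = (?T / s) powr (- p2)"
        using T s by (simp add: powr_divide powr_minus field_simps)
      finally show "A x y s \<le> (if ?T \<le> s then (C * A x y ?T) * (?T / s) powr (- p2) else 0)"
        using s by (simp add: mult_ac)
    qed
    also have "\<dots> \<le> ennreal (C * A x y ?T / (1 - K powr (- (- p2))))"
      using C A_nonneg[OF xy T] p2 by (intro scale_series_tail[OF K T T]) auto
    finally show "series x y \<le> ennreal (C / (1 - K powr p2) * A x y ?T)" by simp
  qed simp
qed

lemma log_ratio_comparable:
  obtains c C where "0 < c" "0 < C" "\<And>x y. x \<in> D \<Longrightarrow> y \<in> D \<Longrightarrow> x \<noteq> y \<Longrightarrow>
     c * ln (exp 1 + delta_max D x y / dist x y) \<le> 1 + ln (\<Delta> x y / \<Phi> (dist x y)) \<and>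
     1 + ln (\<Delta> x y / \<Phi> (dist x y)) \<le> C * ln (exp 1 + delta_max D x y / dist x y)"
proof -
  obtain C0 where C0: "0 < C0"
    and sc: "\<And>r R. 0 < r \<Longrightarrow> r \<le> R \<Longrightarrow> \<Phi> R \<le> C0 * (R / r) powr \<alpha>2 * \<Phi> r"
    using scale_function_upper[OF scale] by blast
  obtain k where k: "0 < k" "k \<le> 1" and low: "\<And>x y. x \<in> D \<Longrightarrow> y \<in> D \<Longrightarrow> x \<noteq> y \<Longrightarrow>
     k * (reach x y / dist x y) powr \<alpha>1 * \<Phi> (dist x y) \<le> \<Delta> x y"
    using \<Delta>_ge_reach by blast
  note a = scale_function_exponents_pos[OF scale]
  have lnk: "ln k \<le> 0" using k by simp
  then have "0 \<le> (1 - ln k) / \<alpha>1" using a by simp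
  then have B: "0 < 2 + (1 - ln k) / \<alpha>1" by simp
  show thesis
  proof (rule that[of "1 / (2 + (1 - ln k) / \<alpha>1)" "1 + \<bar>ln C0\<bar> + \<alpha>2"])
    show "0 < 1 / (2 + (1 - ln k) / \<alpha>1)" using B by simp
    show "0 < 1 + \<bar>ln C0\<bar> + \<alpha>2" using a by simp
    fix x y assume xy: "x \<in> D" "y \<in> D" "x \<noteq> y"
    have d: "0 < dist x y" using xy by simp
    note T = T_pos[OF xy]
    define q where "q = delta_max D x y / dist x y"
    have q: "0 \<le> q" using delta_max_nonneg[OF xy] d by (simp add: q_def)
    have rq: "reach x y / dist x y = max 1 q"
      using d by (simp add: reach_def q_def max_def field_simps)
    have "\<Delta> x y \<le> C0 * (max 1 q) powr \<alpha>2 * \<Phi> (dist x y)"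
      using \<Delta>_le_reach[OF xy] sc[OF d reach_ge(1)[OF xy]] unfolding rq by (rule order.trans)
    then have up: "\<Delta> x y / \<Phi> (dist x y) \<le> C0 * (max 1 q) powr \<alpha>2" using T by (simp add: pos_divide_le_eq)
    have dn: "k * (max 1 q) powr \<alpha>1 \<le> \<Delta> x y / \<Phi> (dist x y)"
      using low[OF xy] T unfolding rq by (simp add: pos_le_divide_eq)
    have "1 \<le> \<Delta> x y / \<Phi> (dist x y)" using T T_le_\<Delta>[OF xy] by simp
    then show "1 / (2 + (1 - ln k) / \<alpha>1) * ln (exp 1 + delta_max D x y / dist x y) \<le> 1 + ln (\<Delta> x y / \<Phi> (dist x y)) \<and>
       1 + ln (\<Delta> x y / \<Phi> (dist x y)) \<le> (1 + \<bar>ln C0\<bar> + \<alpha>2) * ln (exp 1 + delta_max D x y / dist x y)"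
      using one_plus_ln_comparable[OF k C0 a q _ dn up] by (simp add: q_def)
  qed
qed

lemma top_log_ratio_comparable:
  assumes "bounded D"
  obtains c C where "0 < c" "0 < C" "\<And>x y. x \<in> D \<Longrightarrow> y \<in> D \<Longrightarrow> x \<noteq> y \<Longrightarrow>
     c * ln (exp 1 + diameter D / reach x y) \<le> 1 + ln (\<Phi> (diameter D) / \<Delta> x y) \<and>
     1 + ln (\<Phi> (diameter D) / \<Delta> x y) \<le> C * ln (exp 1 + diameter D / reach x y)"
proof -
  obtain c0 where c0: "0 < c0"
    and sc1: "\<And>r R. 0 < r \<Longrightarrow> r \<le> R \<Longrightarrow> c0 * (R / r) powr \<alpha>1 * \<Phi> r \<le> \<Phi> R"
    using scale_function_lower[OF scale] by blast
  obtain C0 where sc2: "\<And>r R. 0 < r \<Longrightarrow> r \<le> R \<Longrightarrow> \<Phi> R \<le> C0 * (R / r) powr \<alpha>2 * \<Phi> r"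
    using scale_function_upper[OF scale] by blast
  note a = scale_function_exponents_pos[OF scale]
  define k C where "k = min 1 c0" and "C = max 1 C0"
  have k: "0 < k" "k \<le> 1" and C: "0 < C" using c0 by (auto simp: k_def C_def)
  have lnk: "ln k \<le> 0" using k by simp
  then have "0 \<le> (1 - ln k) / \<alpha>1" using a by simp
  then have B: "0 < 2 + (1 - ln k) / \<alpha>1" by simp
  show thesis
  proof (rule that[of "1 / (2 + (1 - ln k) / \<alpha>1)" "1 + \<bar>ln C\<bar> + \<alpha>2"])
    show "0 < 1 / (2 + (1 - ln k) / \<alpha>1)" using B by simp
    show "0 < 1 + \<bar>ln C\<bar> + \<alpha>2" using a by simp
    fix x y assume xy: "x \<in> D" "y \<in> D" "x \<noteq> y"
    note R = reach_pos[OF xy] and \<Delta> = \<Delta>_pos[OF xy]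
    have diam: "0 \<le> diameter D" by (rule diameter_ge_0[OF assms])
    define q w where "q = diameter D / reach x y" and "w = \<Phi> (diameter D) / \<Delta> x y"
    have q: "0 \<le> q" using diam R by (simp add: q_def)
    have adm_iff': "adm t \<longleftrightarrow> t \<le> \<Phi> (diameter D)" for t using assms by (simp add: adm_iff)
    have w: "1 \<le> w" using \<Delta> \<Delta>_adm[OF xy] by (simp add: w_def adm_iff')
    have "k * (max 1 q) powr \<alpha>1 \<le> w \<and> w \<le> C * (max 1 q) powr \<alpha>2"
    proof (cases "reach x y \<le> diameter D")
      case True
      then have "adm (\<Phi> (reach x y))" using scale_function_mono[OF scale _ True] R by (simp add: adm_iff')
      then have De: "\<Delta> x y = \<Phi> (reach x y)" by (simp add: \<Delta>_def)
      have mq: "max 1 q = q" using True R by (simp add: q_def)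
      have "k * q powr \<alpha>1 \<le> c0 * q powr \<alpha>1" by (intro mult_right_mono) (auto simp: k_def)
      moreover have "c0 * q powr \<alpha>1 \<le> w"
        using sc1[OF R True] \<Delta> by (simp add: w_def q_def De pos_le_divide_eq)
      moreover have "w \<le> C0 * q powr \<alpha>2"
        using sc2[OF R True] \<Delta> by (simp add: w_def q_def De pos_divide_le_eq)
      moreover have "C0 * q powr \<alpha>2 \<le> C * q powr \<alpha>2" by (intro mult_right_mono) (auto simp: C_def)
      ultimately show ?thesis unfolding mq by linarith
    next
      case False
      then have "\<Phi> (diameter D) < \<Phi> (reach x y)" using scale_function_strict_mono[OF scale diam] by simp
      then have "\<Delta> x y = \<Phi> (diameter D)" by (simp add: \<Delta>_def adm_iff')
      then have "w = 1" using \<Delta> by (simp add: w_def)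
      moreover have "max 1 q = 1" using False R by (simp add: q_def)
      ultimately show ?thesis using k by (simp add: C_def)
    qed
    then show "1 / (2 + (1 - ln k) / \<alpha>1) * ln (exp 1 + diameter D / reach x y) \<le> 1 + ln (\<Phi> (diameter D) / \<Delta> x y) \<and>
       1 + ln (\<Phi> (diameter D) / \<Delta> x y) \<le> (1 + \<bar>ln C\<bar> + \<alpha>2) * ln (exp 1 + diameter D / reach x y)"
      using one_plus_ln_comparable[OF k C a q w] by (simp add: q_def w_def)
  qed
qed

text \<open>
  The weight is of constant order. Up to \<open>\<Delta> x y\<close> the boundary function is at most its first value, and of order 1
  if there are many such grid points; so these terms count scales. Beyond \<open>\<Delta> x y\<close> the terms decay.
\<close>
lemma green_logarithmic:
  assumes bc: "0 < cb" "\<And>x s. x \<in> D \<Longrightarrow> 0 < s \<Longrightarrow> adm s \<Longrightarrow> cb \<le> b s x \<and> b s x \<le> Cb"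
  shows "comparable_off_diagonal D G
     (\<lambda>x y. h (\<Phi> (dist x y)) x y * ln (exp 1 + delta_max D x y / dist x y))"
proof -
  obtain Cd where Cd: "1 \<le> Cd"
    "\<And>x y s t. x \<in> D \<Longrightarrow> y \<in> D \<Longrightarrow> x \<noteq> y \<Longrightarrow> \<Delta> x y \<le> s \<Longrightarrow> s \<le> t \<Longrightarrow> adm t \<Longrightarrow>
      h t x y \<le> Cd * (s / t) powr \<gamma>' * h s x y"
    using h_decay by blast
  have \<gamma>': "0 < \<gamma>'" using H2_star by (simp add: H2_star_def)
  obtain cr where cr: "0 < cr" "cr \<le> 1"
    "\<And>x y s. x \<in> D \<Longrightarrow> y \<in> D \<Longrightarrow> x \<noteq> y \<Longrightarrow> 2 * dist x y \<le> delta_max D x y \<Longrightarrow> 0 < s \<Longrightarrow> s \<le> \<Delta> x y \<Longrightarrow> cr \<le> h s x y"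
    using regular_scales by blast
  obtain Cn where Cn: "1 \<le> Cn"
    "\<And>x y. x \<in> D \<Longrightarrow> y \<in> D \<Longrightarrow> x \<noteq> y \<Longrightarrow> \<not> 2 * dist x y \<le> delta_max D x y \<Longrightarrow> \<Delta> x y \<le> Cn * \<Phi> (dist x y)"
    using \<Delta>_le_near_boundary by blast
  obtain cl Cl where cl: "0 < cl" "0 < Cl" "\<And>x y. x \<in> D \<Longrightarrow> y \<in> D \<Longrightarrow> x \<noteq> y \<Longrightarrow>
     cl * ln (exp 1 + delta_max D x y / dist x y) \<le> 1 + ln (\<Delta> x y / \<Phi> (dist x y)) \<and>
     1 + ln (\<Delta> x y / \<Phi> (dist x y)) \<le> Cl * ln (exp 1 + delta_max D x y / dist x y)"
    using log_ratio_comparable by blast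
  have Kg: "K powr (- \<gamma>') < 1" using K \<gamma>' by (simp add: powr_less_one)
  define c where "c = min (cb * cr / (3 * max 1 (ln K))) (cb / (1 + ln Cn))"
  define C where "C = \<bar>Cb\<bar> * max 1 (1 / ln K) + \<bar>Cb\<bar> * Cd / (1 - K powr (- \<gamma>')) + 1"
  have "comparable_off_diagonal D G
     (\<lambda>x y. h (\<Phi> (dist x y)) x y * (1 + ln (\<Delta> x y / \<Phi> (dist x y))))"
  proof (rule comparable_seriesI[where c = c and C = C])
    show "0 < c" using bc cr Cn by (auto simp: c_def intro!: divide_pos_pos add_pos_nonneg)
    show "0 < C" using Cd Kg by (auto simp: C_def intro!: add_nonneg_pos add_nonneg_nonneg)
    fix x y assume xy: "x \<in> D" "y \<in> D" "x \<noteq> y"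
    let ?T = "\<Phi> (dist x y)" and ?\<Delta> = "\<Delta> x y"
    note T = T_pos[OF xy] and \<Delta> = \<Delta>_pos[OF xy] and T\<Delta> = T_le_\<Delta>[OF xy]
    have h0: "0 \<le> h ?T x y" and h1: "h ?T x y \<le> 1" using h_nonneg[OF xy T] h_le_1[OF xy T] by auto
    have z: "1 \<le> ?\<Delta> / ?T" using T T\<Delta> by simp
    have lz: "0 \<le> ln (?\<Delta> / ?T)" using z by simp
    have Cb: "0 \<le> Cb" using bc(1) bc(2)[OF xy(1) T T_adm[OF xy]] by simp
    have bT: "cb \<le> b ?T x" using bc(2)[OF xy(1) T T_adm[OF xy]] by simp
    show "ennreal (c * (h ?T x y * (1 + ln (?\<Delta> / ?T)))) \<le> series x y"
    proof (cases "2 * dist x y \<le> delta_max D x y")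
      case True
      define H where "H = cb * cr * h ?T x y"
      have H: "0 \<le> H" using bc cr h0 by (simp add: H_def)
      have "cb * (cr * h ?T x y) \<le> b ?T x * h ?T x y"
        using bT cr h0 bc(1) by (intro mult_mono) (auto simp: mult_left_le_one_le)
      then have "ennreal H \<le> ennreal (A x y ?T)" by (intro ennreal_leI) (simp add: H_def mult_ac)
      then have 1: "ennreal H \<le> series x y" using A_T_le_series[OF xy] by (rule order.trans)
      have 2: "ennreal (H * (log K (?\<Delta> / ?T) - 1)) \<le> series x y"
      proof (rule scale_series_count_lower[OF K T order.refl T\<Delta> H])
        fix s assume s: "?T \<le> s" "s \<le> ?\<Delta>"
        have sp: "0 < s" using s T by simp
        have ad: "adm s" using adm_mono[OF s(2) \<Delta>_adm[OF xy]] .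
        have "cb * cr \<le> b s x * h s x y"
          using bc(2)[OF xy(1) sp ad] cr(3)[OF xy True sp s(2)] bc(1) cr(1) by (intro mult_mono) auto
        moreover have "H \<le> cb * cr" using h1 bc(1) cr(1) unfolding H_def by (simp add: mult_left_le)
        ultimately show "adm s \<and> H \<le> A x y s" using ad by (simp add: mult.commute)
      qed
      have "c * (h ?T x y * (1 + ln (?\<Delta> / ?T))) \<le> cb * cr / (3 * max 1 (ln K)) * (h ?T x y * (1 + ln (?\<Delta> / ?T)))"
        using h0 lz by (intro mult_right_mono) (auto simp: c_def)
      also have "\<dots> = H / (3 * max 1 (ln K)) * (1 + ln (?\<Delta> / ?T))" by (simp add: H_def)
      finally have "ennreal (c * (h ?T x y * (1 + ln (?\<Delta> / ?T)))) \<le> ennreal (H / (3 * max 1 (ln K)) * (1 + ln (?\<Delta> / ?T)))"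
        by (rule ennreal_leI)
      also have "\<dots> \<le> series x y" by (rule count_combine[OF 1 2 H K z])
      finally show ?thesis .
    next
      case False
      have "?\<Delta> / ?T \<le> Cn" using Cn(2)[OF xy False] T by (simp add: pos_divide_le_eq)
      then have "ln (?\<Delta> / ?T) \<le> ln Cn" using z by (intro ln_mono) auto
      have "c * (h ?T x y * (1 + ln (?\<Delta> / ?T))) \<le> cb / (1 + ln Cn) * (h ?T x y * (1 + ln Cn))"
        using h0 lz \<open>ln (?\<Delta> / ?T) \<le> ln Cn\<close> bc(1) Cn(1)
        by (intro mult_mono mult_nonneg_nonneg divide_nonneg_nonneg) (auto simp: c_def)
      also have "\<dots> = cb * h ?T x y" using Cn(1) by (simp add: add_pos_nonneg[THEN less_imp_neq, THEN not_sym])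
      also have "\<dots> \<le> A x y ?T" using mult_right_mono[OF bT h0] by (simp add: mult.commute)
      finally have "ennreal (c * (h ?T x y * (1 + ln (?\<Delta> / ?T)))) \<le> ennreal (A x y ?T)" by (rule ennreal_leI)
      then show ?thesis using A_T_le_series[OF xy] by (rule order.trans)
    qed
    have "series x y \<le> ennreal (Cb * h ?T x y * (1 + log K (?\<Delta> / ?T)) + Cb * Cd * h ?T x y / (1 - K powr (- \<gamma>')))"
    proof (rule series_split[OF xy, where
          f = "\<lambda>s. if ?T \<le> s \<and> s \<le> ?\<Delta> then Cb * h ?T x y else 0" and
          g = "\<lambda>s. if ?\<Delta> \<le> s then (Cb * Cd * h ?T x y) * (?\<Delta> / s) powr \<gamma>' else 0"])
      show "scale_series K adm ?T (\<lambda>s. if ?T \<le> s \<and> s \<le> ?\<Delta> then Cb * h ?T x y else 0)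
          \<le> ennreal (Cb * h ?T x y * (1 + log K (?\<Delta> / ?T)))"
        using Cb h0 by (intro scale_series_count_upper[OF K T T T\<Delta>]) auto
      show "scale_series K adm ?T (\<lambda>s. if ?\<Delta> \<le> s then (Cb * Cd * h ?T x y) * (?\<Delta> / s) powr \<gamma>' else 0)
          \<le> ennreal (Cb * Cd * h ?T x y / (1 - K powr (- \<gamma>')))"
        using Cb h0 Cd(1) by (intro scale_series_tail[OF K T \<Delta> \<gamma>']) auto
      show "0 \<le> Cb * h ?T x y * (1 + log K (?\<Delta> / ?T))"
        using Cb h0 z K by (intro mult_nonneg_nonneg) (auto intro: add_nonneg_nonneg)
      show "0 \<le> Cb * Cd * h ?T x y / (1 - K powr (- \<gamma>'))"
        using Cb h0 Cd(1) Kg by auto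
      fix s assume s: "?T \<le> s"
      have sp: "0 < s" using s T by simp
      show "0 \<le> (if ?T \<le> s \<and> s \<le> ?\<Delta> then Cb * h ?T x y else 0)" using Cb h0 by simp
      show "0 \<le> (if ?\<Delta> \<le> s then (Cb * Cd * h ?T x y) * (?\<Delta> / s) powr \<gamma>' else 0)"
        using Cb h0 Cd(1) by simp
      assume ad: "adm s"
      note bs = bc(2)[OF xy(1) sp ad]
      show "A x y s \<le> (if ?T \<le> s \<and> s \<le> ?\<Delta> then Cb * h ?T x y else 0)
          + (if ?\<Delta> \<le> s then (Cb * Cd * h ?T x y) * (?\<Delta> / s) powr \<gamma>' else 0)"
      proof (cases "s \<le> ?\<Delta>")
        case True
        have "h s x y * b s x \<le> h ?T x y * Cb"
          using h_antimono[OF xy T s] bs h_nonneg[OF xy T] bc(1) by (intro mult_mono) auto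
        moreover have "0 \<le> (if ?\<Delta> \<le> s then (Cb * Cd * h ?T x y) * (?\<Delta> / s) powr \<gamma>' else 0)"
          using Cb h0 Cd(1) by simp
        ultimately show ?thesis using True s by (simp add: mult.commute)
      next
        case False
        then have lt: "?\<Delta> \<le> s" by simp
        have "h s x y \<le> Cd * (?\<Delta> / s) powr \<gamma>' * h ?\<Delta> x y" using Cd(2)[OF xy order.refl lt ad] .
        also have "\<dots> \<le> Cd * (?\<Delta> / s) powr \<gamma>' * h ?T x y"
          using h_antimono[OF xy T T\<Delta>] Cd(1) by (intro mult_left_mono) auto
        finally have "h s x y * b s x \<le> (Cd * (?\<Delta> / s) powr \<gamma>' * h ?T x y) * Cb"
          using bs h_nonneg[OF xy sp] bc(1) Cd(1) h0 by (intro mult_mono) auto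
        then show ?thesis using False lt by (simp add: mult_ac)
      qed
    qed
    also have "\<dots> \<le> ennreal (C * (h ?T x y * (1 + ln (?\<Delta> / ?T))))"
    proof (rule ennreal_leI)
      define Z where "Z = 1 + ln (?\<Delta> / ?T)"
      have Z: "1 \<le> Z" using lz by (simp add: Z_def)
      have e1: "Cb * h ?T x y * (1 + log K (?\<Delta> / ?T)) \<le> Cb * h ?T x y * (max 1 (1 / ln K) * Z)"
        unfolding Z_def using Cb h0 by (intro mult_left_mono one_plus_log_le K z) auto
      have e2: "Cb * Cd * h ?T x y / (1 - K powr (- \<gamma>')) * 1 \<le> Cb * Cd * h ?T x y / (1 - K powr (- \<gamma>')) * Z"
        using Cb h0 Cd(1) Kg Z by (intro mult_left_mono) auto
      have e3: "0 \<le> h ?T x y * Z" using h0 Z by simp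
      have "Cb * h ?T x y * (1 + log K (?\<Delta> / ?T)) + Cb * Cd * h ?T x y / (1 - K powr (- \<gamma>'))
          \<le> C * (h ?T x y * Z)"
      proof -
        have "C * (h ?T x y * Z) = Cb * h ?T x y * (max 1 (1 / ln K) * Z)
            + Cb * Cd * h ?T x y / (1 - K powr (- \<gamma>')) * Z + h ?T x y * Z"
          using Cb by (simp add: C_def distrib_left distrib_right mult_ac)
        then show ?thesis using e1 e2 e3 by linarith
      qed
      then show "Cb * h ?T x y * (1 + log K (?\<Delta> / ?T)) + Cb * Cd * h ?T x y / (1 - K powr (- \<gamma>'))
          \<le> C * (h ?T x y * (1 + ln (?\<Delta> / ?T)))" by (simp add: Z_def)
    qed
    finally show "series x y \<le> ennreal (C * (h ?T x y * (1 + ln (?\<Delta> / ?T))))" .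
  qed
  then show ?thesis
  proof (rule comparable_off_diagonal_cong[OF _ cl(1,2)])
    fix x y assume xy: "x \<in> D" "y \<in> D" "x \<noteq> y"
    show "cl * (h (\<Phi> (dist x y)) x y * ln (exp 1 + delta_max D x y / dist x y))
        \<le> h (\<Phi> (dist x y)) x y * (1 + ln (\<Delta> x y / \<Phi> (dist x y))) \<and>
       h (\<Phi> (dist x y)) x y * (1 + ln (\<Delta> x y / \<Phi> (dist x y)))
        \<le> Cl * (h (\<Phi> (dist x y)) x y * ln (exp 1 + delta_max D x y / dist x y))"
      using mult_left_mono[OF conjunct1[OF cl(3)[OF xy]] h_nonneg[OF xy T_pos[OF xy]]]
        mult_left_mono[OF conjunct2[OF cl(3)[OF xy]] h_nonneg[OF xy T_pos[OF xy]]]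
      by (simp add: mult.left_commute)
  qed
qed

text \<open>
  One grid point lies within a factor \<open>K\<close> below any prescribed scale \<open>u\<close> of the range, and its term alone
  gives the lower bounds.
\<close>
lemma A_grid_point_ge:
  obtains c where "0 < c"
    "\<And>x y u H. x \<in> D \<Longrightarrow> y \<in> D \<Longrightarrow> x \<noteq> y \<Longrightarrow> \<Phi> (dist x y) \<le> u \<Longrightarrow> adm u \<Longrightarrow> 0 \<le> H \<Longrightarrow>
       (\<And>s. 0 < s \<Longrightarrow> s \<le> u \<Longrightarrow> H \<le> h s x y) \<Longrightarrow> ennreal (c * (H * b u x)) \<le> series x y"
proof -
  obtain C where C: "1 \<le> C"
    "\<And>x s t. x \<in> D \<Longrightarrow> 0 < s \<Longrightarrow> s \<le> t \<Longrightarrow> adm t \<Longrightarrow> b s x \<le> C * (s / t) powr p1 * b t x"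
    "\<And>x s t. x \<in> D \<Longrightarrow> 0 < s \<Longrightarrow> s \<le> t \<Longrightarrow> adm t \<Longrightarrow> b t x \<le> C * (t / s) powr p2 * b s x"
    using b_bounds by blast
  define B where "B = C * K powr \<bar>p2\<bar>"
  have B: "0 < B" using C(1) K by (simp add: B_def)
  show thesis
  proof (rule that[of "1 / B"])
    show "0 < 1 / B" using B by simp
    fix x y u H assume xy: "x \<in> D" "y \<in> D" "x \<noteq> y" and u: "\<Phi> (dist x y) \<le> u" "adm u" and H: "0 \<le> H"
      and hH: "\<And>s. 0 < s \<Longrightarrow> s \<le> u \<Longrightarrow> H \<le> h s x y"
    obtain n where n: "0 < K ^ n * \<Phi> (dist x y)" "K ^ n * \<Phi> (dist x y) \<le> u"
      "u \<le> K * (K ^ n * \<Phi> (dist x y))" "adm (K ^ n * \<Phi> (dist x y))"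
      using grid_point_below[OF xy u] by blast
    define s where "s = K ^ n * \<Phi> (dist x y)"
    note n = n[folded s_def]
    have "b u x \<le> C * (u / s) powr p2 * b s x" by (rule C(3)[OF xy(1) n(1,2) u(2)])
    also have "\<dots> \<le> C * K powr \<bar>p2\<bar> * b s x"
      using C(1) b_pos[OF xy(1) n(1)] n
      by (intro mult_right_mono mult_left_mono powr_le_powr_abs) (auto simp: pos_divide_le_eq)
    finally have "b u x / B \<le> b s x" using B by (simp add: B_def pos_divide_le_eq mult.commute)
    then have "H * (b u x / B) \<le> h s x y * b s x"
      using hH[OF n(1,2)] H B b_pos[OF xy(1), of u] n by (intro mult_mono) auto
    then have "ennreal (1 / B * (H * b u x)) \<le> ennreal (A x y s)" by (intro ennreal_leI) simp
    also have "\<dots> \<le> series x y" unfolding s_def by (rule A_le_series[OF xy]) (use n s_def in simp)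
    finally show "ennreal (1 / B * (H * b u x)) \<le> series x y" .
  qed
qed

text \<open>
  The terms grow geometrically up to \<open>\<Delta> x y\<close>, since the weight does. Beyond, the decay of the boundary
  function wins, by \<open>p2 < \<gamma>'\<close>. The first value of \<open>h\<close> appears because \<open>h\<close> is comparable to it up to \<open>\<Delta> x y\<close>,
  either as a quantity of order 1 or because the range of scales is bounded.
\<close>
lemma green_intermediate_scale:
  assumes p: "0 < p1" "p2 < \<gamma>'"
  shows "comparable_off_diagonal D G (\<lambda>x y. h (\<Phi> (dist x y)) x y * b (\<Delta> x y) x)"
proof -
  obtain C where C: "1 \<le> C"
    "\<And>x s t. x \<in> D \<Longrightarrow> 0 < s \<Longrightarrow> s \<le> t \<Longrightarrow> adm t \<Longrightarrow> b s x \<le> C * (s / t) powr p1 * b t x"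
    "\<And>x s t. x \<in> D \<Longrightarrow> 0 < s \<Longrightarrow> s \<le> t \<Longrightarrow> adm t \<Longrightarrow> b t x \<le> C * (t / s) powr p2 * b s x"
    using b_bounds by blast
  obtain Cd where Cd: "1 \<le> Cd"
    "\<And>x y s t. x \<in> D \<Longrightarrow> y \<in> D \<Longrightarrow> x \<noteq> y \<Longrightarrow> \<Delta> x y \<le> s \<Longrightarrow> s \<le> t \<Longrightarrow> adm t \<Longrightarrow>
      h t x y \<le> Cd * (s / t) powr \<gamma>' * h s x y"
    using h_decay by blast
  obtain cr where cr: "0 < cr" "cr \<le> 1"
    "\<And>x y s. x \<in> D \<Longrightarrow> y \<in> D \<Longrightarrow> x \<noteq> y \<Longrightarrow> 2 * dist x y \<le> delta_max D x y \<Longrightarrow> 0 < s \<Longrightarrow> s \<le> \<Delta> x y \<Longrightarrow> cr \<le> h s x y"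
    using regular_scales by blast
  obtain Cn where Cn: "1 \<le> Cn"
    "\<And>x y. x \<in> D \<Longrightarrow> y \<in> D \<Longrightarrow> x \<noteq> y \<Longrightarrow> \<not> 2 * dist x y \<le> delta_max D x y \<Longrightarrow> \<Delta> x y \<le> Cn * \<Phi> (dist x y)"
    using \<Delta>_le_near_boundary by blast
  obtain cg where cg: "0 < cg"
    "\<And>x y u H. x \<in> D \<Longrightarrow> y \<in> D \<Longrightarrow> x \<noteq> y \<Longrightarrow> \<Phi> (dist x y) \<le> u \<Longrightarrow> adm u \<Longrightarrow> 0 \<le> H \<Longrightarrow>
       (\<And>s. 0 < s \<Longrightarrow> s \<le> u \<Longrightarrow> H \<le> h s x y) \<Longrightarrow> ennreal (cg * (H * b u x)) \<le> series x y"
    using A_grid_point_ge by blast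
  have K1: "K powr (- p1) < 1" "K powr (- (\<gamma>' - p2)) < 1" using K p by (simp_all add: powr_less_one)
  define c where "c = min (cg * cr) (1 / (C * Cn powr \<bar>p2\<bar>))"
  show ?thesis
  proof (rule comparable_seriesI[where c = c and C = "C / (1 - K powr (- p1)) + C * Cd / (1 - K powr (- (\<gamma>' - p2)))"])
    show "0 < c" using cg cr C(1) Cn(1) by (simp add: c_def)
    show "0 < C / (1 - K powr (- p1)) + C * Cd / (1 - K powr (- (\<gamma>' - p2)))"
      using C(1) Cd(1) K1 by (intro add_pos_pos divide_pos_pos mult_pos_pos) auto
    fix x y assume xy: "x \<in> D" "y \<in> D" "x \<noteq> y"
    let ?T = "\<Phi> (dist x y)" and ?\<Delta> = "\<Delta> x y"
    note T = T_pos[OF xy] and \<Delta> = \<Delta>_pos[OF xy] and T\<Delta> = T_le_\<Delta>[OF xy]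
    have h0: "0 \<le> h ?T x y" and h1: "h ?T x y \<le> 1" using h_nonneg[OF xy T] h_le_1[OF xy T] by auto
    have b\<Delta>: "0 < b ?\<Delta> x" by (rule b_pos[OF xy(1) \<Delta>])
    show "ennreal (c * (h ?T x y * b ?\<Delta> x)) \<le> series x y"
    proof (cases "2 * dist x y \<le> delta_max D x y")
      case True
      have "c * (h ?T x y * b ?\<Delta> x) \<le> (cg * cr) * (1 * b ?\<Delta> x)"
        using h0 h1 b\<Delta> cg(1) cr(1) by (intro mult_mono) (auto simp: c_def)
      then have "ennreal (c * (h ?T x y * b ?\<Delta> x)) \<le> ennreal (cg * (cr * b ?\<Delta> x))"
        by (intro ennreal_leI) simp
      also have "\<dots> \<le> series x y"
        by (rule cg(2)[OF xy T\<Delta> \<Delta>_adm[OF xy]]) (use cr(1) cr(3)[OF xy True] in auto)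
      finally show ?thesis .
    next
      case False
      have "b ?\<Delta> x \<le> C * (?\<Delta> / ?T) powr p2 * b ?T x" by (rule C(3)[OF xy(1) T T\<Delta> \<Delta>_adm[OF xy]])
      also have "\<dots> \<le> C * Cn powr \<bar>p2\<bar> * b ?T x"
        using C(1) b_pos[OF xy(1) T] T T\<Delta> Cn(2)[OF xy False]
        by (intro mult_right_mono mult_left_mono powr_le_powr_abs) (auto simp: pos_divide_le_eq)
      finally have bb: "1 / (C * Cn powr \<bar>p2\<bar>) * b ?\<Delta> x \<le> b ?T x"
        using C(1) Cn(1) by (simp add: pos_divide_le_eq mult.commute)
      have "c * b ?\<Delta> x \<le> 1 / (C * Cn powr \<bar>p2\<bar>) * b ?\<Delta> x"
        using b\<Delta> by (intro mult_right_mono) (auto simp: c_def)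
      with bb have "h ?T x y * (c * b ?\<Delta> x) \<le> h ?T x y * b ?T x"
        using h0 by (intro mult_left_mono) auto
      then have "ennreal (c * (h ?T x y * b ?\<Delta> x)) \<le> ennreal (A x y ?T)"
        by (intro ennreal_leI) (simp add: mult.left_commute)
      then show ?thesis using A_T_le_series[OF xy] by (rule order.trans)
    qed
    let ?H = "C * (h ?T x y * b ?\<Delta> x)" and ?H' = "C * Cd * (h ?T x y * b ?\<Delta> x)"
    have H: "0 \<le> ?H" "0 \<le> ?H'" using C(1) Cd(1) h0 b\<Delta> by auto
    have "series x y \<le> ennreal (?H / (1 - K powr (- p1)) + ?H' / (1 - K powr (- (\<gamma>' - p2))))"
    proof (rule series_split[OF xy, where
          f = "\<lambda>s. if s \<le> ?\<Delta> then ?H * (s / ?\<Delta>) powr p1 else 0" and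
          g = "\<lambda>s. if ?\<Delta> \<le> s then ?H' * (?\<Delta> / s) powr (\<gamma>' - p2) else 0"])
      show "scale_series K adm ?T (\<lambda>s. if s \<le> ?\<Delta> then ?H * (s / ?\<Delta>) powr p1 else 0) \<le> ennreal (?H / (1 - K powr (- p1)))"
        by (rule scale_series_head[OF K T \<Delta> p(1) H(1)])
      show "scale_series K adm ?T (\<lambda>s. if ?\<Delta> \<le> s then ?H' * (?\<Delta> / s) powr (\<gamma>' - p2) else 0)
          \<le> ennreal (?H' / (1 - K powr (- (\<gamma>' - p2))))"
        by (rule scale_series_tail[OF K T \<Delta> _ H(2)]) (use p in simp)
      show "0 \<le> ?H / (1 - K powr (- p1))" "0 \<le> ?H' / (1 - K powr (- (\<gamma>' - p2)))"
        using H K1 by (auto intro!: divide_nonneg_pos simp del: mult_nonneg_nonneg)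
      fix s assume s: "?T \<le> s"
      have sp: "0 < s" using s T by simp
      show f0: "0 \<le> (if s \<le> ?\<Delta> then ?H * (s / ?\<Delta>) powr p1 else 0)" using H by auto
      show g0: "0 \<le> (if ?\<Delta> \<le> s then ?H' * (?\<Delta> / s) powr (\<gamma>' - p2) else 0)" using H by auto
      assume ad: "adm s"
      show "A x y s \<le> (if s \<le> ?\<Delta> then ?H * (s / ?\<Delta>) powr p1 else 0)
          + (if ?\<Delta> \<le> s then ?H' * (?\<Delta> / s) powr (\<gamma>' - p2) else 0)"
      proof (cases "s \<le> ?\<Delta>")
        case True
        have "h s x y * b s x \<le> h ?T x y * (C * (s / ?\<Delta>) powr p1 * b ?\<Delta> x)"
          using h_antimono[OF xy T s] C(2)[OF xy(1) sp True \<Delta>_adm[OF xy]] h0 b_pos[OF xy(1) sp]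
          by (intro mult_mono) auto
        also have "\<dots> = ?H * (s / ?\<Delta>) powr p1" by simp
        finally show ?thesis using True g0 by simp
      next
        case False
        then have lt: "?\<Delta> \<le> s" by simp
        have "h s x y \<le> Cd * (?\<Delta> / s) powr \<gamma>' * h ?\<Delta> x y" using Cd(2)[OF xy order.refl lt ad] .
        also have "\<dots> \<le> Cd * (?\<Delta> / s) powr \<gamma>' * h ?T x y"
          using h_antimono[OF xy T T\<Delta>] Cd(1) by (intro mult_left_mono) auto
        finally have "h s x y * b s x \<le> (Cd * (?\<Delta> / s) powr \<gamma>' * h ?T x y) * (C * (s / ?\<Delta>) powr p2 * b ?\<Delta> x)"
          using C(3)[OF xy(1) \<Delta> lt ad] Cd(1) h0 b_pos[OF xy(1) sp] by (intro mult_mono) auto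
        also have "(s / ?\<Delta>) powr p2 = (?\<Delta> / s) powr (- p2)"
          using sp \<Delta> by (simp add: powr_divide powr_minus field_simps)
        finally have "A x y s \<le> ?H' * ((?\<Delta> / s) powr \<gamma>' * (?\<Delta> / s) powr (- p2))"
          by (simp add: mult_ac)
        also have "(?\<Delta> / s) powr \<gamma>' * (?\<Delta> / s) powr (- p2) = (?\<Delta> / s) powr (\<gamma>' - p2)"
          by (simp flip: powr_add)
        finally show ?thesis using False lt by simp
      qed
    qed
    also have "?H / (1 - K powr (- p1)) + ?H' / (1 - K powr (- (\<gamma>' - p2)))
        = (C / (1 - K powr (- p1)) + C * Cd / (1 - K powr (- (\<gamma>' - p2)))) * (h ?T x y * b ?\<Delta> x)"
      by (simp add: distrib_right)
    finally show "series x y \<le> ennreal ((C / (1 - K powr (- p1)) + C * Cd / (1 - K powr (- (\<gamma>' - p2)))) * (h ?T x y * b ?\<Delta> x))" .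
  qed
qed

lemma top_scale:
  assumes "bounded D" "x \<in> D" "y \<in> D" "x \<noteq> y"
  shows "adm (\<Phi> (diameter D))" "\<Phi> (dist x y) \<le> \<Phi> (diameter D)" "\<Delta> x y \<le> \<Phi> (diameter D)"
    "0 < \<Phi> (diameter D)" "adm s \<longleftrightarrow> s \<le> \<Phi> (diameter D)"
  using assms T_adm[OF assms(2-4)] \<Delta>_adm[OF assms(2-4)] T_pos[OF assms(2-4)] by (auto simp: adm_iff)

lemma A_le_top:
  assumes "bounded D"
  obtains C where "1 \<le> C" "\<And>x y s. x \<in> D \<Longrightarrow> y \<in> D \<Longrightarrow> x \<noteq> y \<Longrightarrow> 0 < s \<Longrightarrow> adm s \<Longrightarrow>
    A x y s \<le> C * (h (\<Phi> (diameter D)) x y * b (\<Phi> (diameter D)) x) * (s / \<Phi> (diameter D)) powr (p1 - \<gamma>)"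
proof -
  obtain C where C: "1 \<le> C"
    "\<And>x s t. x \<in> D \<Longrightarrow> 0 < s \<Longrightarrow> s \<le> t \<Longrightarrow> adm t \<Longrightarrow> b s x \<le> C * (s / t) powr p1 * b t x"
    "\<And>x s t. x \<in> D \<Longrightarrow> 0 < s \<Longrightarrow> s \<le> t \<Longrightarrow> adm t \<Longrightarrow> b t x \<le> C * (t / s) powr p2 * b s x"
    using b_bounds by blast
  obtain Ch where Ch: "1 \<le> Ch"
    "\<And>x y s t. x \<in> D \<Longrightarrow> y \<in> D \<Longrightarrow> x \<noteq> y \<Longrightarrow> 0 < s \<Longrightarrow> s \<le> t \<Longrightarrow> adm t \<Longrightarrow>
      h s x y \<le> Ch * (t / s) powr \<gamma> * h t x y"
    using h_doubling by blast
  show thesis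
  proof (rule that[of "Ch * C"])
    show "1 \<le> Ch * C" using mult_mono[OF Ch(1) C(1)] Ch(1) by simp
    fix x y s assume xy: "x \<in> D" "y \<in> D" "x \<noteq> y" and s: "0 < s" "adm s"
    let ?\<Theta> = "\<Phi> (diameter D)"
    note top = top_scale[OF assms xy]
    have le: "s \<le> ?\<Theta>" using s top(5) by simp
    have "h s x y * b s x \<le> (Ch * (?\<Theta> / s) powr \<gamma> * h ?\<Theta> x y) * (C * (s / ?\<Theta>) powr p1 * b ?\<Theta> x)"
      using Ch(2)[OF xy s(1) le top(1)] C(2)[OF xy(1) s(1) le top(1)] Ch(1) h_nonneg[OF xy top(4)] b_pos[OF xy(1) s(1)]
      by (intro mult_mono) auto
    also have "(?\<Theta> / s) powr \<gamma> = (s / ?\<Theta>) powr (- \<gamma>)"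
      using s top(4) by (simp add: powr_divide powr_minus field_simps)
    also have "(Ch * (s / ?\<Theta>) powr (- \<gamma>) * h ?\<Theta> x y) * (C * (s / ?\<Theta>) powr p1 * b ?\<Theta> x)
        = Ch * C * (h ?\<Theta> x y * b ?\<Theta> x) * ((s / ?\<Theta>) powr p1 * (s / ?\<Theta>) powr (- \<gamma>))"
      by (simp add: mult_ac)
    also have "(s / ?\<Theta>) powr p1 * (s / ?\<Theta>) powr (- \<gamma>) = (s / ?\<Theta>) powr (p1 - \<gamma>)"
      by (simp flip: powr_add)
    finally show "A x y s \<le> Ch * C * (h ?\<Theta> x y * b ?\<Theta> x) * (s / ?\<Theta>) powr (p1 - \<gamma>)" .
  qed
qed

text \<open>
  The weight grows faster than the boundary function can decay, so the last term dominates.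
\<close>
lemma green_top_scale:
  assumes D: "bounded D" and p: "\<gamma> < p1"
  shows "comparable_off_diagonal D G (\<lambda>x y. h (\<Phi> (diameter D)) x y * b (\<Phi> (diameter D)) x)"
proof -
  obtain C where C: "1 \<le> C" "\<And>x y s. x \<in> D \<Longrightarrow> y \<in> D \<Longrightarrow> x \<noteq> y \<Longrightarrow> 0 < s \<Longrightarrow> adm s \<Longrightarrow>
    A x y s \<le> C * (h (\<Phi> (diameter D)) x y * b (\<Phi> (diameter D)) x) * (s / \<Phi> (diameter D)) powr (p1 - \<gamma>)"
    using A_le_top[OF D] by blast
  obtain cg where cg: "0 < cg"
    "\<And>x y u H. x \<in> D \<Longrightarrow> y \<in> D \<Longrightarrow> x \<noteq> y \<Longrightarrow> \<Phi> (dist x y) \<le> u \<Longrightarrow> adm u \<Longrightarrow> 0 \<le> H \<Longrightarrow>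
       (\<And>s. 0 < s \<Longrightarrow> s \<le> u \<Longrightarrow> H \<le> h s x y) \<Longrightarrow> ennreal (cg * (H * b u x)) \<le> series x y"
    using A_grid_point_ge by blast
  have K1: "K powr (- (p1 - \<gamma>)) < 1" using K p by (simp add: powr_less_one)
  let ?\<Theta> = "\<Phi> (diameter D)"
  show ?thesis
  proof (rule comparable_seriesI[where c = cg and C = "C / (1 - K powr (- (p1 - \<gamma>)))"])
    show "0 < C / (1 - K powr (- (p1 - \<gamma>)))" using C(1) K1 by simp
    fix x y assume xy: "x \<in> D" "y \<in> D" "x \<noteq> y"
    note top = top_scale[OF D xy]
    let ?H = "C * (h ?\<Theta> x y * b ?\<Theta> x)"
    have H: "0 \<le> ?H" using C(1) A_nonneg[OF xy top(4)] by simp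
    show "ennreal (cg * (h ?\<Theta> x y * b ?\<Theta> x)) \<le> series x y"
      by (rule cg(2)[OF xy top(2,1) h_nonneg[OF xy top(4)] h_antimono[OF xy]])
    have "series x y \<le> scale_series K adm (\<Phi> (dist x y)) (\<lambda>s. if s \<le> ?\<Theta> then ?H * (s / ?\<Theta>) powr (p1 - \<gamma>) else 0)"
    proof (rule scale_series_mono[OF K T_pos[OF xy]])
      fix s assume s: "\<Phi> (dist x y) \<le> s" "adm s"
      then show "A x y s \<le> (if s \<le> ?\<Theta> then ?H * (s / ?\<Theta>) powr (p1 - \<gamma>) else 0)"
        using C(2)[OF xy _ s(2)] top(5)[of s] T_pos[OF xy] by simp
    qed
    also have "\<dots> \<le> ennreal (?H / (1 - K powr (- (p1 - \<gamma>))))"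
      by (rule scale_series_head[OF K T_pos[OF xy] top(4) _ H]) (use p in simp)
    finally show "series x y \<le> ennreal (C / (1 - K powr (- (p1 - \<gamma>))) * (h ?\<Theta> x y * b ?\<Theta> x))" by simp
  qed (rule cg)
qed

text \<open>
  The terms do not decrease below a multiple of the first one, which is positive by regularity at a
  scale below the distance of both points to the complement.
\<close>
lemma green_infinite:
  assumes unb: "\<not> bounded D" and p: "\<gamma> \<le> p1" and xy: "x \<in> D" "y \<in> D" "x \<noteq> y"
  shows "G x y = \<infinity>"
proof -
  have adm: "adm t" for t using unb by (simp add: adm_iff)
  obtain C where C: "1 \<le> C"
    "\<And>x s t. x \<in> D \<Longrightarrow> 0 < s \<Longrightarrow> s \<le> t \<Longrightarrow> adm t \<Longrightarrow> b s x \<le> C * (s / t) powr p1 * b t x"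
    "\<And>x s t. x \<in> D \<Longrightarrow> 0 < s \<Longrightarrow> s \<le> t \<Longrightarrow> adm t \<Longrightarrow> b t x \<le> C * (t / s) powr p2 * b s x"
    using b_bounds by blast
  obtain Ch where Ch: "1 \<le> Ch"
    "\<And>x y s t. x \<in> D \<Longrightarrow> y \<in> D \<Longrightarrow> x \<noteq> y \<Longrightarrow> 0 < s \<Longrightarrow> s \<le> t \<Longrightarrow> adm t \<Longrightarrow>
      h s x y \<le> Ch * (t / s) powr \<gamma> * h t x y"
    using h_doubling by blast
  let ?T = "\<Phi> (dist x y)"
  note T = T_pos[OF xy]
  have hT: "0 < h ?T x y"
  proof -
    obtain cr where cr: "0 < cr" "\<And>x y t. x \<in> D \<Longrightarrow> y \<in> D \<Longrightarrow> 0 < t \<Longrightarrow> ereal t < 4 * scale_diam \<Phi> D + 1 \<Longrightarrow>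
        scale_inv \<Phi> t \<le> delta_min D x y \<Longrightarrow> cr \<le> h t x y"
      using regular unfolding regular_boundary_function_def by blast
    have "0 < delta D z" if "z \<in> D" for z
      unfolding delta_def using D that by (intro infdist_pos_not_in_closed) auto
    then have d: "0 < delta_min D x y" using xy by (simp add: delta_min_def)
    define s where "s = min ?T (\<Phi> (delta_min D x y))"
    have s: "0 < s" "s \<le> ?T" using T scale_function_pos[OF scale d] by (auto simp: s_def)
    have "scale_inv \<Phi> s \<le> scale_inv \<Phi> (\<Phi> (delta_min D x y))"
      by (intro scale_inv_mono[OF scale]) (simp add: s_def)
    also have "\<dots> = delta_min D x y" using d by (intro scale_inv_scale[OF scale]) simp
    finally have "cr \<le> h s x y" by (intro cr xy s adm_less[OF xy adm])
    also have "\<dots> \<le> Ch * (?T / s) powr \<gamma> * h ?T x y" by (rule Ch(2)[OF xy s adm])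
    finally have "h ?T x y \<noteq> 0" using cr(1) by auto
    then show ?thesis using h_nonneg[OF xy T] by simp
  qed
  define H where "H = A x y ?T / (Ch * C)"
  have "scale_series K adm ?T (A x y) = \<infinity>"
  proof (rule scale_series_infinite[OF K T])
    show "0 < H" using hT b_pos[OF xy(1) T] C(1) Ch(1) by (simp add: H_def)
    fix s assume s: "?T \<le> s"
    have sp: "0 < s" using s T by simp
    have "h ?T x y * b ?T x \<le> (Ch * (s / ?T) powr \<gamma> * h s x y) * (C * (?T / s) powr p1 * b s x)"
      using Ch(2)[OF xy T s adm] C(2)[OF xy(1) T s adm] Ch(1) h_nonneg[OF xy sp] b_pos[OF xy(1) T]
      by (intro mult_mono) auto
    also have "(s / ?T) powr \<gamma> = (?T / s) powr (- \<gamma>)"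
      using sp T by (simp add: powr_divide powr_minus field_simps)
    also have "(Ch * (?T / s) powr (- \<gamma>) * h s x y) * (C * (?T / s) powr p1 * b s x)
        = Ch * C * A x y s * ((?T / s) powr p1 * (?T / s) powr (- \<gamma>))"
      by (simp add: mult_ac)
    also have "(?T / s) powr p1 * (?T / s) powr (- \<gamma>) = (?T / s) powr (p1 - \<gamma>)"
      by (simp flip: powr_add)
    also have "Ch * C * A x y s * (?T / s) powr (p1 - \<gamma>) \<le> Ch * C * A x y s * 1"
      using Ch(1) C(1) h_nonneg[OF xy sp] b_pos[OF xy(1) sp] p T s
      by (intro mult_left_mono powr_le1 mult_nonneg_nonneg) auto
    finally have "H \<le> A x y s" using Ch(1) C(1) by (simp add: H_def pos_divide_le_eq mult.commute)
    then show "adm s \<and> H \<le> A x y s" using adm by simp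
  qed
  moreover obtain c where c: "0 < c" "ennreal c * series x y \<le> G x y"
    using G_series xy by blast
  ultimately show ?thesis using c by (simp add: ennreal_mult_top top_unique)
qed

text \<open>
  Beyond \<open>\<Delta> x y\<close> growth of the weight and decay of the boundary function cancel, and the terms count scales.
  Below, they are at most of the order of the last term. If the points are close to the boundary compared with
  their distance, there are boundedly many of them; otherwise the boundary function is of order 1, and the
  weight grows geometrically up to \<open>\<Delta> x y\<close>.
\<close>
lemma green_top_logarithmic:
  assumes D: "bounded D" and p: "p1 = \<gamma>" "p2 = \<gamma>" "\<gamma>' = \<gamma>"
  shows "comparable_off_diagonal D G
    (\<lambda>x y. h (\<Phi> (diameter D)) x y * b (\<Phi> (diameter D)) x * (1 + ln (\<Phi> (diameter D) / \<Delta> x y)))"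
proof -
  let ?\<Theta> = "\<Phi> (diameter D)"
  have \<gamma>: "0 < \<gamma>" using H2_star p by (simp add: H2_star_def)
  obtain C where C: "1 \<le> C"
    "\<And>x s t. x \<in> D \<Longrightarrow> 0 < s \<Longrightarrow> s \<le> t \<Longrightarrow> adm t \<Longrightarrow> b s x \<le> C * (s / t) powr p1 * b t x"
    "\<And>x s t. x \<in> D \<Longrightarrow> 0 < s \<Longrightarrow> s \<le> t \<Longrightarrow> adm t \<Longrightarrow> b t x \<le> C * (t / s) powr p2 * b s x"
    using b_bounds by blast
  obtain Ct where Ct: "1 \<le> Ct" "\<And>x y s. x \<in> D \<Longrightarrow> y \<in> D \<Longrightarrow> x \<noteq> y \<Longrightarrow> 0 < s \<Longrightarrow> adm s \<Longrightarrow>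
    A x y s \<le> Ct * (h ?\<Theta> x y * b ?\<Theta> x) * (s / ?\<Theta>) powr (p1 - \<gamma>)"
    using A_le_top[OF D] by blast
  obtain Cd where Cd: "1 \<le> Cd"
    "\<And>x y s t. x \<in> D \<Longrightarrow> y \<in> D \<Longrightarrow> x \<noteq> y \<Longrightarrow> \<Delta> x y \<le> s \<Longrightarrow> s \<le> t \<Longrightarrow> adm t \<Longrightarrow>
      h t x y \<le> Cd * (s / t) powr \<gamma>' * h s x y"
    using h_decay by blast
  obtain cr where cr: "0 < cr" "cr \<le> 1"
    "\<And>x y s. x \<in> D \<Longrightarrow> y \<in> D \<Longrightarrow> x \<noteq> y \<Longrightarrow> 2 * dist x y \<le> delta_max D x y \<Longrightarrow> 0 < s \<Longrightarrow> s \<le> \<Delta> x y \<Longrightarrow> cr \<le> h s x y"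
    using regular_scales by blast
  obtain Cn where Cn: "1 \<le> Cn"
    "\<And>x y. x \<in> D \<Longrightarrow> y \<in> D \<Longrightarrow> x \<noteq> y \<Longrightarrow> \<not> 2 * dist x y \<le> delta_max D x y \<Longrightarrow> \<Delta> x y \<le> Cn * \<Phi> (dist x y)"
    using \<Delta>_le_near_boundary by blast
  obtain cg where cg: "0 < cg"
    "\<And>x y u H. x \<in> D \<Longrightarrow> y \<in> D \<Longrightarrow> x \<noteq> y \<Longrightarrow> \<Phi> (dist x y) \<le> u \<Longrightarrow> adm u \<Longrightarrow> 0 \<le> H \<Longrightarrow>
       (\<And>s. 0 < s \<Longrightarrow> s \<le> u \<Longrightarrow> H \<le> h s x y) \<Longrightarrow> ennreal (cg * (H * b u x)) \<le> series x y"
    using A_grid_point_ge by blast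
  have Kg: "K powr (- \<gamma>) < 1" using K \<gamma> by (simp add: powr_less_one)
  define c where "c = min cg (1 / (Cd * C)) / (3 * max 1 (ln K))"
  define B where "B = max (1 + log K Cn) (C / (cr * (1 - K powr (- \<gamma>))))"
  have B: "0 < B" using Cn(1) K by (simp add: B_def less_max_iff_disj add_pos_nonneg)
  show ?thesis
  proof (rule comparable_seriesI[where c = c and C = "Ct * B + Ct * max 1 (1 / ln K)"])
    show "0 < c" using cg(1) Cd(1) C(1) by (simp add: c_def)
    show "0 < Ct * B + Ct * max 1 (1 / ln K)" using Ct(1) B by (intro add_pos_pos mult_pos_pos) auto
    fix x y assume xy: "x \<in> D" "y \<in> D" "x \<noteq> y"
    let ?T = "\<Phi> (dist x y)" and ?\<Delta> = "\<Delta> x y"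
    note top = top_scale[OF D xy]
    note T = T_pos[OF xy] and \<Delta> = \<Delta>_pos[OF xy] and T\<Delta> = T_le_\<Delta>[OF xy]
    define A\<Theta> where "A\<Theta> = h ?\<Theta> x y * b ?\<Theta> x"
    have A0: "0 \<le> A\<Theta>" using A_nonneg[OF xy top(4)] by (simp add: A\<Theta>_def)
    have z: "1 \<le> ?\<Theta> / ?\<Delta>" using \<Delta> top(3) by simp
    have lz: "0 \<le> ln (?\<Theta> / ?\<Delta>)" using z by simp
    have At: "A x y s \<le> Ct * A\<Theta>" if "0 < s" "adm s" for s
      using Ct(2)[OF xy that] that top(4) by (simp add: p A\<Theta>_def)
    show "ennreal (c * (h ?\<Theta> x y * b ?\<Theta> x * (1 + ln (?\<Theta> / ?\<Delta>)))) \<le> series x y"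
    proof -
      define H where "H = min cg (1 / (Cd * C)) * A\<Theta>"
      have H: "0 \<le> H" using A0 cg(1) C(1) Cd(1) by (simp add: H_def)
      have "H \<le> cg * A\<Theta>" unfolding H_def using A0 by (intro mult_right_mono) auto
      then have "ennreal H \<le> ennreal (cg * A\<Theta>)" by (rule ennreal_leI)
      also have "\<dots> \<le> series x y" unfolding A\<Theta>_def
        by (rule cg(2)[OF xy top(2,1) h_nonneg[OF xy top(4)] h_antimono[OF xy]])
      finally have 1: "ennreal H \<le> series x y" .
      have 2: "ennreal (H * (log K (?\<Theta> / ?\<Delta>) - 1)) \<le> series x y"
      proof (rule scale_series_count_lower[OF K T T\<Delta> top(3) H])
        fix s assume s: "?\<Delta> \<le> s" "s \<le> ?\<Theta>"
        have sp: "0 < s" using s \<Delta> by simp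
        have "A\<Theta> \<le> (Cd * (s / ?\<Theta>) powr \<gamma> * h s x y) * (C * (?\<Theta> / s) powr \<gamma> * b s x)"
          unfolding A\<Theta>_def
          using Cd(2)[OF xy s top(1)] C(3)[OF xy(1) sp s(2) top(1)] Cd(1) h_nonneg[OF xy sp] b_pos[OF xy(1) top(4)]
          by (intro mult_mono) (auto simp: p)
        also have "\<dots> = Cd * C * A x y s * ((s / ?\<Theta>) powr \<gamma> * (?\<Theta> / s) powr \<gamma>)" by (simp add: mult_ac)
        also have "(s / ?\<Theta>) powr \<gamma> * (?\<Theta> / s) powr \<gamma> = 1"
          using sp top(4) by (simp add: powr_divide)
        finally have "1 / (Cd * C) * A\<Theta> \<le> A x y s"
          using C(1) Cd(1) by (simp add: pos_divide_le_eq mult.commute)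
        moreover have "H \<le> 1 / (Cd * C) * A\<Theta>" unfolding H_def using A0 by (intro mult_right_mono) auto
        ultimately show "adm s \<and> H \<le> A x y s" using s top(5)[of s] by simp
      qed
      have "ennreal (H / (3 * max 1 (ln K)) * (1 + ln (?\<Theta> / ?\<Delta>))) \<le> series x y"
        by (rule count_combine[OF 1 2 H K z])
      then show ?thesis by (simp add: c_def H_def A\<Theta>_def mult_ac)
    qed
    have low: "\<exists>f. (\<forall>s. 0 < s \<longrightarrow> 0 \<le> f s) \<and> (\<forall>s. ?T \<le> s \<longrightarrow> s \<le> ?\<Delta> \<longrightarrow> A x y s \<le> f s) \<and>
        scale_series K adm ?T f \<le> ennreal (Ct * B * A\<Theta>)"
    proof (cases "2 * dist x y \<le> delta_max D x y")
      case True
      define H where "H = C * b ?\<Delta> x"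
      have H: "0 \<le> H" using C(1) b_pos[OF xy(1) \<Delta>] by (simp add: H_def)
      show ?thesis
      proof (rule exI[of _ "\<lambda>s. if s \<le> ?\<Delta> then H * (s / ?\<Delta>) powr \<gamma> else 0"], intro conjI allI impI)
        fix s :: real
        show "0 \<le> (if s \<le> ?\<Delta> then H * (s / ?\<Delta>) powr \<gamma> else 0)" using H by simp
      next
        fix s assume s: "?T \<le> s" "s \<le> ?\<Delta>"
        have sp: "0 < s" using s T by simp
        have "h s x y * b s x \<le> 1 * (C * (s / ?\<Delta>) powr \<gamma> * b ?\<Delta> x)"
          using h_le_1[OF xy sp] C(2)[OF xy(1) sp s(2) \<Delta>_adm[OF xy]] b_pos[OF xy(1) sp]
          by (intro mult_mono) (auto simp: p)
        then show "A x y s \<le> (if s \<le> ?\<Delta> then H * (s / ?\<Delta>) powr \<gamma> else 0)"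
          using s by (simp add: H_def mult_ac)
      next
        have "scale_series K adm ?T (\<lambda>s. if s \<le> ?\<Delta> then H * (s / ?\<Delta>) powr \<gamma> else 0) \<le> ennreal (H / (1 - K powr (- \<gamma>)))"
          by (rule scale_series_head[OF K T \<Delta> \<gamma> H])
        also have "\<dots> \<le> ennreal (Ct * B * A\<Theta>)"
        proof (rule ennreal_leI)
          have "cr * b ?\<Delta> x \<le> A x y ?\<Delta>"
            using cr(3)[OF xy True \<Delta> order.refl] b_pos[OF xy(1) \<Delta>] by (intro mult_right_mono) auto
          also have "\<dots> \<le> Ct * A\<Theta>" by (rule At[OF \<Delta> \<Delta>_adm[OF xy]])
          finally have "b ?\<Delta> x \<le> Ct * A\<Theta> / cr" using cr(1) by (simp add: pos_le_divide_eq mult.commute)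
          then have "H / (1 - K powr (- \<gamma>)) \<le> C * (Ct * A\<Theta> / cr) / (1 - K powr (- \<gamma>))"
            unfolding H_def using C(1) Kg by (intro divide_right_mono mult_left_mono) auto
          also have "\<dots> = C / (cr * (1 - K powr (- \<gamma>))) * (Ct * A\<Theta>)" by simp
          also have "\<dots> \<le> B * (Ct * A\<Theta>)"
            using Ct(1) A0 by (intro mult_right_mono) (auto simp: B_def)
          finally show "H / (1 - K powr (- \<gamma>)) \<le> Ct * B * A\<Theta>" by (simp add: mult_ac)
        qed
        finally show "scale_series K adm ?T (\<lambda>s. if s \<le> ?\<Delta> then H * (s / ?\<Delta>) powr \<gamma> else 0) \<le> ennreal (Ct * B * A\<Theta>)" .
      qed
    next
      case False
      show ?thesis
      proof (rule exI[of _ "\<lambda>s. if ?T \<le> s \<and> s \<le> ?\<Delta> then Ct * A\<Theta> else 0"], intro conjI allI impI)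
        fix s :: real
        show "0 \<le> (if ?T \<le> s \<and> s \<le> ?\<Delta> then Ct * A\<Theta> else 0)" using Ct(1) A0 by simp
      next
        fix s assume s: "?T \<le> s" "s \<le> ?\<Delta>"
        then show "A x y s \<le> (if ?T \<le> s \<and> s \<le> ?\<Delta> then Ct * A\<Theta> else 0)"
          using At[of s] T adm_mono[OF s(2) \<Delta>_adm[OF xy]] by simp
      next
        have "scale_series K adm ?T (\<lambda>s. if ?T \<le> s \<and> s \<le> ?\<Delta> then Ct * A\<Theta> else 0)
            \<le> ennreal (Ct * A\<Theta> * (1 + log K (?\<Delta> / ?T)))"
          using Ct(1) A0 by (intro scale_series_count_upper[OF K T T T\<Delta>]) simp
        also have "\<dots> \<le> ennreal (Ct * B * A\<Theta>)"
        proof (rule ennreal_leI)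
          have "?\<Delta> / ?T \<le> Cn" using Cn(2)[OF xy False] T by (simp add: pos_divide_le_eq)
          then have "log K (?\<Delta> / ?T) \<le> log K Cn" using K T \<Delta> Cn(1) by simp
          then have "Ct * A\<Theta> * (1 + log K (?\<Delta> / ?T)) \<le> Ct * A\<Theta> * B"
            using Ct(1) A0 by (intro mult_left_mono) (auto simp: B_def)
          then show "Ct * A\<Theta> * (1 + log K (?\<Delta> / ?T)) \<le> Ct * B * A\<Theta>" by (simp add: mult_ac)
        qed
        finally show "scale_series K adm ?T (\<lambda>s. if ?T \<le> s \<and> s \<le> ?\<Delta> then Ct * A\<Theta> else 0) \<le> ennreal (Ct * B * A\<Theta>)" .
      qed
    qed
    then obtain f where f: "\<And>s. 0 < s \<Longrightarrow> 0 \<le> f s" "\<And>s. ?T \<le> s \<Longrightarrow> s \<le> ?\<Delta> \<Longrightarrow> A x y s \<le> f s"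
      "scale_series K adm ?T f \<le> ennreal (Ct * B * A\<Theta>)" by blast
    have "series x y \<le> ennreal (Ct * B * A\<Theta> + Ct * A\<Theta> * (1 + log K (?\<Theta> / ?\<Delta>)))"
    proof (rule series_split[OF xy, where f = f and g = "\<lambda>s. if ?\<Delta> \<le> s \<and> s \<le> ?\<Theta> then Ct * A\<Theta> else 0"])
      show "scale_series K adm ?T (\<lambda>s. if ?\<Delta> \<le> s \<and> s \<le> ?\<Theta> then Ct * A\<Theta> else 0)
          \<le> ennreal (Ct * A\<Theta> * (1 + log K (?\<Theta> / ?\<Delta>)))"
        using Ct(1) A0 by (intro scale_series_count_upper[OF K T \<Delta> top(3)]) simp
      show "0 \<le> Ct * B * A\<Theta>" using Ct(1) A0 B by simp
      show "0 \<le> Ct * A\<Theta> * (1 + log K (?\<Theta> / ?\<Delta>))"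
        using Ct(1) A0 K z by (intro mult_nonneg_nonneg) (auto intro: add_nonneg_nonneg)
      fix s assume s: "?T \<le> s"
      have sp: "0 < s" using s T by simp
      show "0 \<le> f s" by (rule f(1)[OF sp])
      show g0: "0 \<le> (if ?\<Delta> \<le> s \<and> s \<le> ?\<Theta> then Ct * A\<Theta> else 0)" using Ct(1) A0 by simp
      assume ad: "adm s"
      show "A x y s \<le> f s + (if ?\<Delta> \<le> s \<and> s \<le> ?\<Theta> then Ct * A\<Theta> else 0)"
      proof (cases "s \<le> ?\<Delta>")
        case True
        then show ?thesis using f(2)[OF s True] g0 by linarith
      next
        case False
        then show ?thesis using At[OF sp ad] f(1)[OF sp] ad top(5)[of s] by simp
      qed
    qed (rule f(3))
    also have "\<dots> \<le> ennreal ((Ct * B + Ct * max 1 (1 / ln K)) * (h ?\<Theta> x y * b ?\<Theta> x * (1 + ln (?\<Theta> / ?\<Delta>))))"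
    proof (rule ennreal_leI)
      define Z where "Z = 1 + ln (?\<Theta> / ?\<Delta>)"
      have Z: "1 \<le> Z" using lz by (simp add: Z_def)
      have e1: "Ct * A\<Theta> * (1 + log K (?\<Theta> / ?\<Delta>)) \<le> Ct * A\<Theta> * (max 1 (1 / ln K) * Z)"
        unfolding Z_def using Ct(1) A0 by (intro mult_left_mono one_plus_log_le K z) auto
      have e2: "Ct * B * A\<Theta> * 1 \<le> Ct * B * A\<Theta> * Z"
        using Ct(1) A0 B Z by (intro mult_left_mono) auto
      have "(Ct * B + Ct * max 1 (1 / ln K)) * (A\<Theta> * Z) = Ct * B * A\<Theta> * Z + Ct * A\<Theta> * (max 1 (1 / ln K) * Z)"
        by (simp add: distrib_left distrib_right mult_ac)
      then have "Ct * B * A\<Theta> + Ct * A\<Theta> * (1 + log K (?\<Theta> / ?\<Delta>)) \<le> (Ct * B + Ct * max 1 (1 / ln K)) * (A\<Theta> * Z)"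
        using e1 e2 by linarith
      then show "Ct * B * A\<Theta> + Ct * A\<Theta> * (1 + log K (?\<Theta> / ?\<Delta>))
         \<le> (Ct * B + Ct * max 1 (1 / ln K)) * (h ?\<Theta> x y * b ?\<Theta> x * (1 + ln (?\<Theta> / ?\<Delta>)))"
        by (simp add: Z_def A\<Theta>_def)
    qed
    finally show "series x y \<le> ennreal ((Ct * B + Ct * max 1 (1 / ln K)) * (h ?\<Theta> x y * b ?\<Theta> x * (1 + ln (?\<Theta> / ?\<Delta>))))" .
  qed
qed

end

section \<open>From heat kernel bounds to the Green series\<close>

text \<open>
  The order of the heat kernel at times above \<open>\<Phi> (dist x y)\<close>.
\<close>
definition kernel_envelope ::
  "'a::metric_space measure \<Rightarrow> (real \<Rightarrow> real) \<Rightarrow> (real \<Rightarrow> 'a \<Rightarrow> 'a \<Rightarrow> real) \<Rightarrow> real \<Rightarrow> 'a \<Rightarrow> 'a \<Rightarrow> real" where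
  "kernel_envelope m \<Phi> h s x y = h s x y / vol m x (scale_inv \<Phi> s)"

text \<open>
  The common consequence of both heat kernel conditions. The third clause is void for unbounded \<open>D\<close>. The
  lower bound reaches down to \<open>\<Phi> (dist x y) / K\<close>, so that it covers the interval that ends at the
  first grid point.
\<close>
definition kernel_bounds ::
  "'a::metric_space measure \<Rightarrow> 'a set \<Rightarrow> (real \<Rightarrow> real) \<Rightarrow> (real \<Rightarrow> 'a \<Rightarrow> 'a \<Rightarrow> real) \<Rightarrow>
   (real \<Rightarrow> 'a \<Rightarrow> 'a \<Rightarrow> real) \<Rightarrow> real \<Rightarrow> real \<Rightarrow> real \<Rightarrow> real \<Rightarrow> real \<Rightarrow> bool" where
  "kernel_bounds m D \<Phi> h p K \<theta> C c l \<longleftrightarrow>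
     0 < C \<and> 0 < c \<and> 0 < l \<and> (\<forall>x\<in>D. \<forall>y\<in>D. \<forall>s>0. x \<noteq> y \<longrightarrow>
       (s \<le> \<Phi> (dist x y) \<longrightarrow>
          p s x y \<le> C * kernel_envelope m \<Phi> h (\<Phi> (dist x y)) x y * (s / \<Phi> (dist x y)) powr \<theta>) \<and>
       (\<Phi> (dist x y) \<le> s \<longrightarrow> ereal s \<le> scale_diam \<Phi> D \<longrightarrow> p s x y \<le> C * kernel_envelope m \<Phi> h s x y) \<and>
       (scale_diam \<Phi> D < ereal s \<longrightarrow>
          p s x y \<le> C * kernel_envelope m \<Phi> h (\<Phi> (diameter D)) x y * exp (- l * s)) \<and>
       (\<Phi> (dist x y) / K \<le> s \<longrightarrow> ereal s \<le> scale_diam \<Phi> D \<longrightarrow> c * kernel_envelope m \<Phi> h s x y \<le> p s x y))"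

lemma dist_scale_le_scale_diam:
  assumes "scale_function a b \<Phi>" "x \<in> D" "y \<in> D"
  shows "ereal (\<Phi> (dist x y)) \<le> scale_diam \<Phi> D"
  using scale_function_mono[OF assms(1) zero_le_dist] diameter_bounded_bound[OF _ assms(2,3)]
  by (auto simp: scale_diam_def)

lemma kernel_envelope_antimono:
  fixes m :: "'a::{heine_borel, second_countable_topology} measure"
  assumes m: "radon_measure m" "full_support m" and sf: "scale_function a b \<Phi>"
    and bf: "boundary_function \<Phi> D \<gamma> h" and xy: "x \<in> D" "y \<in> D" and st: "0 < s" "s \<le> t"
  shows "kernel_envelope m \<Phi> h t x y \<le> kernel_envelope m \<Phi> h s x y" "0 \<le> kernel_envelope m \<Phi> h s x y"
proof -
  have h: "h t x y \<le> h s x y" "0 \<le> h s x y" using bf xy st by (simp_all add: boundary_function_def)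
  have V: "0 < vol m x (scale_inv \<Phi> s)" using scale_inv_pos[OF sf st(1)] by (intro vol_pos m)
  have VV: "vol m x (scale_inv \<Phi> s) \<le> vol m x (scale_inv \<Phi> t)"
    using scale_inv_mono[OF sf st(2)] by (intro vol_mono m) simp
  show "kernel_envelope m \<Phi> h t x y \<le> kernel_envelope m \<Phi> h s x y"
    unfolding kernel_envelope_def by (rule frac_le[OF h(2,1) V VV])
  show "0 \<le> kernel_envelope m \<Phi> h s x y" unfolding kernel_envelope_def using h V by simp
qed

text \<open>
  The first term of the grid sum controls the times below \<open>\<Phi> (dist x y)\<close>, the last one those
  beyond the scale of the diameter.
\<close>
lemma green_function_comparable_series:
  fixes m :: "'a::{heine_borel, second_countable_topology} measure"
  assumes S: "\<And>x. x \<in> D \<Longrightarrow> subordinator (P (Some x)) S \<nu>" and \<nu>: "levy_measure \<nu>"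
    and m: "radon_measure m" "full_support m" and sf: "scale_function \<alpha>1 \<alpha>2 \<Phi>"
    and bf: "boundary_function \<Phi> D \<gamma> h"
    and \<phi>: "\<And>u. 0 < u \<Longrightarrow> 0 < laplace_exponent \<nu> u"
    and \<phi>_low: "0 < c" "\<And>s t. 0 < s \<Longrightarrow> s \<le> t \<Longrightarrow> ereal t \<le> scale_diam \<Phi> D \<Longrightarrow>
       c * (t / s) powr \<beta> * laplace_exponent \<nu> (1 / t) \<le> laplace_exponent \<nu> (1 / s)"
    and K: "1 < K" "\<And>r. 0 < r \<Longrightarrow> ereal r \<le> scale_diam \<Phi> D \<Longrightarrow>
       24 * laplace_exponent \<nu> (1 / r) \<le> laplace_exponent \<nu> (K / r)"
    and \<theta>: "\<theta> \<le> 0" "0 < \<theta> + \<beta>"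
    and kb: "kernel_bounds m D \<Phi> h p K \<theta> C1 c4 l"
  shows "\<exists>c>0. \<exists>C>0. \<forall>x\<in>D. \<forall>y\<in>D. x \<noteq> y \<longrightarrow>
     ennreal c * scale_series K (\<lambda>t. ereal t \<le> scale_diam \<Phi> D) (\<Phi> (dist x y)) (\<lambda>s. h s x y * green_weight m \<Phi> \<nu> s x)
       \<le> green_function P S p x y \<and>
     green_function P S p x y \<le>
       ennreal C * scale_series K (\<lambda>t. ereal t \<le> scale_diam \<Phi> D) (\<Phi> (dist x y)) (\<lambda>s. h s x y * green_weight m \<Phi> \<nu> s x)"
proof -
  let ?\<Theta> = "\<Phi> (diameter D)" and ?l = "\<lambda>t. laplace_exponent \<nu> (1 / t)" and ?adm = "\<lambda>t. ereal t \<le> scale_diam \<Phi> D"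
  let ?v = "kernel_envelope m \<Phi> h"
  have C1: "0 < C1" and c4: "0 < c4" and l: "0 < l"
    using kb unfolding kernel_bounds_def by simp_all
  have kb_far: "p s x y \<le> C1 * ?v (\<Phi> (dist x y)) x y * (s / \<Phi> (dist x y)) powr \<theta>"
    if "x \<in> D" "y \<in> D" "x \<noteq> y" "0 < s" "s \<le> \<Phi> (dist x y)" for x y s
    using kb that unfolding kernel_bounds_def by simp
  have kb_near: "p s x y \<le> C1 * ?v s x y"
    if "x \<in> D" "y \<in> D" "x \<noteq> y" "0 < s" "\<Phi> (dist x y) \<le> s" "?adm s" for x y s
    using kb that unfolding kernel_bounds_def by simp
  have kb_tail: "p s x y \<le> C1 * ?v ?\<Theta> x y * exp (- l * s)"
    if "x \<in> D" "y \<in> D" "x \<noteq> y" "0 < s" "\<not> ?adm s" for x y s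
    using kb that unfolding kernel_bounds_def by (simp add: not_le)
  have kb_low: "c4 * ?v s x y \<le> p s x y"
    if "x \<in> D" "y \<in> D" "x \<noteq> y" "0 < s" "\<Phi> (dist x y) / K \<le> s" "?adm s" for x y s
    using kb that unfolding kernel_bounds_def by simp
  \<comment> \<open>The exponential tail has potential 1 / laplace_exponent at the rate l; the last grid point lies within a factor K below the top.\<close>
  define C2 where "C2 = (if bounded D \<and> 0 < ?\<Theta> then C1 * K * ?l ?\<Theta> / laplace_exponent \<nu> l else 0)"
  have C2: "0 \<le> C2"
    using C1 K(1) \<phi>[OF l] \<phi>[of "1 / ?\<Theta>"] by (auto simp: C2_def intro!: mult_nonneg_nonneg divide_nonneg_pos less_imp_le)
  define C where "C = C1 * exp 1 * K powr (- \<theta>) / (c * (1 - K powr (- (\<theta> + \<beta>)))) + C1 * exp 1 * K + C2"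
  have "K powr (- (\<theta> + \<beta>)) < 1" using K(1) \<theta> by (intro powr_less_one) auto
  then have C: "0 < C" using C1 C2 K(1) \<phi>_low(1) unfolding C_def by (intro add_pos_nonneg add_nonneg_pos) auto
  have main: "ennreal (c4 / 32) * scale_series K ?adm (\<Phi> (dist x y)) (\<lambda>s. h s x y * green_weight m \<Phi> \<nu> s x)
       \<le> green_function P S p x y \<and>
     green_function P S p x y \<le>
       ennreal C * scale_series K ?adm (\<Phi> (dist x y)) (\<lambda>s. h s x y * green_weight m \<Phi> \<nu> s x)"
    if xy: "x \<in> D" "y \<in> D" "x \<noteq> y" for x y
  proof -
    let ?T = "\<Phi> (dist x y)"
    have T: "0 < ?T" using scale_function_pos[OF sf] xy by simp
    have T_adm: "?adm ?T" by (rule dist_scale_le_scale_diam[OF sf xy(1,2)])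
    have weight: "(\<lambda>s. h s x y * green_weight m \<Phi> \<nu> s x) = (\<lambda>s. ?v s x y / ?l s)"
      by (simp add: green_weight_def kernel_envelope_def)
    note v = kernel_envelope_antimono[OF m sf bf xy(1,2)]
    have adm: "?adm s" if "s \<le> t" "?adm t" for s t
      using that by (meson ereal_less_eq(3) order.trans)
    show ?thesis
      unfolding weight green_function_eq_green_integral
    proof
      show "ennreal (c4 / 32) * scale_series K ?adm ?T (\<lambda>s. ?v s x y / ?l s)
          \<le> green_integral (P (Some x)) S (\<lambda>s. p s x y)"
      proof (rule green_integral_lower_series[OF S[OF xy(1)] K(1) T \<phi> K(2)])
        show "c4 * ?v s x y \<le> p s x y" if s: "?T / K \<le> s" "?adm s" for s
        proof -
          have "0 < ?T / K" using T K(1) by simp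
          then have "0 < s" using s(1) by linarith
          then show ?thesis using kb_low[OF xy _ s] by simp
        qed
      qed (use c4 v adm in auto)
      have tail: "\<exists>e N. 0 \<le> e \<and> ?adm (K ^ N * ?T) \<and>
          e / laplace_exponent \<nu> l \<le> C2 * (?v (K ^ N * ?T) x y / ?l (K ^ N * ?T)) \<and>
          (\<forall>s. 0 < s \<longrightarrow> \<not> ?adm s \<longrightarrow> p s x y \<le> e * exp (- l * s))"
      proof (cases "bounded D")
        case False
        then have all: "?adm s" for s by (simp add: scale_diam_def)
        show ?thesis
          using all C2 v(2)[OF T order.refl] \<phi>[of "1 / ?T"] T by (intro exI[of _ 0]) auto
      next
        case True
        then have adm_iff: "?adm s \<longleftrightarrow> s \<le> ?\<Theta>" for s by (simp add: scale_diam_def)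
        have \<Theta>: "?T \<le> ?\<Theta>" "0 < ?\<Theta>" using T_adm T by (auto simp: adm_iff)
        have "\<exists>n. K ^ n * ?T \<le> ?\<Theta> \<and> ?\<Theta> \<le> K ^ Suc n * ?T"
        proof (cases "?T < ?\<Theta>")
          case True
          then show ?thesis using geometric_interval_above[OF K(1) T] by (meson less_imp_le)
        next
          case False
          then show ?thesis using \<Theta> K(1) T by (intro exI[of _ 0]) auto
        qed
        then obtain N where N: "K ^ N * ?T \<le> ?\<Theta>" "?\<Theta> \<le> K ^ Suc N * ?T" by blast
        define s where "s = K ^ N * ?T"
        have s: "0 < s" "s \<le> ?\<Theta>" "?\<Theta> \<le> K * s" using T K(1) N by (auto simp: s_def mult.assoc)
        define e where "e = C1 * ?v ?\<Theta> x y"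
        have e0: "0 \<le> e" using C1 v(2)[OF \<Theta>(2) order.refl] by (simp add: e_def)
        have "?l s \<le> laplace_exponent \<nu> (K * (1 / ?\<Theta>))"
          using s \<Theta> K(1) by (intro laplace_exponent_mono[OF \<nu>]) (auto simp: field_simps)
        also have "\<dots> \<le> K * ?l ?\<Theta>" using \<Theta> K(1) by (intro laplace_exponent_mult_le[OF \<nu>]) auto
        finally have ls: "?l s \<le> K * ?l ?\<Theta>" .
        have lpos: "0 < ?l s" "0 < ?l ?\<Theta>" "0 < laplace_exponent \<nu> l" using \<phi> s \<Theta> l by auto
        have "e / laplace_exponent \<nu> l \<le> C1 * ?v s x y / laplace_exponent \<nu> l"
          unfolding e_def using v(1)[OF s(1,2)] C1 lpos by (intro divide_right_mono mult_left_mono) auto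
        also have "\<dots> = C1 * ?v s x y / laplace_exponent \<nu> l * 1" by simp
        also have "\<dots> \<le> C1 * ?v s x y / laplace_exponent \<nu> l * (K * ?l ?\<Theta> / ?l s)"
          using ls lpos C1 v(2)[OF s(1) order.refl] by (intro mult_left_mono) auto
        also have "\<dots> = C2 * (?v s x y / ?l s)" using True \<Theta> by (simp add: C2_def)
        finally have "e / laplace_exponent \<nu> l \<le> C2 * (?v s x y / ?l s)" .
        moreover have "p s' x y \<le> e * exp (- l * s')" if "0 < s'" "\<not> ?adm s'" for s'
          using kb_tail[OF xy that] by (simp add: e_def)
        moreover have "?adm s" using s by (simp add: adm_iff)
        ultimately show ?thesis using e0 unfolding s_def by blast
      qed
      then obtain e N where e: "0 \<le> e" "?adm (K ^ N * ?T)"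
        "e / laplace_exponent \<nu> l \<le> C2 * (?v (K ^ N * ?T) x y / ?l (K ^ N * ?T))"
        "\<And>s. 0 < s \<Longrightarrow> \<not> ?adm s \<Longrightarrow> p s x y \<le> e * exp (- l * s)" by blast
      show "green_integral (P (Some x)) S (\<lambda>s. p s x y) \<le> ennreal C * scale_series K ?adm ?T (\<lambda>s. ?v s x y / ?l s)"
        unfolding C_def
      proof (rule green_integral_upper_series[where adm = ?adm and c = c and \<beta> = \<beta> and e = e and u = l and N = N,
            OF S[OF xy(1)] K(1) T T_adm \<nu> \<phi> \<phi>_low(2) \<phi>_low(1) \<theta>])
        show "p s x y \<le> C1 * ?v s x y" if "?T \<le> s" "?adm s" for s
          using kb_near[OF xy _ that] that(1) T by linarith
      qed (use v adm C1 C2 e l kb_far[OF xy] in auto)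
    qed
  qed
  have "0 < c4 / 32" using c4 by simp
  with C main show ?thesis by blast
qed

lemma hk_two_sided_envelope:
  fixes m :: "'a::{heine_borel, second_countable_topology} measure"
  assumes hk: "hk_two_sided m D \<Phi> \<Psi> C0 h p I" and I: "I \<subseteq> {0<..}"
    and m: "radon_measure m" "full_support m" "volume_scaling m R\<^sub>E d1 d2"
    and sf: "scale_function \<alpha>1 \<alpha>2 \<Phi>" "scale_function \<alpha>3 \<alpha>4 \<Psi>" "\<And>r. 0 \<le> r \<Longrightarrow> \<Phi> r \<le> \<Psi> r"
    and bf: "boundary_function \<Phi> D \<gamma> h" and K: "1 < K"
    and \<theta>: "\<theta> \<le> 0" "C0 = 0 \<or> \<theta> \<le> 1 - \<gamma>"
    and L: "\<And>x y. x \<in> D \<Longrightarrow> y \<in> D \<Longrightarrow> dist x y \<le> L \<or> R\<^sub>E = \<infinity>"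
    and dom: "\<And>x y. x \<in> D \<Longrightarrow> y \<in> D \<Longrightarrow> x \<noteq> y \<Longrightarrow> ereal (\<Phi> (dist x y)) < 4 * scale_diam \<Phi> D + 1"
  obtains C c where "0 < C" "0 < c"
    "\<And>x y s. x \<in> D \<Longrightarrow> y \<in> D \<Longrightarrow> s \<in> I \<Longrightarrow> p s x y \<le> C * kernel_envelope m \<Phi> h s x y"
    "\<And>x y s. x \<in> D \<Longrightarrow> y \<in> D \<Longrightarrow> x \<noteq> y \<Longrightarrow> s \<in> I \<Longrightarrow> s \<le> \<Phi> (dist x y) \<Longrightarrow>
       p s x y \<le> C * kernel_envelope m \<Phi> h (\<Phi> (dist x y)) x y * (s / \<Phi> (dist x y)) powr \<theta>"
    "\<And>x y s. x \<in> D \<Longrightarrow> y \<in> D \<Longrightarrow> x \<noteq> y \<Longrightarrow> s \<in> I \<Longrightarrow> \<Phi> (dist x y) / K \<le> s \<Longrightarrow>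
       c * kernel_envelope m \<Phi> h s x y \<le> p s x y"
proof -
  have C0: "C0 \<in> {0, 1}" and C00: "0 \<le> C0" using hk by (auto simp: hk_two_sided_def)
  obtain c1 c2 c3 c4 where c: "0 < c1" "0 < c2" "0 < c3" "0 < c4"
    and p: "\<And>t x y. t \<in> I \<Longrightarrow> x \<in> D \<Longrightarrow> y \<in> D \<Longrightarrow>
       c1 * h t x y * hk_profile m \<Phi> \<Psi> C0 c2 t x y \<le> p t x y \<and>
       p t x y \<le> c3 * h t x y * hk_profile m \<Phi> \<Psi> C0 c4 t x y"
    using hk unfolding hk_two_sided_def by blast
  have vp: "0 < vol m x r" if "0 < r" for x r using vol_pos[OF m(1,2) that] .
  have \<Psi>0: "0 \<le> \<Psi> r" if "0 \<le> r" for r using sf(2) that by (simp add: scale_function_def)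
  obtain k where k: "0 < k" "\<And>x y t. x \<noteq> y \<Longrightarrow> 0 < t \<Longrightarrow> \<Phi> (dist x y) / K \<le> t \<Longrightarrow>
     k / vol m x (scale_inv \<Phi> t) \<le> hk_profile m \<Phi> \<Psi> C0 c2 t x y"
    using hk_profile_lower[where ?C0.0 = C0 and m = m and \<Psi> = \<Psi>, OF sf(1) \<Psi>0 C00 K c(2)] by blast
  obtain A where A: "0 < A" "\<And>x y t. x \<in> D \<Longrightarrow> y \<in> D \<Longrightarrow> x \<noteq> y \<Longrightarrow> 0 < t \<Longrightarrow> t \<le> \<Phi> (dist x y) \<Longrightarrow>
     h t x y * hk_profile m \<Phi> \<Psi> C0 c4 t x y
       \<le> A * (h (\<Phi> (dist x y)) x y / vol m x (scale_inv \<Phi> (\<Phi> (dist x y)))) * (t / \<Phi> (dist x y)) powr \<theta>"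
    using hk_profile_far[where \<Psi> = \<Psi> and m = m, OF sf(1,3) vp m(3) bf c(4) C0 L dom \<theta>] by blast
  have pos: "0 < s" if "s \<in> I" for s using I that by auto
  have h0: "0 \<le> h t x y" if "t \<in> I" "x \<in> D" "y \<in> D" for t x y
    using bf that pos by (simp add: boundary_function_def)
  have v0: "0 \<le> kernel_envelope m \<Phi> h s x y" if "x \<in> D" "y \<in> D" "0 < s" for x y s
    by (rule kernel_envelope_antimono(2)[OF m(1,2) sf(1) bf that order.refl])
  define B where "B = max c3 (c3 * A)"
  show thesis
  proof (rule that[of B "c1 * k"])
    show "0 < B" "0 < c1 * k" using c k by (auto simp: B_def less_max_iff_disj)
    show "p s x y \<le> B * kernel_envelope m \<Phi> h s x y" if "x \<in> D" "y \<in> D" "s \<in> I" for x y s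
    proof -
      have "p s x y \<le> c3 * (h s x y * hk_profile m \<Phi> \<Psi> C0 c4 s x y)"
        using p[OF that(3,1,2)] by (simp add: mult.assoc)
      also have "\<dots> \<le> c3 * (h s x y * (1 / vol m x (scale_inv \<Phi> s)))"
        using c h0[OF that(3,1,2)] by (intro mult_left_mono hk_profile_upper) auto
      also have "\<dots> = c3 * kernel_envelope m \<Phi> h s x y" by (simp add: kernel_envelope_def)
      also have "\<dots> \<le> B * kernel_envelope m \<Phi> h s x y"
        using v0[OF that(1,2) pos[OF that(3)]] by (intro mult_right_mono) (auto simp: B_def)
      finally show ?thesis .
    qed
    show "p s x y \<le> B * kernel_envelope m \<Phi> h (\<Phi> (dist x y)) x y * (s / \<Phi> (dist x y)) powr \<theta>"
      if "x \<in> D" "y \<in> D" "x \<noteq> y" "s \<in> I" "s \<le> \<Phi> (dist x y)" for x y s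
    proof -
      have T: "0 < \<Phi> (dist x y)" using scale_function_pos[OF sf(1)] that by simp
      have "p s x y \<le> c3 * (h s x y * hk_profile m \<Phi> \<Psi> C0 c4 s x y)"
        using p[OF that(4,1,2)] by (simp add: mult.assoc)
      also have "\<dots> \<le> c3 * (A * (h (\<Phi> (dist x y)) x y / vol m x (scale_inv \<Phi> (\<Phi> (dist x y)))) * (s / \<Phi> (dist x y)) powr \<theta>)"
        using c that pos by (intro mult_left_mono A) auto
      also have "\<dots> = c3 * A * kernel_envelope m \<Phi> h (\<Phi> (dist x y)) x y * (s / \<Phi> (dist x y)) powr \<theta>"
        by (simp add: kernel_envelope_def mult_ac)
      also have "\<dots> \<le> B * kernel_envelope m \<Phi> h (\<Phi> (dist x y)) x y * (s / \<Phi> (dist x y)) powr \<theta>"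
        using v0[OF that(1,2) T] by (intro mult_right_mono) (auto simp: B_def)
      finally show ?thesis .
    qed
    show "c1 * k * kernel_envelope m \<Phi> h s x y \<le> p s x y"
      if "x \<in> D" "y \<in> D" "x \<noteq> y" "s \<in> I" "\<Phi> (dist x y) / K \<le> s" for x y s
    proof -
      have "c1 * h s x y * (k / vol m x (scale_inv \<Phi> s)) \<le> c1 * h s x y * hk_profile m \<Phi> \<Psi> C0 c2 s x y"
        using c h0[OF that(4,1,2)] pos[OF that(4)] that by (intro mult_left_mono k) auto
      also have "\<dots> \<le> p s x y" using p that by blast
      finally show ?thesis by (simp add: kernel_envelope_def mult_ac)
    qed
  qed
qed

lemma kernel_bounds_unbounded:
  fixes m :: "'a::{heine_borel, second_countable_topology} measure"
  assumes hk: "HK_U m R\<^sub>E D \<Phi> \<Psi> C0 h p"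
    and m: "radon_measure m" "full_support m" "volume_scaling m R\<^sub>E d1 d2"
    and sf: "scale_function \<alpha>1 \<alpha>2 \<Phi>" "scale_function \<alpha>3 \<alpha>4 \<Psi>" "\<And>r. 0 \<le> r \<Longrightarrow> \<Phi> r \<le> \<Psi> r"
    and bf: "boundary_function \<Phi> D \<gamma> h" and K: "1 < K"
    and \<theta>: "\<theta> \<le> 0" "C0 = 0 \<or> \<theta> \<le> 1 - \<gamma>"
  shows "\<exists>C c l. kernel_bounds m D \<Phi> h p K \<theta> C c l"
proof -
  have hk2: "hk_two_sided m D \<Phi> \<Psi> C0 h p {0<..}" and RE: "R\<^sub>E = \<infinity>" and sd: "scale_diam \<Phi> D = \<infinity>"
    using hk by (auto simp: HK_U_def scale_diam_def)
  have L: "dist x y \<le> 0 \<or> R\<^sub>E = \<infinity>" for x y :: 'a using RE by simp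
  have dom: "ereal (\<Phi> (dist x y)) < 4 * scale_diam \<Phi> D + 1" for x y using sd by simp
  obtain C c where C: "0 < C" and c: "0 < c"
    and near: "\<And>x y s. x \<in> D \<Longrightarrow> y \<in> D \<Longrightarrow> s \<in> {0<..} \<Longrightarrow> p s x y \<le> C * kernel_envelope m \<Phi> h s x y"
    and far: "\<And>x y s. x \<in> D \<Longrightarrow> y \<in> D \<Longrightarrow> x \<noteq> y \<Longrightarrow> s \<in> {0<..} \<Longrightarrow> s \<le> \<Phi> (dist x y) \<Longrightarrow>
       p s x y \<le> C * kernel_envelope m \<Phi> h (\<Phi> (dist x y)) x y * (s / \<Phi> (dist x y)) powr \<theta>"
    and low: "\<And>x y s. x \<in> D \<Longrightarrow> y \<in> D \<Longrightarrow> x \<noteq> y \<Longrightarrow> s \<in> {0<..} \<Longrightarrow> \<Phi> (dist x y) / K \<le> s \<Longrightarrow>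
       c * kernel_envelope m \<Phi> h s x y \<le> p s x y"
    using hk_two_sided_envelope[OF hk2 order.refl m sf bf K \<theta> L dom] by blast
  have "kernel_bounds m D \<Phi> h p K \<theta> C c 1"
    unfolding kernel_bounds_def sd using near far low C c by simp
  then show ?thesis by blast
qed

text \<open>
  The profile is only given up to time 1, the exponential decay only from time 1 on, whereas the two regimes
  should meet at the scale \<open>\<Theta>\<close> of the diameter. Between 1 and \<open>\<Theta>\<close>, in either order, the
  boundary function, the volumes and the exponential change by bounded factors, uniformly over the bounded set.
\<close>
lemma kernel_bounds_bounded:
  fixes m :: "'a::{heine_borel, second_countable_topology} measure"
  assumes hk: "HK_B m D \<Phi> \<Psi> C0 h p"
    and m: "radon_measure m" "full_support m" "volume_scaling m R\<^sub>E d1 d2"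
    and sf: "scale_function \<alpha>1 \<alpha>2 \<Phi>" "scale_function \<alpha>3 \<alpha>4 \<Psi>" "\<And>r. 0 \<le> r \<Longrightarrow> \<Phi> r \<le> \<Psi> r"
    and bf: "boundary_function \<Phi> D \<gamma> h" and K: "1 < K"
    and \<theta>: "\<theta> \<le> 0" "C0 = 0 \<or> \<theta> \<le> 1 - \<gamma>"
  shows "\<exists>C c l. kernel_bounds m D \<Phi> h p K \<theta> C c l"
proof (cases "\<exists>x\<in>D. \<exists>y\<in>D. x \<noteq> y")
  case False
  then have "kernel_bounds m D \<Phi> h p K \<theta> 1 1 1" unfolding kernel_bounds_def by auto
  then show ?thesis by blast
next
  case True
  have bd: "bounded D" and hk2: "hk_two_sided m D \<Phi> \<Psi> C0 h p {0<..1}"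
    using hk by (auto simp: HK_B_def)
  define \<Theta> where "\<Theta> = \<Phi> (diameter D)"
  have sd: "scale_diam \<Phi> D = ereal \<Theta>" using bd by (simp add: scale_diam_def \<Theta>_def)
  have dd: "dist x y \<le> diameter D" if "x \<in> D" "y \<in> D" for x y
    using diameter_bounded_bound[OF bd that] .
  have "D \<noteq> {}" using True by auto
  have diam: "0 < diameter D"
  proof -
    obtain x y where "x \<in> D" "y \<in> D" "x \<noteq> y" using True by blast
    then show ?thesis using dd[of x y] zero_less_dist_iff[of x y] by linarith
  qed
  have \<Theta>: "0 < \<Theta>" unfolding \<Theta>_def by (rule scale_function_pos[OF sf(1) diam])
  have T\<Theta>: "\<Phi> (dist x y) \<le> \<Theta>" if "x \<in> D" "y \<in> D" for x y
    unfolding \<Theta>_def by (rule scale_function_mono[OF sf(1) zero_le_dist dd[OF that]])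
  have four: "ereal t < 4 * scale_diam \<Phi> D + 1" if "t \<le> max 1 \<Theta>" for t
    using that \<Theta> by (auto simp: sd one_ereal_def)
  have L: "dist x y \<le> diameter D \<or> R\<^sub>E = \<infinity>" if "x \<in> D" "y \<in> D" for x y using dd[OF that] by simp
  have dom: "ereal (\<Phi> (dist x y)) < 4 * scale_diam \<Phi> D + 1" if "x \<in> D" "y \<in> D" "x \<noteq> y" for x y
    using T\<Theta>[OF that(1,2)] by (intro four) simp
  obtain C c where C: "0 < C" and c: "0 < c"
    and near: "\<And>x y s. x \<in> D \<Longrightarrow> y \<in> D \<Longrightarrow> s \<in> {0<..1} \<Longrightarrow> p s x y \<le> C * kernel_envelope m \<Phi> h s x y"
    and far: "\<And>x y s. x \<in> D \<Longrightarrow> y \<in> D \<Longrightarrow> x \<noteq> y \<Longrightarrow> s \<in> {0<..1} \<Longrightarrow> s \<le> \<Phi> (dist x y) \<Longrightarrow>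
       p s x y \<le> C * kernel_envelope m \<Phi> h (\<Phi> (dist x y)) x y * (s / \<Phi> (dist x y)) powr \<theta>"
    and low: "\<And>x y s. x \<in> D \<Longrightarrow> y \<in> D \<Longrightarrow> x \<noteq> y \<Longrightarrow> s \<in> {0<..1} \<Longrightarrow> \<Phi> (dist x y) / K \<le> s \<Longrightarrow>
       c * kernel_envelope m \<Phi> h s x y \<le> p s x y"
  proof (rule hk_two_sided_envelope[OF hk2 _ m sf bf K \<theta> L dom])
    show "{0<..1} \<subseteq> {0::real<..}" by auto
  qed blast+
  obtain l c1 c2 where l: "0 < l" and c12: "0 < c1" "0 < c2"
    and large: "\<And>t x y. 1 \<le> t \<Longrightarrow> x \<in> D \<Longrightarrow> y \<in> D \<Longrightarrow>
        c1 * (exp (- l * t) * h 1 x y) \<le> p t x y \<and> p t x y \<le> c2 * (exp (- l * t) * h 1 x y)"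
    using hk unfolding HK_B_def by blast
  obtain Ch where Ch: "1 \<le> Ch" "\<And>x y s t. x \<in> D \<Longrightarrow> y \<in> D \<Longrightarrow> 0 < s \<Longrightarrow> s \<le> t \<Longrightarrow> ereal t < 4 * scale_diam \<Phi> D + 1 \<Longrightarrow>
      h s x y \<le> Ch * (t / s) powr \<gamma> * h t x y"
    using boundary_function_doubling[OF bf] by blast
  have \<gamma>: "0 \<le> \<gamma>" using bf by (simp add: boundary_function_def)
  have h0: "0 \<le> h t x y" if "0 < t" "x \<in> D" "y \<in> D" for t x y
    using bf that by (simp add: boundary_function_def)
  have hmono: "h t x y \<le> h s x y" if "0 < s" "s \<le> t" "x \<in> D" "y \<in> D" for s t x y
    using bf that by (simp add: boundary_function_def)
  define s0 s1 where "s0 = min 1 \<Theta>" and "s1 = max 1 \<Theta>"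
  have s01: "0 < s0" "s0 \<le> 1" "s0 \<le> \<Theta>" "1 \<le> s1" "\<Theta> \<le> s1" using \<Theta> by (auto simp: s0_def s1_def)
  have s0s1: "s0 \<le> s1" using s01 by simp
  obtain a A where a: "0 < a" "0 < A" and vol: "\<And>x r. x \<in> D \<Longrightarrow> scale_inv \<Phi> s0 \<le> r \<Longrightarrow> r \<le> scale_inv \<Phi> s1 \<Longrightarrow>
      a \<le> vol m x r \<and> vol m x r \<le> A"
    using vol_bounded_set[OF m bd \<open>D \<noteq> {}\<close> scale_inv_pos[OF sf(1) s01(1)] scale_inv_mono[OF sf(1) s0s1]]
    by blast
  have V: "a \<le> vol m x (scale_inv \<Phi> s)" "vol m x (scale_inv \<Phi> s) \<le> A" if "x \<in> D" "s0 \<le> s" "s \<le> s1" for x s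
    using vol[OF that(1)] scale_inv_mono[OF sf(1) that(2)] scale_inv_mono[OF sf(1) that(3)] by auto
  have h_comp: "h s x y \<le> Ch * s1 powr \<gamma> * h t x y" if "x \<in> D" "y \<in> D" "1 \<le> s" "s \<le> t" "t \<le> s1" for s t x y
  proof -
    have "h s x y \<le> Ch * (t / s) powr \<gamma> * h t x y"
      using that four[of t] s1_def by (intro Ch) auto
    also have "\<dots> \<le> Ch * s1 powr \<gamma> * h t x y"
    proof (intro mult_right_mono mult_left_mono powr_mono2)
      have "t / s \<le> t / 1" using that by (intro divide_left_mono) auto
      then show "t / s \<le> s1" using that by simp
    qed (use Ch \<gamma> that h0 in auto)
    finally show ?thesis .
  qed
  have hv: "h s x y \<le> A * kernel_envelope m \<Phi> h s x y" "kernel_envelope m \<Phi> h s x y \<le> h s x y / a"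
    if "x \<in> D" "y \<in> D" "s0 \<le> s" "s \<le> s1" for s x y
  proof -
    have s: "0 < s" using that s01 by simp
    have vp: "0 < vol m x (scale_inv \<Phi> s)" using V(1)[OF that(1,3,4)] a by simp
    have "h s x y * vol m x (scale_inv \<Phi> s) \<le> h s x y * A"
      using V(2)[OF that(1,3,4)] h0[OF s that(1,2)] by (intro mult_left_mono) auto
    then show "h s x y \<le> A * kernel_envelope m \<Phi> h s x y"
      using vp by (simp add: kernel_envelope_def pos_le_divide_eq mult.commute)
    show "kernel_envelope m \<Phi> h s x y \<le> h s x y / a"
      unfolding kernel_envelope_def using V(1)[OF that(1,3,4)] a h0[OF s that(1,2)] vp
      by (intro divide_left_mono mult_pos_pos) auto
  qed
  define E where "E = Ch * s1 powr \<gamma>"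
  have E: "1 \<le> E" using Ch(1) s01 \<gamma> mult_mono[OF Ch(1) ge_one_powr_ge_zero[of s1 \<gamma>]] by (simp add: E_def)
  have v0: "0 \<le> kernel_envelope m \<Phi> h s x y" if "x \<in> D" "y \<in> D" "0 < s" for x y s
    by (rule kernel_envelope_antimono(2)[OF m(1,2) sf(1) bf that order.refl])
  have mid_up: "p s x y \<le> c2 * E * A * kernel_envelope m \<Phi> h t x y"
    if "x \<in> D" "y \<in> D" "1 \<le> s" "s \<le> t" "t \<le> \<Theta>" for s t x y
  proof -
    have "p s x y \<le> c2 * (exp (- l * s) * h 1 x y)" using large that by blast
    also have "\<dots> \<le> c2 * (1 * (E * h t x y))"
      unfolding E_def using that l c12 h_comp[of x y 1 t] h0[of 1 x y] s01 by (intro mult_left_mono mult_mono) auto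
    also have "\<dots> \<le> c2 * (1 * (E * (A * kernel_envelope m \<Phi> h t x y)))"
      using hv(1)[of x y t] that s01 E c12 by (intro mult_left_mono) auto
    finally show ?thesis by (simp add: mult_ac)
  qed
  have mid_low: "c1 * exp (- l * \<Theta>) * a * kernel_envelope m \<Phi> h s x y \<le> p s x y"
    if "x \<in> D" "y \<in> D" "1 \<le> s" "s \<le> \<Theta>" for s x y
  proof -
    have "a * kernel_envelope m \<Phi> h s x y \<le> h s x y" using hv(2)[of x y s] that s01 a by (simp add: pos_le_divide_eq mult.commute)
    also have "\<dots> \<le> h 1 x y" using hmono[of 1 s] that by simp
    finally have "exp (- l * \<Theta>) * (a * kernel_envelope m \<Phi> h s x y) \<le> exp (- l * s) * h 1 x y"
      using that l a v0[of x y s] by (intro mult_mono) auto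
    then have "c1 * (exp (- l * \<Theta>) * (a * kernel_envelope m \<Phi> h s x y)) \<le> c1 * (exp (- l * s) * h 1 x y)"
      using c12 by (intro mult_left_mono) auto
    also have "\<dots> \<le> p s x y" using large that by blast
    finally show ?thesis by (simp add: mult_ac)
  qed
  have tail: "p s x y \<le> max (c2 * E * A) (C * exp l) * kernel_envelope m \<Phi> h \<Theta> x y * exp (- l * s)"
    if "x \<in> D" "y \<in> D" "\<Theta> < s" for s x y
  proof (cases "1 \<le> s")
    case True
    have "h 1 x y \<le> E * h \<Theta> x y"
    proof (cases "\<Theta> \<le> 1")
      case True
      have "h 1 x y \<le> 1 * h \<Theta> x y" using hmono[OF \<Theta> True that(1,2)] by simp
      also have "\<dots> \<le> E * h \<Theta> x y" using E h0[OF \<Theta> that(1,2)] by (intro mult_right_mono) auto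
      finally show ?thesis .
    next
      case False
      then show ?thesis using h_comp[OF that(1,2), of 1 \<Theta>] s01 by (simp add: E_def)
    qed
    also have "\<dots> \<le> E * (A * kernel_envelope m \<Phi> h \<Theta> x y)"
      using hv(1)[OF that(1,2) s01(3,5)] E by (intro mult_left_mono) auto
    finally have "c2 * (exp (- l * s) * h 1 x y) \<le> c2 * (exp (- l * s) * (E * (A * kernel_envelope m \<Phi> h \<Theta> x y)))"
      using c12 by (intro mult_left_mono) auto
    moreover have "p s x y \<le> c2 * (exp (- l * s) * h 1 x y)" using large True that by blast
    ultimately have "p s x y \<le> (c2 * E * A) * (kernel_envelope m \<Phi> h \<Theta> x y * exp (- l * s))" by (simp add: mult_ac)
    also have "\<dots> \<le> max (c2 * E * A) (C * exp l) * (kernel_envelope m \<Phi> h \<Theta> x y * exp (- l * s))"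
      using v0[OF that(1,2) \<Theta>] by (intro mult_right_mono) auto
    finally show ?thesis by (simp add: mult.assoc)
  next
    case False
    then have s: "s \<in> {0<..1}" using that \<Theta> by auto
    have "p s x y \<le> C * kernel_envelope m \<Phi> h s x y" by (rule near[OF that(1,2) s])
    also have "\<dots> \<le> C * kernel_envelope m \<Phi> h \<Theta> x y"
      using C kernel_envelope_antimono(1)[OF m(1,2) sf(1) bf that(1,2) \<Theta>, of s] that by (intro mult_left_mono) auto
    also have "\<dots> \<le> C * kernel_envelope m \<Phi> h \<Theta> x y * (exp l * exp (- l * s))"
    proof -
      have "1 \<le> exp l * exp (- l * s)" using False l by (simp flip: exp_add)
      then show ?thesis using mult_left_mono[of 1 _ "C * kernel_envelope m \<Phi> h \<Theta> x y"] C v0[OF that(1,2) \<Theta>] by simp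
    qed
    also have "\<dots> = (C * exp l) * (kernel_envelope m \<Phi> h \<Theta> x y * exp (- l * s))" by (simp add: mult_ac)
    also have "\<dots> \<le> max (c2 * E * A) (C * exp l) * (kernel_envelope m \<Phi> h \<Theta> x y * exp (- l * s))"
      using v0[OF that(1,2) \<Theta>] by (intro mult_right_mono) auto
    finally show ?thesis by (simp add: mult.assoc)
  qed
  define B where "B = max C (max (c2 * E * A) (C * exp l))"
  define b where "b = min c (c1 * exp (- l * \<Theta>) * a)"
  have B: "C \<le> B" "c2 * E * A \<le> B" "max (c2 * E * A) (C * exp l) \<le> B" "0 < B" using C by (auto simp: B_def)
  have b: "0 < b" "b \<le> c" "b \<le> c1 * exp (- l * \<Theta>) * a" using c c12 a by (auto simp: b_def)
  have "kernel_bounds m D \<Phi> h p K \<theta> B b l"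
    unfolding kernel_bounds_def sd \<Theta>_def[symmetric]
  proof (intro conjI ballI allI impI)
    fix x y and s :: real assume xy: "x \<in> D" "y \<in> D" "x \<noteq> y" and s: "0 < s"
    let ?T = "\<Phi> (dist x y)"
    have T: "0 < ?T" using scale_function_pos[OF sf(1)] xy by simp
    note v = v0[OF xy(1,2)]
    show "p s x y \<le> B * kernel_envelope m \<Phi> h ?T x y * (s / ?T) powr \<theta>" if sT: "s \<le> ?T"
    proof (cases "s \<le> 1")
      case True
      have "p s x y \<le> C * kernel_envelope m \<Phi> h ?T x y * (s / ?T) powr \<theta>" using far[OF xy _ sT] s True by simp
      also have "\<dots> \<le> B * kernel_envelope m \<Phi> h ?T x y * (s / ?T) powr \<theta>"
        using B v[OF T] by (intro mult_right_mono) auto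
      finally show ?thesis .
    next
      case False
      have "p s x y \<le> c2 * E * A * kernel_envelope m \<Phi> h ?T x y"
        using mid_up[OF xy(1,2) _ sT T\<Theta>[OF xy(1,2)]] False by simp
      also have "\<dots> \<le> B * kernel_envelope m \<Phi> h ?T x y" using B v[OF T] by (intro mult_right_mono) auto
      also have "\<dots> \<le> B * kernel_envelope m \<Phi> h ?T x y * (s / ?T) powr \<theta>"
      proof -
        have "1 \<le> (s / ?T) powr \<theta>" using powr_mono'[of \<theta> 0 "s / ?T"] \<theta> s sT T by simp
        then show ?thesis using mult_left_mono[of 1 _ "B * kernel_envelope m \<Phi> h ?T x y"] B v[OF T] by simp
      qed
      finally show ?thesis .
    qed
    show "p s x y \<le> B * kernel_envelope m \<Phi> h s x y" if "?T \<le> s" "ereal s \<le> ereal \<Theta>"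
    proof -
      have "p s x y \<le> max C (c2 * E * A) * kernel_envelope m \<Phi> h s x y"
      proof (cases "s \<le> 1")
        case True
        have "p s x y \<le> C * kernel_envelope m \<Phi> h s x y" using near[OF xy(1,2)] s True by simp
        also have "\<dots> \<le> max C (c2 * E * A) * kernel_envelope m \<Phi> h s x y" using v[OF s] by (intro mult_right_mono) auto
        finally show ?thesis .
      next
        case False
        have "p s x y \<le> c2 * E * A * kernel_envelope m \<Phi> h s x y" using mid_up[OF xy(1,2) _ order.refl] False that by simp
        also have "\<dots> \<le> max C (c2 * E * A) * kernel_envelope m \<Phi> h s x y" using v[OF s] by (intro mult_right_mono) auto
        finally show ?thesis .
      qed
      also have "\<dots> \<le> B * kernel_envelope m \<Phi> h s x y" using B v[OF s] by (intro mult_right_mono) auto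
      finally show ?thesis .
    qed
    show "p s x y \<le> B * kernel_envelope m \<Phi> h \<Theta> x y * exp (- l * s)" if "ereal \<Theta> < ereal s"
    proof -
      have "p s x y \<le> max (c2 * E * A) (C * exp l) * kernel_envelope m \<Phi> h \<Theta> x y * exp (- l * s)"
        using tail[OF xy(1,2)] that by simp
      also have "\<dots> \<le> B * kernel_envelope m \<Phi> h \<Theta> x y * exp (- l * s)"
        using B v[OF \<Theta>] by (intro mult_right_mono) auto
      finally show ?thesis .
    qed
    show "b * kernel_envelope m \<Phi> h s x y \<le> p s x y" if "?T / K \<le> s" "ereal s \<le> ereal \<Theta>"
    proof (cases "s \<le> 1")
      case True
      have "b * kernel_envelope m \<Phi> h s x y \<le> c * kernel_envelope m \<Phi> h s x y" using b v[OF s] by (intro mult_right_mono) auto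
      also have "\<dots> \<le> p s x y" using low[OF xy _ that(1)] s True by simp
      finally show ?thesis .
    next
      case False
      have "b * kernel_envelope m \<Phi> h s x y \<le> c1 * exp (- l * \<Theta>) * a * kernel_envelope m \<Phi> h s x y"
        using b v[OF s] by (intro mult_right_mono) auto
      also have "\<dots> \<le> p s x y" using mid_low[OF xy(1,2)] that False by simp
      finally show ?thesis .
    qed
  qed (use B b l in auto)
  then show ?thesis by blast
qed

section \<open>Green function estimates\<close>

lemma green_weight_bounds:
  fixes m :: "'a::{heine_borel, second_countable_topology} measure"
  assumes m: "radon_measure m" "full_support m" "volume_scaling m R\<^sub>E d1 d2"
    and sf: "scale_function \<alpha>1 \<alpha>2 \<Phi>" and \<nu>: "levy_measure \<nu>"
    and \<phi>: "\<And>u. 0 < u \<Longrightarrow> 0 < laplace_exponent \<nu> u"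
    and D: "bounded D" and s: "0 < s0" "s0 \<le> s1"
  shows "\<exists>c>0. \<exists>C>0. \<forall>x\<in>D. \<forall>s. s0 \<le> s \<longrightarrow> s \<le> s1 \<longrightarrow>
    c \<le> green_weight m \<Phi> \<nu> s x \<and> green_weight m \<Phi> \<nu> s x \<le> C"
proof (cases "D = {}")
  case True
  then show ?thesis by (intro exI[of _ 1] conjI) auto
next
  case False
  obtain a A where a: "0 < a" "0 < A" and vol: "\<And>x r. x \<in> D \<Longrightarrow> scale_inv \<Phi> s0 \<le> r \<Longrightarrow> r \<le> scale_inv \<Phi> s1 \<Longrightarrow>
      a \<le> vol m x r \<and> vol m x r \<le> A"
    using vol_bounded_set[OF m D False scale_inv_pos[OF sf s(1)] scale_inv_mono[OF sf s(2)]] by blast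
  let ?l = "\<lambda>s. laplace_exponent \<nu> (1 / s)"
  have "1 / (A * ?l s0) \<le> green_weight m \<Phi> \<nu> s x \<and> green_weight m \<Phi> \<nu> s x \<le> 1 / (a * ?l s1)"
    if x: "x \<in> D" and t: "s0 \<le> s" "s \<le> s1" for x s
  proof -
    have V: "a \<le> vol m x (scale_inv \<Phi> s)" "vol m x (scale_inv \<Phi> s) \<le> A"
      using vol[OF x scale_inv_mono[OF sf t(1)] scale_inv_mono[OF sf t(2)]] by auto
    have l: "?l s \<le> ?l s0" "?l s1 \<le> ?l s"
      using s t by (auto intro!: laplace_exponent_mono[OF \<nu>] divide_left_mono)
    have lp: "0 < ?l s0" "0 < ?l s1" "0 < ?l s" using \<phi> s t by auto
    have "vol m x (scale_inv \<Phi> s) * ?l s \<le> A * ?l s0" "a * ?l s1 \<le> vol m x (scale_inv \<Phi> s) * ?l s"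
      using V l lp a by (auto intro!: mult_mono)
    moreover have "0 < vol m x (scale_inv \<Phi> s) * ?l s" "0 < a * ?l s1" using V lp a by auto
    ultimately show ?thesis unfolding green_weight_def by (auto intro!: divide_left_mono)
  qed
  moreover have "0 < 1 / (A * ?l s0)" "0 < 1 / (a * ?l s1)" using a \<phi> s by auto
  ultimately show ?thesis by blast
qed

text \<open>
  With vanishing exponents the weight is comparable over all scales for each point separately. For different
  points it is compared at the scale of their distance: balls with radius above the distance of their centres
  have comparable volumes.
\<close>
lemma green_weight_uniform:
  fixes m :: "'a::{heine_borel, second_countable_topology} measure"
  assumes m: "radon_measure m" "full_support m" "volume_scaling m R\<^sub>E d1 d2"
    and sf: "scale_function \<alpha>1 \<alpha>2 \<Phi>" and \<nu>: "levy_measure \<nu>"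
    and \<phi>: "\<And>u. 0 < u \<Longrightarrow> 0 < laplace_exponent \<nu> u"
    and D: "bounded D \<or> R\<^sub>E = \<infinity>"
    and c: "0 < c" "0 < C" "\<And>x s t. x \<in> D \<Longrightarrow> 0 < s \<Longrightarrow> s \<le> t \<Longrightarrow> ereal t \<le> scale_diam \<Phi> D \<Longrightarrow>
       c * green_weight m \<Phi> \<nu> s x \<le> green_weight m \<Phi> \<nu> t x \<and> green_weight m \<Phi> \<nu> t x \<le> C * green_weight m \<Phi> \<nu> s x"
  shows "\<exists>cb>0. \<exists>Cb. \<forall>x\<in>D. \<forall>s>0. ereal s \<le> scale_diam \<Phi> D \<longrightarrow>
    cb \<le> green_weight m \<Phi> \<nu> s x \<and> green_weight m \<Phi> \<nu> s x \<le> Cb"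
proof (cases "bounded D")
  case True
  let ?b = "\<lambda>s x. green_weight m \<Phi> \<nu> s x" and ?\<Theta> = "\<Phi> (diameter D)"
  have adm_iff: "ereal s \<le> scale_diam \<Phi> D \<longleftrightarrow> s \<le> ?\<Theta>" for s using True by (simp add: scale_diam_def)
  show ?thesis
  proof (cases "0 < ?\<Theta>")
    case False
    then show ?thesis by (intro exI[of _ 1] conjI) (auto simp: adm_iff)
  next
    case pos: True
    obtain a A where a: "0 < a" "0 < A" "\<And>x. x \<in> D \<Longrightarrow> a \<le> ?b ?\<Theta> x \<and> ?b ?\<Theta> x \<le> A"
      using green_weight_bounds[OF m sf \<nu> \<phi> True pos order.refl] by blast
    have "a / C \<le> ?b s x \<and> ?b s x \<le> A / c" if "x \<in> D" "0 < s" "s \<le> ?\<Theta>" for x s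
      using c(3)[OF that(1,2,3)] a(3)[OF that(1)] c(1,2)
      by (simp add: adm_iff pos_divide_le_eq pos_le_divide_eq mult.commute)
    moreover have "0 < a / C" using a c by simp
    ultimately show ?thesis unfolding adm_iff by blast
  qed
next
  case unb: False
  then have RE: "R\<^sub>E = \<infinity>" using D by simp
  have adm: "ereal s \<le> scale_diam \<Phi> D" for s using unb by (simp add: scale_diam_def)
  let ?b = "\<lambda>s x. green_weight m \<Phi> \<nu> s x"
  obtain x0 where x0: "x0 \<in> D" using unb by (metis bounded_empty ex_in_conv)
  obtain A where A: "1 \<le> A" "\<And>x r R. 0 < r \<Longrightarrow> r \<le> R \<Longrightarrow> R \<le> 0 \<or> R\<^sub>E = \<infinity> \<Longrightarrow>
    (R / r) powr d1 / A \<le> vol m x R / vol m x r \<and> vol m x R / vol m x r \<le> A * (R / r) powr d2"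
    using volume_scaling_up_to[OF m(3), of 0] by blast
  define M where "M = A * 2 powr d2"
  have M: "0 < M" using A(1) by (simp add: M_def)
  have swap: "?b t y \<le> M * ?b t x" if "0 < t" "dist x y \<le> scale_inv \<Phi> t" for t x y
  proof -
    let ?r = "scale_inv \<Phi> t"
    have r: "0 < ?r" by (rule scale_inv_pos[OF sf that(1)])
    have V: "0 < vol m x ?r" "0 < vol m y ?r" by (intro vol_pos m r)+
    have l: "0 < laplace_exponent \<nu> (1 / t)" using \<phi> that by simp
    have "vol m x ?r \<le> vol m y (2 * ?r)" using that(2) by (intro vol_mono m) simp
    also have "\<dots> \<le> M * vol m y ?r"
      using A(2)[of ?r "2 * ?r" y] RE r V by (simp add: M_def pos_divide_le_eq)
    finally show ?thesis
      unfolding green_weight_def using V l M by (simp add: field_simps)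
  qed
  have bounds: "c * ?b 1 x0 / (C * M) \<le> ?b s x \<and> ?b s x \<le> M * C * ?b 1 x0 / c" if x: "x \<in> D" and s: "0 < s" for x s
  proof -
    define t where "t = max (max s 1) (\<Phi> (dist x x0))"
    have t: "0 < t" "s \<le> t" "1 \<le> t" using s by (auto simp: t_def)
    have "scale_inv \<Phi> (\<Phi> (dist x x0)) \<le> scale_inv \<Phi> t" by (intro scale_inv_mono[OF sf]) (simp add: t_def)
    then have d: "dist x x0 \<le> scale_inv \<Phi> t" "dist x0 x \<le> scale_inv \<Phi> t"
      using scale_inv_scale[OF sf, of "dist x x0"] by (auto simp: dist_commute)
    have 1: "c * ?b s x \<le> ?b t x" "?b t x \<le> C * ?b s x" using c(3)[OF x s t(2) adm] by auto
    have 2: "c * ?b 1 x0 \<le> ?b t x0" "?b t x0 \<le> C * ?b 1 x0" using c(3)[OF x0 _ t(3) adm] by auto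
    note 3 = swap[OF t(1) d(1)] swap[OF t(1) d(2)]
    have "c * ?b 1 x0 \<le> M * ?b t x" using 2 3 by linarith
    also have "\<dots> \<le> M * (C * ?b s x)" using 1 M by (intro mult_left_mono) auto
    finally have 4: "c * ?b 1 x0 / (C * M) \<le> ?b s x" using c M by (simp add: pos_divide_le_eq mult_ac)
    have "c * ?b s x \<le> M * ?b t x0" using 1 3 by linarith
    also have "\<dots> \<le> M * (C * ?b 1 x0)" using 2 M by (intro mult_left_mono) auto
    finally have "?b s x \<le> M * C * ?b 1 x0 / c" using c by (simp add: pos_le_divide_eq mult_ac)
    with 4 show ?thesis by simp
  qed
  have "0 < ?b 1 x0"
    using vol_pos[OF m(1,2) scale_inv_pos[OF sf, of 1]] \<phi>[of 1] by (simp add: green_weight_def)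
  then have "0 < c * ?b 1 x0 / (C * M)" using c M by simp
  then show ?thesis using bounds by blast
qed

text \<open>
  The scale of the diameter and time 1 differ by a bounded factor.
\<close>
lemma top_weight_comparable:
  fixes m :: "'a::{heine_borel, second_countable_topology} measure"
  assumes m: "radon_measure m" "full_support m" "volume_scaling m R\<^sub>E d1 d2"
    and sf: "scale_function \<alpha>1 \<alpha>2 \<Phi>" and \<nu>: "levy_measure \<nu>"
    and \<phi>: "\<And>u. 0 < u \<Longrightarrow> 0 < laplace_exponent \<nu> u"
    and D: "bounded D" and bf: "boundary_function \<Phi> D \<gamma> h"
  shows "\<exists>c>0. \<exists>C>0. \<forall>x\<in>D. \<forall>y\<in>D. x \<noteq> y \<longrightarrow>
    c * h 1 x y \<le> h (\<Phi> (diameter D)) x y * green_weight m \<Phi> \<nu> (\<Phi> (diameter D)) x \<and>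
    h (\<Phi> (diameter D)) x y * green_weight m \<Phi> \<nu> (\<Phi> (diameter D)) x \<le> C * h 1 x y"
proof (cases "0 < \<Phi> (diameter D)")
  case False
  have "x = y" if "x \<in> D" "y \<in> D" for x y
  proof (rule ccontr)
    assume "x \<noteq> y"
    then have "0 < diameter D" using diameter_bounded_bound[OF D that] zero_less_dist_iff[of x y] by linarith
    then show False using scale_function_pos[OF sf] False by blast
  qed
  then show ?thesis by (intro exI[of _ 1] conjI) auto
next
  case pos: True
  let ?\<Theta> = "\<Phi> (diameter D)"
  obtain a A where a: "0 < a" "0 < A" "\<And>x. x \<in> D \<Longrightarrow> a \<le> green_weight m \<Phi> \<nu> ?\<Theta> x \<and> green_weight m \<Phi> \<nu> ?\<Theta> x \<le> A"
    using green_weight_bounds[OF m sf \<nu> \<phi> D pos order.refl] by blast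
  obtain Ch where Ch: "1 \<le> Ch" "\<And>x y s t. x \<in> D \<Longrightarrow> y \<in> D \<Longrightarrow> 0 < s \<Longrightarrow> s \<le> t \<Longrightarrow> ereal t < 4 * scale_diam \<Phi> D + 1 \<Longrightarrow>
      h s x y \<le> Ch * (t / s) powr \<gamma> * h t x y"
    using boundary_function_doubling[OF bf] by blast
  have sd: "scale_diam \<Phi> D = ereal ?\<Theta>" using D by (simp add: scale_diam_def)
  have four: "ereal 1 < 4 * scale_diam \<Phi> D + 1" "ereal ?\<Theta> < 4 * scale_diam \<Phi> D + 1"
    using pos by (auto simp: sd one_ereal_def)
  define k where "k = Ch * max ?\<Theta> (1 / ?\<Theta>) powr \<gamma>"
  have mx: "1 \<le> max ?\<Theta> (1 / ?\<Theta>)"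
    using pos by (cases "1 \<le> ?\<Theta>") (auto simp: le_max_iff_disj)
  have \<gamma>: "0 \<le> \<gamma>" using bf by (simp add: boundary_function_def)
  have k: "1 \<le> k" using mult_mono[OF Ch(1) ge_one_powr_ge_zero[OF mx \<gamma>]] Ch(1) by (simp add: k_def)
  have hh: "h 1 x y \<le> k * h ?\<Theta> x y \<and> h ?\<Theta> x y \<le> k * h 1 x y" if xy: "x \<in> D" "y \<in> D" for x y
  proof -
    have h0: "0 \<le> h 1 x y" "0 \<le> h ?\<Theta> x y" using bf xy pos by (auto simp: boundary_function_def)
    have mono: "h t x y \<le> h s x y" if "0 < s" "s \<le> t" for s t
      using bf xy that by (simp add: boundary_function_def)
    have k1: "z \<le> k * z" if "0 \<le> z" for z using mult_right_mono[OF k that] by simp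
    show ?thesis
    proof (cases "1 \<le> ?\<Theta>")
      case True
      have "h 1 x y \<le> Ch * (?\<Theta> / 1) powr \<gamma> * h ?\<Theta> x y" using Ch(2)[OF xy _ True four(2)] by simp
      also have "\<dots> \<le> k * h ?\<Theta> x y"
        unfolding k_def using True Ch(1) h0 \<gamma> by (intro mult_right_mono mult_left_mono powr_mono2) auto
      finally show ?thesis using order.trans[OF mono[OF _ True] k1[OF h0(1)]] by simp
    next
      case False
      have "h ?\<Theta> x y \<le> Ch * (1 / ?\<Theta>) powr \<gamma> * h 1 x y" using Ch(2)[OF xy pos _ four(1)] False by simp
      also have "\<dots> \<le> k * h 1 x y"
        unfolding k_def using pos Ch(1) h0 \<gamma> by (intro mult_right_mono mult_left_mono powr_mono2) auto
      finally show ?thesis using order.trans[OF mono[OF pos, of 1] k1[OF h0(2)]] False by simp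
    qed
  qed
  have "a / k * h 1 x y \<le> h ?\<Theta> x y * green_weight m \<Phi> \<nu> ?\<Theta> x \<and>
      h ?\<Theta> x y * green_weight m \<Phi> \<nu> ?\<Theta> x \<le> A * k * h 1 x y" if xy: "x \<in> D" "y \<in> D" for x y
  proof
    have h0: "0 \<le> h 1 x y" "0 \<le> h ?\<Theta> x y" using bf xy pos by (auto simp: boundary_function_def)
    have "h 1 x y / k * a \<le> h ?\<Theta> x y * green_weight m \<Phi> \<nu> ?\<Theta> x"
      using hh[OF xy] a(3)[OF xy(1)] a(1) k h0 by (intro mult_mono) (auto simp: pos_divide_le_eq mult.commute)
    then show "a / k * h 1 x y \<le> h ?\<Theta> x y * green_weight m \<Phi> \<nu> ?\<Theta> x" by (simp add: mult.commute)
    have "h ?\<Theta> x y * green_weight m \<Phi> \<nu> ?\<Theta> x \<le> (k * h 1 x y) * A"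
      using hh[OF xy] a(3)[OF xy(1)] a(1) k h0 by (intro mult_mono) auto
    then show "h ?\<Theta> x y * green_weight m \<Phi> \<nu> ?\<Theta> x \<le> A * k * h 1 x y" by (simp add: mult_ac)
  qed
  moreover have "0 < a / k" "0 < A * k" using a k by auto
  ultimately show ?thesis by blast
qed

theorem theorem5p8:
  fixes m :: "'a::{heine_borel, second_countable_topology} measure"
    and R\<^sub>E R1 :: ereal
    and D :: "'a set"
    and \<Phi> \<Psi> :: "real \<Rightarrow> real"
    and d1 d2 \<alpha>1 \<alpha>2 \<alpha>3 \<alpha>4 \<beta>1 \<beta>2 \<gamma> \<gamma>' C0 :: real
    and P :: "'a option \<Rightarrow> 'w measure"
    and Y :: "ennreal \<Rightarrow> 'w \<Rightarrow> 'a option"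
    and S :: "real \<Rightarrow> 'w \<Rightarrow> real"
    and \<nu> :: "real measure"
    and p h :: "real \<Rightarrow> 'a \<Rightarrow> 'a \<Rightarrow> real"
  assumes m: "radon_measure m" "full_support m" "volume_scaling m R\<^sub>E d1 d2"
    and D: "open D" "D \<noteq> UNIV"
    and scales: "scale_function \<alpha>1 \<alpha>2 \<Phi>" "scale_function \<alpha>3 \<alpha>4 \<Psi>" "\<forall>r\<ge>0. \<Phi> r \<le> \<Psi> r"
    and Y: "hunt_process D P Y"
    and S: "\<forall>x\<in>cemetery_space D. subordinator (P x) S \<nu>"
    and indep: "\<forall>x\<in>cemetery_space D. independent_processes D (P x) Y S"
    and p: "heat_kernel m D P Y p"
    and h: "boundary_function \<Phi> D \<gamma> h"
    and setting:
      "(Poly_tail R1 \<beta>1 \<beta>2 \<nu> \<and> HK_B m D \<Phi> \<Psi> C0 h p \<and> ereal (\<Phi> (diameter D)) < R1 / 8) \<or>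
       (Poly_tail \<infinity> \<beta>1 \<beta>2 \<nu> \<and> HK_U m R\<^sub>E D \<Phi> \<Psi> C0 h p)"
    and C0: "C0 = 0 \<or> \<gamma> < \<beta>1 + 1"
    and regular: "regular_boundary_function \<Phi> D h"
    and H2_star: "H2_star \<Phi> D \<gamma>' h"
  shows
    "(d1 > \<alpha>2 * min \<beta>2 1 \<or>
      (d1 = d2 \<and> d2 = \<alpha>1 * \<beta>1 \<and> \<alpha>1 * \<beta>1 = \<alpha>2 * \<beta>2) \<or>
      (d2 < \<alpha>1 * \<beta>1 \<and> d1 > \<alpha>2 * (min \<beta>2 1 - \<gamma>')) \<longrightarrow>
        comparable_off_diagonal D (green_function P S p)
          (\<lambda>x y. h (\<Phi> (dist x y)) x y * g0 m D \<nu> \<Phi> d1 d2 \<alpha>1 \<alpha>2 \<beta>1 \<beta>2 x y)) \<and>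
     (d2 < \<alpha>1 * (\<beta>1 - \<gamma>) \<longrightarrow>
        (HK_B m D \<Phi> \<Psi> C0 h p \<longrightarrow>
           comparable_off_diagonal D (green_function P S p) (\<lambda>x y. h 1 x y)) \<and>
        (HK_U m R\<^sub>E D \<Phi> \<Psi> C0 h p \<longrightarrow>
           (\<forall>x\<in>D. \<forall>y\<in>D. x \<noteq> y \<longrightarrow> green_function P S p x y = \<infinity>))) \<and>
     (\<alpha>1 = \<alpha>2 \<and> \<beta>1 = \<beta>2 \<and> \<gamma> = \<gamma>' \<and> d1 = d2 \<and> d2 = \<alpha>1 * (\<beta>1 - \<gamma>) \<longrightarrow>
        (HK_B m D \<Phi> \<Psi> C0 h p \<longrightarrow>
           comparable_off_diagonal D (green_function P S p)
             (\<lambda>x y. h 1 x y * ln (exp 1 + diameter D / max (dist x y) (delta_max D x y)))) \<and>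
        (HK_U m R\<^sub>E D \<Phi> \<Psi> C0 h p \<longrightarrow>
           (\<forall>x\<in>D. \<forall>y\<in>D. x \<noteq> y \<longrightarrow> green_function P S p x y = \<infinity>)))"
proof -
  have \<Phi>\<Psi>: "\<And>r. 0 \<le> r \<Longrightarrow> \<Phi> r \<le> \<Psi> r" using scales(3) by blast
  have subS: "\<And>x. x \<in> D \<Longrightarrow> subordinator (P (Some x)) S \<nu>" using S by auto
  have \<nu>: "levy_measure \<nu>" using S by (auto simp: subordinator_def)
  have \<alpha>: "0 < \<alpha>1" "0 < \<alpha>2" "\<alpha>1 \<le> \<alpha>2"
    using scale_function_exponents_pos[OF scales(1)] scale_function_exponents_le[OF scales(1)] by auto
  have d: "d1 \<le> d2" "0 < d1" using m(3) by (auto simp: volume_scaling_def)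
  \<comment> \<open>In both settings the Levy tail is controlled at all scales up to that of the diameter.\<close>
  obtain R where poly: "Poly_tail R \<beta>1 \<beta>2 \<nu>" and R: "\<And>t. ereal t \<le> scale_diam \<Phi> D \<Longrightarrow> ereal t < R"
  proof (cases "bounded D")
    case True
    then have 1: "Poly_tail R1 \<beta>1 \<beta>2 \<nu>" "ereal (\<Phi> (diameter D)) < R1 / 8"
      using setting by (auto simp: HK_U_def)
    then have "0 < R1" by (simp add: Poly_tail_def)
    then have "R1 / 8 \<le> R1" by (cases R1) auto
    with 1(2) have "ereal (\<Phi> (diameter D)) < R1" by (rule less_le_trans)
    then have "ereal t < R1" if "ereal t \<le> scale_diam \<Phi> D" for t
    proof -
      have "ereal t \<le> ereal (\<Phi> (diameter D))" using that True by (simp add: scale_diam_def)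
      then show ?thesis using \<open>ereal (\<Phi> (diameter D)) < R1\<close> by (rule le_less_trans)
    qed
    then show thesis using 1(1) by (rule that[rotated])
  next
    case False
    then have "Poly_tail \<infinity> \<beta>1 \<beta>2 \<nu>" using setting by (auto simp: HK_B_def)
    then show thesis by (rule that) simp
  qed
  have RE: "bounded D \<or> R\<^sub>E = \<infinity>" using setting by (auto simp: HK_B_def HK_U_def)
  have \<beta>: "0 < \<beta>1" "\<beta>1 \<le> \<beta>2" using poly by (auto simp: Poly_tail_def)
  have \<beta>1: "\<beta>1 \<le> 1" by (rule Poly_tail_exponent_le_1[OF \<nu> poly])
  have \<phi>: "0 < laplace_exponent \<nu> u" if "0 < u" for u
  proof -
    have "0 < R" using poly by (simp add: Poly_tail_def)
    then obtain r where "0 < ereal r" "ereal r < R" using ereal_dense2 by blast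
    then show ?thesis using laplace_exponent_pos[OF \<nu> _ Poly_tail_pos[OF poly] that] by simp
  qed
  obtain cp Cp where cp: "0 < cp" "0 < Cp" and \<phi>_scaling: "\<And>s t. 0 < s \<Longrightarrow> s \<le> t \<Longrightarrow> ereal t \<le> scale_diam \<Phi> D \<Longrightarrow>
       cp * (t / s) powr \<beta>1 * laplace_exponent \<nu> (1 / t) \<le> laplace_exponent \<nu> (1 / s) \<and>
       laplace_exponent \<nu> (1 / s) \<le> Cp * (t / s) powr min \<beta>2 1 * laplace_exponent \<nu> (1 / t)"
    using laplace_exponent_scaling[OF \<nu> poly] R by blast
  obtain K where K: "1 < K" "\<And>r. 0 < r \<Longrightarrow> ereal r \<le> scale_diam \<Phi> D \<Longrightarrow>
      24 * laplace_exponent \<nu> (1 / r) \<le> laplace_exponent \<nu> (K / r)"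
    using laplace_growth_factor[where adm = "\<lambda>t. ereal t \<le> scale_diam \<Phi> D",
          OF cp(1) \<beta>(1) conjunct1[OF \<phi>_scaling] \<phi>]
    by blast
  \<comment> \<open>Zero whenever possible; with jumps, the hypothesis on C0 says that this exponent exceeds minus the lower tail exponent.\<close>
  define \<theta> where "\<theta> = (if C0 = 0 then 0 else min 0 (1 - \<gamma>))"
  have \<theta>: "\<theta> \<le> 0" "C0 = 0 \<or> \<theta> \<le> 1 - \<gamma>" "0 < \<theta> + \<beta>1"
    using C0 \<beta> by (auto simp: \<theta>_def min_def)
  obtain kC kc kl where kb: "kernel_bounds m D \<Phi> h p K \<theta> kC kc kl"
    using setting kernel_bounds_bounded[OF _ m scales(1,2) \<Phi>\<Psi> h K(1) \<theta>(1,2)]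
      kernel_bounds_unbounded[OF _ m scales(1,2) \<Phi>\<Psi> h K(1) \<theta>(1,2)] by blast
  note G = green_function_comparable_series[where P = P and S = S and \<nu> = \<nu> and D = D,
      OF subS \<nu> m(1,2) scales(1) h \<phi> cp(1) conjunct1[OF \<phi>_scaling] K \<theta>(1,3) kb]
  have vp: "\<And>x r. 0 < r \<Longrightarrow> 0 < vol m x r" by (rule vol_pos[OF m(1,2)])
  let ?b = "green_weight m \<Phi> \<nu>" and ?\<Theta> = "\<Phi> (diameter D)"
  \<comment> \<open>The exponents that separate the cases of the theorem.\<close>
  define p1 p2 where "p1 = \<beta>1 - d2 / \<alpha>1" and "p2 = min \<beta>2 1 - d1 / \<alpha>2"
  have L: "scale_inv \<Phi> t \<le> diameter D \<or> R\<^sub>E = \<infinity>" if "0 < t" "ereal t \<le> scale_diam \<Phi> D" for t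
  proof (cases "bounded D")
    case True
    then have "t \<le> ?\<Theta>" using that by (simp add: scale_diam_def)
    then have "scale_inv \<Phi> t \<le> scale_inv \<Phi> ?\<Theta>" by (rule scale_inv_mono[OF scales(1)])
    then show ?thesis using scale_inv_scale[OF scales(1) diameter_ge_0[OF True]] by simp
  next
    case False
    then show ?thesis using RE by simp
  qed
  obtain cb Cb where cb: "0 < cb" "0 < Cb" and weight_scaling: "\<And>x s t. 0 < s \<Longrightarrow> s \<le> t \<Longrightarrow> ereal t \<le> scale_diam \<Phi> D \<Longrightarrow>
     cb * (t / s) powr p1 * ?b s x \<le> ?b t x \<and> ?b t x \<le> Cb * (t / s) powr p2 * ?b s x"
    using green_weight_scaling[where adm = "\<lambda>t. ereal t \<le> scale_diam \<Phi> D", OF scales(1) vp m(3) \<phi> cp \<phi>_scaling L]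
    unfolding p1_def p2_def by blast
  interpret green_series D \<Phi> \<alpha>1 \<alpha>2 \<gamma> \<gamma>' p1 p2 K h ?b "green_function P S p"
  proof
    show "0 < ?b s x" if "x \<in> D" "0 < s" for x s
      using vp[OF scale_inv_pos[OF scales(1) that(2)]] \<phi> that by (simp add: green_weight_def)
    show "\<exists>c>0. \<exists>C>0. \<forall>x\<in>D. \<forall>s t. 0 < s \<and> s \<le> t \<and> ereal t \<le> scale_diam \<Phi> D \<longrightarrow>
       c * (t / s) powr p1 * ?b s x \<le> ?b t x \<and> ?b t x \<le> C * (t / s) powr p2 * ?b s x"
      using weight_scaling cb by blast
  qed (use scales(1) D h regular H2_star K(1) G in auto)
  have psi_b: "psi \<nu> \<Phi> r / vol m x r = ?b (\<Phi> r) x" if "0 \<le> r" for r x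
    by (rule psi_over_vol_eq_weight[OF scales(1) that])
  have top_b: "\<exists>c>0. \<exists>C>0. \<forall>x\<in>D. \<forall>y\<in>D. x \<noteq> y \<longrightarrow> c * h 1 x y \<le> h ?\<Theta> x y * ?b ?\<Theta> x \<and> h ?\<Theta> x y * ?b ?\<Theta> x \<le> C * h 1 x y"
    if "bounded D"
    by (rule top_weight_comparable[OF m scales(1) \<nu> \<phi> that h])
  \<comment> \<open>The branches of g0 are tested in order; this excludes the first one in the other two cases.\<close>
  have not_local: "\<not> d1 > \<alpha>2 * min \<beta>2 1" if "d1 \<le> \<alpha>1 * \<beta>1"
  proof -
    have "\<alpha>1 * \<beta>1 \<le> \<alpha>2 * min \<beta>2 1" using \<alpha> \<beta> \<beta>1 by (intro mult_mono) auto
    then show ?thesis using that by simp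
  qed
  show ?thesis
  proof (intro conjI impI)
    assume cases: "d1 > \<alpha>2 * min \<beta>2 1 \<or>
      (d1 = d2 \<and> d2 = \<alpha>1 * \<beta>1 \<and> \<alpha>1 * \<beta>1 = \<alpha>2 * \<beta>2) \<or>
      (d2 < \<alpha>1 * \<beta>1 \<and> d1 > \<alpha>2 * (min \<beta>2 1 - \<gamma>'))"
    let ?g = "\<lambda>x y. h (\<Phi> (dist x y)) x y * g0 m D \<nu> \<Phi> d1 d2 \<alpha>1 \<alpha>2 \<beta>1 \<beta>2 x y"
    consider (short_range) "d1 > \<alpha>2 * min \<beta>2 1"
      | (critical) "d1 = d2" "d2 = \<alpha>1 * \<beta>1" "\<alpha>1 * \<beta>1 = \<alpha>2 * \<beta>2"
      | (long_range) "d2 < \<alpha>1 * \<beta>1" "d1 > \<alpha>2 * (min \<beta>2 1 - \<gamma>')"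
      using cases by blast
    then show "comparable_off_diagonal D (green_function P S p) ?g"
    proof cases
      case short_range
      then have "p2 < 0" using \<alpha> by (simp add: p2_def pos_less_divide_eq mult.commute)
      from green_local_scale[OF this] show ?thesis
        using short_range by (simp add: g0_def psi_b)
    next
      case critical
      have "\<alpha>1 = \<alpha>2"
      proof (rule ccontr)
        assume "\<alpha>1 \<noteq> \<alpha>2"
        then have "\<alpha>1 * \<beta>1 < \<alpha>2 * \<beta>1" using \<alpha> \<beta> by (intro mult_strict_right_mono) auto
        also have "\<dots> \<le> \<alpha>2 * \<beta>2" using \<alpha> \<beta> by (intro mult_left_mono) auto
        finally show False using critical by simp
      qed
      then have eq: "\<beta>1 = \<beta>2" using critical \<alpha> by simp
      have p: "p1 = 0" "p2 = 0"
        using critical \<alpha> \<open>\<alpha>1 = \<alpha>2\<close> eq \<beta>1 by (auto simp: p1_def p2_def)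
      have "cb * ?b s x \<le> ?b t x \<and> ?b t x \<le> Cb * ?b s x" if "0 < s" "s \<le> t" "ereal t \<le> scale_diam \<Phi> D" for s t x
        using weight_scaling[OF that, of x] that by (simp add: p)
      then obtain cu Cu where "0 < cu" "\<And>x s. x \<in> D \<Longrightarrow> 0 < s \<Longrightarrow> ereal s \<le> scale_diam \<Phi> D \<Longrightarrow> cu \<le> ?b s x \<and> ?b s x \<le> Cu"
        using green_weight_uniform[OF m scales(1) \<nu> \<phi> RE cb] by blast
      from green_logarithmic[OF this] show ?thesis
        using critical not_local by (simp add: g0_def)
    next
      case long_range
      have p: "0 < p1" "p2 < \<gamma>'"
      proof -
        show "0 < p1" using long_range \<alpha> by (simp add: p1_def pos_divide_less_eq mult.commute)
        have "min \<beta>2 1 - \<gamma>' < d1 / \<alpha>2"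
          unfolding pos_less_divide_eq[OF \<alpha>(2)] using long_range(2) by (simp add: mult.commute)
        then show "p2 < \<gamma>'" by (simp add: p2_def)
      qed
      have g: "g0 m D \<nu> \<Phi> d1 d2 \<alpha>1 \<alpha>2 \<beta>1 \<beta>2 x y = ?b (\<Phi> (reach x y)) x" for x y
      proof -
        have "0 \<le> reach x y" by (simp add: reach_def le_max_iff_disj)
        then show ?thesis using long_range d not_local psi_b[of "reach x y" x]
          by (simp add: g0_def reach_def)
      qed
      have "\<exists>c>0. \<exists>C>0. \<forall>x\<in>D. \<forall>y\<in>D. x \<noteq> y \<longrightarrow>
          c * ?b (\<Phi> (reach x y)) x \<le> ?b (\<Delta> x y) x \<and> ?b (\<Delta> x y) x \<le> C * ?b (\<Phi> (reach x y)) x"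
      proof (cases "bounded D \<and> D \<noteq> {} \<and> 0 < ?\<Theta>")
        case True
        obtain L where L: "0 < L" "\<And>x y. x \<in> D \<Longrightarrow> y \<in> D \<Longrightarrow> reach x y \<le> L"
          using reach_bounded True by blast
        obtain c C where c: "0 < c" "0 < C" "\<And>x s. x \<in> D \<Longrightarrow> ?\<Theta> \<le> s \<Longrightarrow> s \<le> max ?\<Theta> (\<Phi> L) \<Longrightarrow> c \<le> ?b s x \<and> ?b s x \<le> C"
          using green_weight_bounds[OF m scales(1) \<nu> \<phi>, of D ?\<Theta> "max ?\<Theta> (\<Phi> L)"] True by (metis max.cobounded1)
        have "min 1 (c / C) * ?b (\<Phi> (reach x y)) x \<le> ?b (\<Delta> x y) x \<and>
            ?b (\<Delta> x y) x \<le> max 1 (C / c) * ?b (\<Phi> (reach x y)) x"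
          if xy: "x \<in> D" "y \<in> D" "x \<noteq> y" for x y
        proof (cases "ereal (\<Phi> (reach x y)) \<le> scale_diam \<Phi> D")
          case adm: True
          have "0 < ?b (\<Phi> (reach x y)) x"
            by (rule b_pos[OF xy(1) scale_function_pos[OF scales(1) reach_pos[OF xy]]])
          moreover have "min 1 (c / C) * z \<le> z \<and> z \<le> max 1 (C / c) * z" if "0 < z" for z :: real
            using that mult_right_mono[of "min 1 (c / C)" 1 z] mult_right_mono[of 1 "max 1 (C / c)" z] by simp
          ultimately show ?thesis using adm by (simp add: \<Delta>_def)
        next
          case nadm: False
          have De: "\<Delta> x y = ?\<Theta>" using nadm by (simp add: \<Delta>_def)
          have "?\<Theta> \<le> \<Phi> (reach x y)" using nadm True by (simp add: scale_diam_def)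
          moreover have "\<Phi> (reach x y) \<le> \<Phi> L"
            using reach_pos[OF xy] L(2)[OF xy(1,2)] by (intro scale_function_mono[OF scales(1)]) auto
          ultimately have u: "c \<le> ?b (\<Phi> (reach x y)) x" "?b (\<Phi> (reach x y)) x \<le> C" using c(3)[OF xy(1)] by auto
          have v: "c \<le> ?b ?\<Theta> x" "?b ?\<Theta> x \<le> C" using c(3)[OF xy(1)] by auto
          have "min 1 (c / C) * ?b (\<Phi> (reach x y)) x \<le> c / C * C" using u c by (intro mult_mono) auto
          moreover have "C / c * c \<le> max 1 (C / c) * ?b (\<Phi> (reach x y)) x" using u c by (intro mult_mono) auto
          ultimately show ?thesis using v c De by auto
        qed
        moreover have "0 < min 1 (c / C)" "0 < max 1 (C / c)" using c by auto
        ultimately show ?thesis by blast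
      next
        case False
        have "\<Delta> x y = \<Phi> (reach x y)" if xy: "x \<in> D" "y \<in> D" "x \<noteq> y" for x y
        proof -
          have "\<not> bounded D"
            using False xy T_pos[OF xy] T_adm[OF xy] by (auto simp: scale_diam_def)
          then show ?thesis by (simp add: \<Delta>_def scale_diam_def)
        qed
        then show ?thesis by (intro exI[of _ 1] conjI) auto
      qed
      then obtain c C where c: "0 < c" "0 < C" "\<And>x y. x \<in> D \<Longrightarrow> y \<in> D \<Longrightarrow> x \<noteq> y \<Longrightarrow>
          c * ?b (\<Phi> (reach x y)) x \<le> ?b (\<Delta> x y) x \<and> ?b (\<Delta> x y) x \<le> C * ?b (\<Phi> (reach x y)) x" by blast
      show ?thesis
      proof (rule comparable_off_diagonal_cong[OF green_intermediate_scale[OF p] c(1,2)])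
        fix x y assume xy: "x \<in> D" "y \<in> D" "x \<noteq> y"
        note h0 = h_nonneg[OF xy T_pos[OF xy]]
        show "c * ?g x y \<le> h (\<Phi> (dist x y)) x y * ?b (\<Delta> x y) x \<and> h (\<Phi> (dist x y)) x y * ?b (\<Delta> x y) x \<le> C * ?g x y"
          using mult_left_mono[OF conjunct1[OF c(3)[OF xy]] h0] mult_left_mono[OF conjunct2[OF c(3)[OF xy]] h0]
          by (simp add: g mult.left_commute)
      qed
    qed
  next
    assume "d2 < \<alpha>1 * (\<beta>1 - \<gamma>)" and hk: "HK_B m D \<Phi> \<Psi> C0 h p"
    then have "d2 / \<alpha>1 < \<beta>1 - \<gamma>"
      unfolding pos_divide_less_eq[OF \<alpha>(1)] by (simp add: mult.commute)
    then have p: "\<gamma> < p1" by (simp add: p1_def)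
    have bd: "bounded D" using hk by (simp add: HK_B_def)
    obtain c C where c: "0 < c" "0 < C" "\<And>x y. x \<in> D \<Longrightarrow> y \<in> D \<Longrightarrow> x \<noteq> y \<Longrightarrow>
        c * h 1 x y \<le> h ?\<Theta> x y * ?b ?\<Theta> x \<and> h ?\<Theta> x y * ?b ?\<Theta> x \<le> C * h 1 x y"
      using top_b[OF bd] by blast
    show "comparable_off_diagonal D (green_function P S p) (\<lambda>x y. h 1 x y)"
      by (rule comparable_off_diagonal_cong[OF green_top_scale[OF bd p] c])
  next
    fix x y
    assume "d2 < \<alpha>1 * (\<beta>1 - \<gamma>)" and hk: "HK_U m R\<^sub>E D \<Phi> \<Psi> C0 h p"
    then have "d2 / \<alpha>1 < \<beta>1 - \<gamma>"
      unfolding pos_divide_less_eq[OF \<alpha>(1)] by (simp add: mult.commute)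
    then have p: "\<gamma> \<le> p1" by (simp add: p1_def)
    have unb: "\<not> bounded D" using hk by (simp add: HK_U_def)
    show "\<forall>x\<in>D. \<forall>y\<in>D. x \<noteq> y \<longrightarrow> green_function P S p x y = \<infinity>"
      using green_infinite[OF unb p] by blast
  next
    assume eq: "\<alpha>1 = \<alpha>2 \<and> \<beta>1 = \<beta>2 \<and> \<gamma> = \<gamma>' \<and> d1 = d2 \<and> d2 = \<alpha>1 * (\<beta>1 - \<gamma>)"
      and hk: "HK_B m D \<Phi> \<Psi> C0 h p"
    have bd: "bounded D" using hk by (simp add: HK_B_def)
    have p: "p1 = \<gamma>" "p2 = \<gamma>" "\<gamma>' = \<gamma>" using eq \<alpha> \<beta>1 by (auto simp: p1_def p2_def)
    obtain c C where c: "0 < c" "0 < C" "\<And>x y. x \<in> D \<Longrightarrow> y \<in> D \<Longrightarrow> x \<noteq> y \<Longrightarrow>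
        c * h 1 x y \<le> h ?\<Theta> x y * ?b ?\<Theta> x \<and> h ?\<Theta> x y * ?b ?\<Theta> x \<le> C * h 1 x y"
      using top_b[OF bd] by blast
    obtain cl Cl where cl: "0 < cl" "0 < Cl" "\<And>x y. x \<in> D \<Longrightarrow> y \<in> D \<Longrightarrow> x \<noteq> y \<Longrightarrow>
       cl * ln (exp 1 + diameter D / reach x y) \<le> 1 + ln (?\<Theta> / \<Delta> x y) \<and>
       1 + ln (?\<Theta> / \<Delta> x y) \<le> Cl * ln (exp 1 + diameter D / reach x y)"
      using top_log_ratio_comparable[OF bd] by blast
    have cc: "0 < c * cl" "0 < C * Cl" using c cl by auto
    show "comparable_off_diagonal D (green_function P S p)
        (\<lambda>x y. h 1 x y * ln (exp 1 + diameter D / max (dist x y) (delta_max D x y)))"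
    proof (rule comparable_off_diagonal_cong[OF green_top_logarithmic[OF bd p] cc])
      fix x y assume xy: "x \<in> D" "y \<in> D" "x \<noteq> y"
      define W where "W = ln (exp 1 + diameter D / reach x y)"
      have h0: "0 \<le> h 1 x y" by (rule h_nonneg[OF xy]) simp
      have W: "0 \<le> W" unfolding W_def using diameter_ge_0[OF bd] reach_pos[OF xy]
        by (intro ln_ge_zero) (auto intro: order.trans[of _ "exp 1"])
      define U Z where "U = h ?\<Theta> x y * ?b ?\<Theta> x" and "Z = 1 + ln (?\<Theta> / \<Delta> x y)"
      have U: "c * h 1 x y \<le> U" "U \<le> C * h 1 x y" using c(3)[OF xy] by (simp_all add: U_def)
      have Z: "cl * W \<le> Z" "Z \<le> Cl * W" using cl(3)[OF xy] by (simp_all add: Z_def W_def)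
      have pos: "0 \<le> c * h 1 x y" "0 \<le> C * h 1 x y" "0 \<le> cl * W" using c cl h0 W by simp_all
      have "(c * h 1 x y) * (cl * W) \<le> U * Z"
        by (rule mult_mono[OF U(1) Z(1)]) (use U pos in linarith)+
      moreover have "U * Z \<le> (C * h 1 x y) * (Cl * W)"
        by (rule mult_mono[OF U(2) Z(2)]) (use Z pos in linarith)+
      ultimately show "c * cl * (h 1 x y * ln (exp 1 + diameter D / max (dist x y) (delta_max D x y)))
          \<le> h ?\<Theta> x y * ?b ?\<Theta> x * (1 + ln (?\<Theta> / \<Delta> x y)) \<and>
        h ?\<Theta> x y * ?b ?\<Theta> x * (1 + ln (?\<Theta> / \<Delta> x y))
          \<le> C * Cl * (h 1 x y * ln (exp 1 + diameter D / max (dist x y) (delta_max D x y)))"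
        by (simp add: U_def Z_def W_def reach_def mult_ac)
    qed
  next
    assume eq: "\<alpha>1 = \<alpha>2 \<and> \<beta>1 = \<beta>2 \<and> \<gamma> = \<gamma>' \<and> d1 = d2 \<and> d2 = \<alpha>1 * (\<beta>1 - \<gamma>)"
      and hk: "HK_U m R\<^sub>E D \<Phi> \<Psi> C0 h p"
    have p: "\<gamma> \<le> p1" using eq \<alpha> by (auto simp: p1_def)
    have unb: "\<not> bounded D" using hk by (simp add: HK_U_def)
    show "\<forall>x\<in>D. \<forall>y\<in>D. x \<noteq> y \<longrightarrow> green_function P S p x y = \<infinity>"
      using green_infinite[OF unb p] by blast
  qed
qed

end
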